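(* Let $D \subset \mathbb{C}$ be a bounded domain and let $p \in \partial D$ be a $C^2$-smooth boundary point. Suppose that there exist a constant $k$ with $0 \le k < 1$, a point $a \in D$ and a sequence of $k$-quasiconformal harmonic diffeomorphisms $\phi_j : D \to D$ of $D$ onto itself (with the same $k$ for all $j$) such that $\phi_j(a)$ converges to $p$ as $j \to \infty$. Then there exists a $k$-quasiconformal harmonic diffeomorphism $\phi : D \to \mathbb{H}^2$ of $D$ onto $\mathbb{H}^2$.
   Context: A domain is a nonempty connected open set. $\mathbb{H}^2 = \{x + iy \in \mathbb{C} : y > 0\}$ is the upper half-plane. A point $p \in \partial D$ is a $C^2$-smooth boundary point if there are a neighbourhood $U$ of $p$ and a real-valued $C^2$-smooth function $\rho$ on $U$ such that $U \cap D = \{z \in U : \rho(z) < 0\}$ and $d\rho \ne 0$ on $U \cap \partial D$. A complex-valued map $f = u + iv$ on a domain in $\mathbb{C}$ is harmonic if $u$ and $v$ are both real harmonic functions (the Cauchy--Riemann equations are not required). For $0 \le k < 1$, an orientation-preserving diffeomorphism $f$ of a domain $D$ onto a domain $D' \subset \mathbb{C}$ is called $k$-quasiconformal if its complex dilatation $\mu_f = f_{\overline{z}}/f_z$ satisfies $|\mu_f| \le k$ on $D$; equivalently, the second complex dilatation $\omega_f = \overline{f_{\overline{z}}}/f_z$ satisfies $|\omega_f| \le k$ on $D$. A $k$-quasiconformal harmonic diffeomorphism is a map that is both harmonic and a $k$-quasiconformal (orientation-preserving) diffeomorphism onto the target domain. *)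

theory Defs
  imports "HOL-Analysis.Analysis"
begin

definition planar_domain :: "complex set \<Rightarrow> bool" where
  "planar_domain D \<longleftrightarrow> D \<noteq> {} \<and> connected D \<and> open D"

definition upper_half_plane :: "complex set" where
  "upper_half_plane = {z. Im z > 0}"

text \<open>
  Class \<open>C\<^sup>n\<close> on a set, meant for open sets. Since the source is finite-dimensional,
  continuity of the derivative as a map into the linear maps amounts to continuity of each
  directional derivative.
\<close>
fun Ck_on :: "nat \<Rightarrow> ('a::euclidean_space \<Rightarrow> 'b::real_normed_vector) \<Rightarrow> 'a set \<Rightarrow> bool" where
  "Ck_on 0 f S \<longleftrightarrow> continuous_on S f"
| "Ck_on (Suc n) f S \<longleftrightarrow>
     (\<forall>x\<in>S. f differentiable (at x)) \<and>
     (\<forall>v. Ck_on n (\<lambda>x. frechet_derivative f (at x) v) S)"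

definition smooth_on :: "('a::euclidean_space \<Rightarrow> 'b::real_normed_vector) \<Rightarrow> 'a set \<Rightarrow> bool" where
  "smooth_on f S \<longleftrightarrow> (\<forall>n. Ck_on n f S)"

definition C2_boundary_point :: "complex set \<Rightarrow> complex \<Rightarrow> bool" where
  "C2_boundary_point D p \<longleftrightarrow> p \<in> frontier D \<and>
     (\<exists>U (\<rho> :: complex \<Rightarrow> real).
        open U \<and> p \<in> U \<and> Ck_on 2 \<rho> U \<and>
        U \<inter> D = {z \<in> U. \<rho> z < 0} \<and>
        (\<forall>z \<in> U \<inter> frontier D. frechet_derivative \<rho> (at z) \<noteq> (\<lambda>_. 0)))"

definition dx :: "(complex \<Rightarrow> 'b::real_normed_vector) \<Rightarrow> complex \<Rightarrow> 'b" where
  "dx f z = frechet_derivative f (at z) 1"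

definition dy :: "(complex \<Rightarrow> 'b::real_normed_vector) \<Rightarrow> complex \<Rightarrow> 'b" where
  "dy f z = frechet_derivative f (at z) \<i>"

definition real_harmonic_on :: "(complex \<Rightarrow> real) \<Rightarrow> complex set \<Rightarrow> bool" where
  "real_harmonic_on u D \<longleftrightarrow> Ck_on 2 u D \<and> (\<forall>z\<in>D. dx (dx u) z + dy (dy u) z = 0)"

definition harmonic_map_on :: "(complex \<Rightarrow> complex) \<Rightarrow> complex set \<Rightarrow> bool" where
  "harmonic_map_on f D \<longleftrightarrow>
     real_harmonic_on (\<lambda>z. Re (f z)) D \<and> real_harmonic_on (\<lambda>z. Im (f z)) D"

definition diffeomorphism_onto ::
    "(complex \<Rightarrow> complex) \<Rightarrow> complex set \<Rightarrow> complex set \<Rightarrow> bool" where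
  "diffeomorphism_onto f D D' \<longleftrightarrow>
     bij_betw f D D' \<and> smooth_on f D \<and> smooth_on (inv_into D f) D'"

definition jacobian_det :: "(complex \<Rightarrow> complex) \<Rightarrow> complex \<Rightarrow> real" where
  "jacobian_det f z = Re (dx f z) * Im (dy f z) - Re (dy f z) * Im (dx f z)"

definition orientation_preserving_on :: "(complex \<Rightarrow> complex) \<Rightarrow> complex set \<Rightarrow> bool" where
  "orientation_preserving_on f D \<longleftrightarrow> (\<forall>z\<in>D. jacobian_det f z > 0)"

definition d_z :: "(complex \<Rightarrow> complex) \<Rightarrow> complex \<Rightarrow> complex" where
  "d_z f z = (dx f z - \<i> * dy f z) / 2"

definition d_zbar :: "(complex \<Rightarrow> complex) \<Rightarrow> complex \<Rightarrow> complex" where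
  "d_zbar f z = (dx f z + \<i> * dy f z) / 2"

text \<open>
  The division is only used where the Jacobian determinant, which is
  \<open>|f\<^sub>z|\<^sup>2 - |f\<^sub>z\<^sub>b\<^sub>a\<^sub>r|\<^sup>2\<close>, is positive, so that \<open>f\<^sub>z \<noteq> 0\<close>.
\<close>
definition complex_dilatation :: "(complex \<Rightarrow> complex) \<Rightarrow> complex \<Rightarrow> complex" where
  "complex_dilatation f z = d_zbar f z / d_z f z"

definition quasiconformal_diffeo ::
    "real \<Rightarrow> (complex \<Rightarrow> complex) \<Rightarrow> complex set \<Rightarrow> complex set \<Rightarrow> bool" where
  "quasiconformal_diffeo k f D D' \<longleftrightarrow>
     diffeomorphism_onto f D D' \<and> orientation_preserving_on f D \<and>
     (\<forall>z\<in>D. cmod (complex_dilatation f z) \<le> k)"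

definition qc_harmonic_diffeo ::
    "real \<Rightarrow> (complex \<Rightarrow> complex) \<Rightarrow> complex set \<Rightarrow> complex set \<Rightarrow> bool" where
  "qc_harmonic_diffeo k f D D' \<longleftrightarrow> harmonic_map_on f D \<and> quasiconformal_diffeo k f D D'"

end

theory Submission
  imports Defs "HOL-Complex_Analysis.Complex_Analysis"
begin

text \<open>
  The proof is a scaling argument. Let \<open>q\<^sub>j\<close> be a point of the boundary nearest to \<open>\<phi>\<^sub>j(a)\<close> and
  \<open>\<delta>\<^sub>j = |\<phi>\<^sub>j(a) - q\<^sub>j|\<close>. With a suitable unimodular constant \<open>c\<close>, which turns the inner normal at
  \<open>p\<close> into the direction of the imaginary axis, the maps \<open>f\<^sub>j = (\<phi>\<^sub>j - q\<^sub>j) / (c \<delta>\<^sub>j)\<close> are again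
  \<open>k\<close>-quasiconformal harmonic and injective, they omit \<open>0\<close>, satisfy \<open>|f\<^sub>j(a)| = 1\<close>, and since \<open>p\<close> is
  a smooth boundary point their images \<open>f\<^sub>j(D)\<close> look on every fixed disc more and more like the
  upper half-plane (\<open>C2_boundary_point_half_plane_approximation\<close>). The required map is a limit of
  the \<open>f\<^sub>j\<close>.

  All compactness comes from one distortion estimate, \<open>qc_harnack\<close>: if an injective map \<open>f\<close> on
  \<open>ball z\<^sub>0 r\<close> with \<open>k\<close>-quasiconformal inverse omits \<open>e\<close>, then \<open>|f - e|\<close> varies at most by a
  factor depending on \<open>k\<close> alone on \<open>cball z\<^sub>0 (r/2)\<close>. It is proved by the length-area method: the
  circles around \<open>e\<close> that separate two values of \<open>f\<close> all have to cross the image of an annulus.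
  The estimate is used in both directions.

    \<^item> For the \<open>f\<^sub>j\<close> and \<open>e = 0\<close>, along chains of discs, it shows that the \<open>f\<^sub>j\<close> are locally uniformly
      bounded. The two Wirtinger derivatives of a harmonic map are a holomorphic and an
      antiholomorphic function, so Montel's theorem applies to them, and a subsequence of the \<open>f\<^sub>j\<close>
      converges with its first derivatives to a harmonic map \<open>F\<close> (\<open>harmonic_montel\<close>).

    \<^item> For the inverse maps and all \<open>e \<notin> D\<close>, it shows that the preimages of a point of the half-plane
      stay in a compact subset of \<open>D\<close> (\<open>qc_harmonic_preimages_stay_inside\<close>). Hence \<open>F\<close> takes every
      value in the half-plane; in particular it is not constant.

  Now Hurwitz' theorem shows that the holomorphic function \<open>F\<^sub>z\<close> has no zeros, because the
  \<open>(f\<^sub>j)\<^sub>z\<close> have none and \<open>F\<^sub>z = 0\<close> would force \<open>F\<close> to be constant. So \<open>F\<close> is a local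
  diffeomorphism with \<open>|F\<^sub>z\<^sub>b\<^sub>a\<^sub>r| \<le> k |F\<^sub>z|\<close>, it inherits injectivity from the \<open>f\<^sub>j\<close>, and its image is
  open and contained in the closed, hence in the open half-plane. Smoothness of \<open>F\<close> and of its
  inverse follows because all their derivatives are algebraic expressions in holomorphic functions
  and their conjugates.
\<close>

section \<open>Area and Fubini in the plane\<close>

lemma borel_measurable_vector_2 [measurable]:
  "(\<lambda>(x,y). vector [x,y] :: real^2) \<in> borel_measurable borel"
proof -
  have "linear (\<lambda>(x,y). vector [x,y] :: real^2)"
    by (rule linearI) (auto simp: vec_eq_iff forall_2)
  then show ?thesis
    by (intro borel_measurable_continuous_onI linear_continuous_on) (simp add: linear_conv_bounded_linear)
qed

lemma lborel_real2_eq_distr: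
  "(lborel :: (real^2) measure) = distr (lborel :: (real \<times> real) measure) borel (\<lambda>(x,y). vector [x,y])"
proof (rule lborel_eqI)
  fix l u :: "real^2" assume le: "\<And>b. b \<in> Basis \<Longrightarrow> l \<bullet> b \<le> u \<bullet> b"
  have le': "l$1 \<le> u$1" "l$2 \<le> u$2"
    using le[of "axis 1 1"] le[of "axis 2 1"] by (auto simp: inner_axis)
  have "(\<lambda>(x,y). vector [x,y] :: real^2) -` box l u = box (l$1, l$2) (u$1, u$2)"
    by (auto simp: box_def Basis_vec_def forall_2 inner_axis Basis_prod_def)
  moreover have "(\<Prod>b\<in>Basis. (u - l) \<bullet> b) = (u$1 - l$1) * (u$2 - l$2)"
  proof -
    have B: "Basis = {axis 1 1, axis 2 1 :: real^2}"
      using exhaust_2 by (auto simp: Basis_vec_def) (metis exhaust_2)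
    have "axis 1 1 \<noteq> (axis 2 1 :: real^2)" by (simp add: axis_eq_axis)
    then show ?thesis unfolding B by (simp add: inner_axis)
  qed
  moreover have "emeasure lborel (box (l$1, l$2) (u$1, u$2)) = (u$1 - l$1) * (u$2 - l$2)"
    using le' by (subst emeasure_lborel_box_eq) (auto simp: Basis_prod_def prod.union_disjoint)
  ultimately show "emeasure (distr lborel borel (\<lambda>(x,y). vector [x,y] :: real^2)) (box l u) = (\<Prod>b\<in>Basis. (u - l) \<bullet> b)"
    by (simp add: emeasure_distr)
qed simp

lemma nn_integral_real2:
  assumes "f \<in> borel_measurable borel"
  shows "integral\<^sup>N lborel (f :: real^2 \<Rightarrow> ennreal) = (\<integral>\<^sup>+x. \<integral>\<^sup>+y. f (vector [x,y]) \<partial>lborel \<partial>lborel)"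
proof -
  note [measurable] = assms
  have "integral\<^sup>N lborel f = (\<integral>\<^sup>+p. f (case p of (x,y) \<Rightarrow> vector [x,y]) \<partial>(lborel :: (real \<times> real) measure))"
    by (subst lborel_real2_eq_distr, subst nn_integral_distr) auto
  also have "\<dots> = (\<integral>\<^sup>+x. \<integral>\<^sup>+y. f (vector [x,y]) \<partial>lborel \<partial>lborel)"
    by (subst lborel_prod[symmetric], subst lborel.nn_integral_fst[symmetric])
       (auto simp: lborel_prod)
  finally show ?thesis .
qed

text \<open>
  The double integral is that of the Jacobian of \<open>G\<close> over \<open>S\<close>, hence the area of \<open>G ` S\<close>; this image
  lies in a square of side \<open>2 r\<close>. The change of variables is carried out in \<open>real ^ 2\<close>, and the result is
  written as an iterated integral because it is used line by line.
\<close>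

lemma area_formula_ineq:
  fixes G :: "complex \<Rightarrow> complex"
  assumes S: "open S" and inj: "inj_on G S"
    and der: "\<And>z. z \<in> S \<Longrightarrow> (G has_derivative (\<lambda>h. A z * h + B z * cnj h)) (at z)"
    and img: "G ` S \<subseteq> ball z0 r" and r: "0 < r"
    and A: "continuous_on S A" and B: "continuous_on S B"
  shows "(\<integral>\<^sup>+x. \<integral>\<^sup>+y. indicator S (Complex x y) * ennreal \<bar>(cmod (A (Complex x y)))\<^sup>2 - (cmod (B (Complex x y)))\<^sup>2\<bar> \<partial>lborel \<partial>lborel) \<le> ennreal (4 * r\<^sup>2)"
proof -
  define c where "c = (\<lambda>v::real^2. Complex (v$1) (v$2))"
  define d where "d = (\<lambda>z. vector [Re z, Im z] :: real^2)"
  have [simp]: "c (d z) = z" for z by (simp add: c_def d_def)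
  have [simp]: "d (c v) = v" for v by (simp add: c_def d_def vec_eq_iff forall_2)
  have lc: "linear c" by (rule linearI) (auto simp: c_def complex_eq_iff)
  have ld: "linear d" by (rule linearI) (auto simp: d_def vec_eq_iff forall_2)
  have blc: "bounded_linear c" and bld: "bounded_linear d"
    using lc ld linear_conv_bounded_linear by blast+
  have contc: "continuous_on X c" for X by (simp add: lc linear_continuous_on linear_linear)
  let ?S = "c -` S"
  let ?G = "\<lambda>v. d (G (c v))"
  let ?D = "\<lambda>v h. d (A (c v) * c h + B (c v) * cnj (c h))"
  have oS: "open ?S" using contc[of UNIV] S by (simp add: open_vimage)
  have derG: "(?G has_derivative ?D v) (at v within ?S)" if "v \<in> ?S" for v
  proof -
    have "(G has_derivative (\<lambda>h. A (c v) * h + B (c v) * cnj h)) (at (c v))" using der that by auto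
    then have "((\<lambda>v. G (c v)) has_derivative (\<lambda>h. A (c v) * c h + B (c v) * cnj (c h))) (at v)"
      using has_derivative_compose[OF bounded_linear_imp_has_derivative[OF blc]] by blast
    then have "(?G has_derivative ?D v) (at v)"
      using bounded_linear.has_derivative[OF bld] by blast
    then show ?thesis by (rule has_derivative_at_withinI)
  qed
  have injG: "inj_on ?G ?S"
  proof (rule inj_onI)
    fix x y assume "x \<in> ?S" "y \<in> ?S" "d (G (c x)) = d (G (c y))"
    then have "G (c x) = G (c y)" by (metis \<open>\<And>z. c (d z) = z\<close>)
    then have "c x = c y" using inj \<open>x \<in> ?S\<close> \<open>y \<in> ?S\<close> by (auto dest: inj_onD)
    then show "x = y" by (metis \<open>\<And>v. d (c v) = v\<close>)
  qed
  have det: "\<bar>det (matrix (?D v))\<bar> = \<bar>(cmod (A (c v)))\<^sup>2 - (cmod (B (c v)))\<^sup>2\<bar>" for v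
  proof -
    have "det (matrix (?D v)) = (cmod (A (c v)))\<^sup>2 - (cmod (B (c v)))\<^sup>2"
      unfolding det_2 matrix_def
      by (simp add: d_def c_def axis_def cmod_power2) (simp add: algebra_simps power2_eq_square)
    then show ?thesis by simp
  qed
  have "continuous_on ?S ?G"
    using derG has_derivative_continuous continuous_on_eq_continuous_within by blast
  then have "open (?G ` ?S)" using invariance_of_domain injG oS by blast
  moreover have sub: "?G ` ?S \<subseteq> cbox (d z0 - vector[r,r]) (d z0 + vector[r,r])"
  proof
    fix w assume "w \<in> ?G ` ?S"
    then obtain z where z: "w = d z" "z \<in> ball z0 r" using img by auto
    then have "\<bar>Re z0 - Re z\<bar> < r" "\<bar>Im z0 - Im z\<bar> < r"
      by (metis abs_Re_le_cmod abs_Im_le_cmod dist_norm mem_ball order_le_less_trans minus_complex.simps)+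
    then show "w \<in> cbox (d z0 - vector[r,r]) (d z0 + vector[r,r])"
      unfolding z by (auto simp: mem_box_cart forall_2 d_def)
  qed
  ultimately have lm: "?G ` ?S \<in> lmeasurable"
    using bounded_subset[OF bounded_cbox] by (metis lmeasurable_open)
  have "measure lebesgue (?G ` ?S) \<le> measure lebesgue (cbox (d z0 - vector[r,r]) (d z0 + vector[r,r]))"
    by (rule measure_mono_fmeasurable[OF sub]) (use lm in auto)
  also have "\<dots> = 4 * r\<^sup>2"
  proof -
    have "cbox (d z0 - vector[r,r]) (d z0 + vector[r,r]) \<noteq> {}"
      unfolding interval_ne_empty_cart using r by (auto simp: forall_2)
    then show ?thesis
      by (simp add: content_cbox_cart UNIV_2 d_def power2_eq_square)
  qed
  finally have m: "measure lebesgue (?G ` ?S) \<le> 4 * r\<^sup>2" .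
  have "((\<lambda>v. \<bar>det (matrix (?D v))\<bar>) has_integral measure lebesgue (?G ` ?S)) ?S"
    using has_measure_differentiable_image[of ?S ?G ?D] derG injG lm oS by auto
  then have "integral\<^sup>N lborel (\<lambda>v. indicator ?S v * ennreal \<bar>det (matrix (?D v))\<bar>) = measure lebesgue (?G ` ?S)"
    using nn_integral_has_integral_lebesgue[of ?S "\<lambda>v. \<bar>det (matrix (?D v))\<bar>"] by (simp add: ennreal_mult' ennreal_indicator)
  then have I: "integral\<^sup>N lborel (\<lambda>v. indicator ?S v * ennreal \<bar>(cmod (A (c v)))\<^sup>2 - (cmod (B (c v)))\<^sup>2\<bar>) \<le> 4 * r\<^sup>2"
    unfolding det using m by (simp add: ennreal_leI)
  have meas: "(\<lambda>v. indicator ?S v * ennreal \<bar>(cmod (A (c v)))\<^sup>2 - (cmod (B (c v)))\<^sup>2\<bar>) \<in> borel_measurable borel"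
  proof -
    have "continuous_on ?S (\<lambda>v. \<bar>(cmod (A (c v)))\<^sup>2 - (cmod (B (c v)))\<^sup>2\<bar>)"
      by (intro continuous_on_rabs continuous_on_diff continuous_on_power continuous_on_norm
            continuous_on_compose2[OF A contc] continuous_on_compose2[OF B contc]) auto
    then have "(\<lambda>v. indicator ?S v *\<^sub>R \<bar>(cmod (A (c v)))\<^sup>2 - (cmod (B (c v)))\<^sup>2\<bar>) \<in> borel_measurable borel"
      by (intro borel_measurable_continuous_on_indicator) (use oS in auto)
    then have "(\<lambda>v. ennreal (indicator ?S v *\<^sub>R \<bar>(cmod (A (c v)))\<^sup>2 - (cmod (B (c v)))\<^sup>2\<bar>)) \<in> borel_measurable borel"
      by measurable
    then show ?thesis by (simp add: ennreal_mult' ennreal_indicator)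
  qed
  have "c (vector [x,y]) = Complex x y" for x y by (simp add: c_def)
  then show ?thesis
    using I nn_integral_real2[OF meas] by (simp add: indicator_vimage)
qed

section \<open>Length of curves that cross an annulus\<close>

text \<open>
  A circle around \<open>e\<close> inside \<open>V\<close> would have winding number 1 about a point outside \<open>V\<close>.
\<close>

lemma circle_meets_complement_of_simply_connected:
  assumes "simply_connected V" "e \<notin> V" "0 < t"
  obtains w where "cmod (w - e) = t" "w \<notin> V"
proof -
  have "\<not> path_image (circlepath e t) \<subseteq> V"
    using simply_connected_imp_winding_number_zero[OF assms(1), of "circlepath e t" e]
      winding_number_circlepath_centre[of t e] assms by auto
  moreover have "path_image (circlepath e t) = sphere e t" using assms by simp
  ultimately obtain w where "w \<in> sphere e t" "w \<notin> V" by blast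
  then have "cmod (w - e) = t" by (simp add: dist_norm norm_minus_commute)
  then show ?thesis using that \<open>w \<notin> V\<close> by blast
qed

lemma polar_representation:
  assumes "cmod (w - e) = exp x"
  obtains y where "0 \<le> y" "y \<le> 2 * pi" "w = e + exp (Complex x y)"
proof
  show "0 \<le> Arg2pi (w - e)" "Arg2pi (w - e) \<le> 2 * pi"
    using Arg2pi_ge_0 Arg2pi_lt_2pi by (auto intro: less_imp_le)
  have "w - e = of_real (exp x) * exp (\<i> * of_real (Arg2pi (w - e)))"
    using Arg2pi_eq[of "w - e"] assms by simp
  also have "\<dots> = exp (Complex x (Arg2pi (w - e)))"
    by (simp add: Complex_eq exp_add exp_of_real)
  finally show "w = e + exp (Complex x (Arg2pi (w - e)))" by (simp add: algebra_simps)
qed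

lemma crossing_interval_aux:
  fixes m :: "real \<Rightarrow> real"
  assumes "continuous_on {a..b} m" "a \<le> b" "m a < q" "q \<le> m b"
  obtains d where "a < d" "d \<le> b" "m d = q" "\<And>y. a \<le> y \<Longrightarrow> y < d \<Longrightarrow> m y < q"
proof -
  let ?S = "{y \<in> {a..b}. m y = q}"
  have "closed ?S" 
    by (rule continuous_closed_preimage_constant[OF assms(1)]) simp
  moreover have "bounded ?S" by (rule bounded_subset[of "{a..b}"]) auto
  ultimately have "compact ?S" by (simp add: compact_eq_bounded_closed)
  moreover have "?S \<noteq> {}" using IVT'[of m a q b] assms by auto
  ultimately obtain d where d: "d \<in> ?S" "\<And>y. y \<in> ?S \<Longrightarrow> d \<le> y"
    using compact_attains_inf[of ?S] by blast
  have below: "m y < q" if y: "a \<le> y" "y < d" for y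
  proof (rule ccontr)
    assume "\<not> m y < q"
    moreover have "continuous_on {a..y} m"
      by (rule continuous_on_subset[OF assms(1)]) (use d(1) y in auto)
    ultimately have "\<exists>x. a \<le> x \<and> x \<le> y \<and> m x = q" using IVT'[of m a q y] assms(3) y by auto
    then obtain x where "a \<le> x" "x \<le> y" "m x = q" by blast
    then show False using d(2)[of x] d(1) y by auto
  qed
  have "a \<noteq> d" using d(1) assms(3) by auto
  then show ?thesis using that[of d] d(1) below by auto
qed

text \<open>
  The values \<open>\<le> p\<close> and \<open>\<ge> q\<close> may be taken in either order; the second order is reduced to the first
  by reflection.
\<close>

lemma crossing_interval:
  fixes m :: "real \<Rightarrow> real"
  assumes "continuous_on {a..b} m" "s \<in> {a..b}" "t \<in> {a..b}" "m s \<le> p" "p < q" "q \<le> m t"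
  obtains c d where "a \<le> c" "c < d" "d \<le> b" "(m c \<le> p \<and> m d = q) \<or> (m d \<le> p \<and> m c = q)"
    "\<And>y. c < y \<Longrightarrow> y < d \<Longrightarrow> m y < q"
proof (cases "s \<le> t")
  case True
  have "continuous_on {s..t} m"
    by (rule continuous_on_subset[OF assms(1)]) (use assms(2,3) in auto)
  then obtain d where "s < d" "d \<le> t" "m d = q" "\<And>y. s \<le> y \<Longrightarrow> y < d \<Longrightarrow> m y < q"
    using crossing_interval_aux[of s t m q] True assms by auto
  then show ?thesis using that[of s d] assms by (metis atLeastAtMost_iff order_less_imp_le order_le_less order_trans)
next
  case False
  have "continuous_on {-s..-t} (\<lambda>y. m (-y))"
    by (rule continuous_on_compose2[OF assms(1)]) (use assms in \<open>auto intro!: continuous_intros\<close>)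
  then obtain d where d: "-s < d" "d \<le> -t" "m (-d) = q" "\<And>y. -s \<le> y \<Longrightarrow> y < d \<Longrightarrow> m (-y) < q"
    using crossing_interval_aux[of "-s" "-t" "\<lambda>y. m (-y)" q] False assms by auto
  have d': "m y < q" if "-d < y" "y \<le> s" for y using d(4)[of "-y"] that by auto
  show ?thesis by (rule that[of "-d" s]) (use d d' assms in auto)
qed

text \<open>
  Cauchy-Schwarz in the form \<open>L\<^sup>2 \<le> (\<integral>|h'|)\<^sup>2 \<le> (d - c) \<integral>|h'|\<^sup>2\<close>, where the path \<open>h\<close> has length at
  least \<open>L\<close>. The open interval in the conclusion is the part of a line on which a point is known to lie
  in the interior of the set over which the area is integrated.
\<close>

lemma energy_lower_bound:
  fixes h :: "real \<Rightarrow> complex"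
  assumes cd: "c < d" "d - c \<le> T"
    and der: "\<And>y. y \<in> {c..d} \<Longrightarrow> (h has_vector_derivative h' y) (at y)"
    and cont: "continuous_on {c..d} h'"
    and L: "0 < L" "L \<le> cmod (h d - h c)"
  shows "(\<integral>\<^sup>+y. indicator {c<..<d} y * ennreal ((cmod (h' y))\<^sup>2) \<partial>lborel) \<ge> ennreal (L\<^sup>2 / T)"
proof -
  define I where "I = integral {c..d} (\<lambda>y. (cmod (h' y))\<^sup>2)"
  have T: "0 < T" using cd by simp
  have int2: "(\<lambda>y. (cmod (h' y))\<^sup>2) integrable_on {c..d}"
    by (intro integrable_continuous_real continuous_intros cont)
  have ftc: "(h' has_integral (h d - h c)) {c..d}"
    by (rule fundamental_theorem_of_calculus) (use cd in \<open>auto intro!: has_vector_derivative_at_within[OF der]\<close>)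
  have "cmod (h d - h c) = cmod (integral {c..d} h')" using ftc by (simp add: integral_unique)
  also have "\<dots> \<le> integral {c..d} (\<lambda>y. T / (2 * L) * (cmod (h' y))\<^sup>2 + L / (2 * T))"
  proof (rule integral_norm_bound_integral)
    show "h' integrable_on {c..d}" using ftc by blast
    show "(\<lambda>y. T / (2 * L) * (cmod (h' y))\<^sup>2 + L / (2 * T)) integrable_on {c..d}"
      by (intro integrable_continuous_real continuous_intros cont)
    fix y
    \<comment> \<open>the arithmetic-geometric mean inequality, balanced for \<open>|h'| = L / T\<close>\<close>
    have "0 \<le> (T * cmod (h' y) - L)\<^sup>2 / (2 * L * T)" using L T by simp
    also have "\<dots> = T / (2 * L) * (cmod (h' y))\<^sup>2 + L / (2 * T) - cmod (h' y)"
      using L T by (simp add: field_simps power2_eq_square)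
    finally show "cmod (h' y) \<le> T / (2 * L) * (cmod (h' y))\<^sup>2 + L / (2 * T)" by simp
  qed
  also have "\<dots> = T / (2 * L) * I + L / (2 * T) * (d - c)"
    unfolding I_def using int2 cd L
    by (subst integral_add) (auto intro!: integrable_continuous_real continuous_intros cont)
  also have "L / (2 * T) * (d - c) \<le> L / 2"
  proof -
    have "L / (2 * T) * (d - c) \<le> L / (2 * T) * T" using cd L T by (intro mult_left_mono) auto
    then show ?thesis using T by simp
  qed
  finally have "L \<le> T / (2 * L) * I + L / 2" using L by simp
  then have "L\<^sup>2 / T \<le> I" using L T by (simp add: field_simps power2_eq_square)
  moreover have "((\<lambda>y. (cmod (h' y))\<^sup>2) has_integral I) {c<..<d}"
    using int2 unfolding I_def by (simp add: has_integral_Icc_iff_Ioo[symmetric] integrable_integral)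
  then have "(\<integral>\<^sup>+y. indicator {c<..<d} y * ennreal ((cmod (h' y))\<^sup>2) \<partial>lborel) = ennreal I"
    using nn_integral_has_integral_lebesgue[of "{c<..<d}" "\<lambda>y. (cmod (h' y))\<^sup>2" I]
    by (simp add: ennreal_mult' ennreal_indicator)
  ultimately show ?thesis by (simp add: ennreal_leI)
qed

section \<open>Distortion of quasiconformal maps omitting a value\<close>

text \<open>
  The exponent is what the proof of \<open>qc_harnack\<close> gives for the logarithm of the ratio of two values;
  \<open>(1 + k) / (1 - k)\<close> is the maximal dilatation of a map whose complex dilatation is bounded by \<open>k\<close>.
\<close>

definition qc_constant :: "real \<Rightarrow> real" where
  "qc_constant k = exp (128 * pi * (1 + k) / (1 - k))"

text \<open>
  For the linear map \<open>h \<mapsto> a h + b cnj h\<close> this compares the square of the operator norm with the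
  Jacobian.
\<close>

lemma dilatation_ineq:
  assumes "0 \<le> k" "k < 1" "cmod b \<le> k * cmod a"
  shows "(cmod a + cmod b)\<^sup>2 \<le> (1 + k) / (1 - k) * \<bar>(cmod a)\<^sup>2 - (cmod b)\<^sup>2\<bar>"
proof -
  have "k * cmod a \<le> cmod a" using assms by (simp add: mult_left_le_one_le)
  then have ba: "cmod b \<le> cmod a" using assms by linarith
  have "(1 - k) * (cmod a + cmod b) \<le> (1 + k) * (cmod a - cmod b)"
    using assms by (simp add: algebra_simps)
  then have "(cmod a + cmod b) * ((1 - k) * (cmod a + cmod b)) \<le> (cmod a + cmod b) * ((1 + k) * (cmod a - cmod b))"
    by (intro mult_left_mono) auto
  then have "(1 - k) * (cmod a + cmod b)\<^sup>2 \<le> (1 + k) * ((cmod a)\<^sup>2 - (cmod b)\<^sup>2)"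
    by (simp add: algebra_simps power2_eq_square)
  then have "(cmod a + cmod b)\<^sup>2 \<le> (1 + k) / (1 - k) * ((cmod a)\<^sup>2 - (cmod b)\<^sup>2)"
    using assms by (simp add: field_simps)
  then show ?thesis using ba by (simp add: abs_of_nonneg power_mono)
qed

text \<open>
  The length-area method. In the logarithmic coordinate \<open>w = e + exp z\<close> the circles around \<open>e\<close> become
  vertical lines \<open>Re z = x\<close> with \<open>0 \<le> Im z \<le> 2 pi\<close>. If \<open>exp x\<close> lies strictly between \<open>|f z2 - e|\<close> and
  \<open>|f z1 - e|\<close>, the circle meets \<open>f ` cball z0 (r/2)\<close>, which is connected, and leaves
  \<open>V = f ` ball z0 (3 r / 4)\<close>, which is simply connected and does not contain \<open>e\<close>. So \<open>g\<close> maps a part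
  of it to a curve of length at least \<open>r / 4\<close>, and by Cauchy-Schwarz the integral of \<open>|g'|\<^sup>2\<close> along it is
  bounded below. Integration over \<open>x\<close> bounds the length of the interval of such \<open>x\<close>, since by
  quasiconformality the double integral of \<open>|g'|\<^sup>2\<close> is at most a constant times the area of
  \<open>ball z0 (3 r / 4)\<close>; the radius \<open>r\<close> cancels.
\<close>

lemma qc_harnack:
  fixes f g A B :: "complex \<Rightarrow> complex"
  assumes k: "0 \<le> k" "k < 1" and r: "0 < r"
    and contf: "continuous_on (ball z0 r) f"
    and inv: "\<And>z. z \<in> ball z0 r \<Longrightarrow> g (f z) = z"
    and der: "\<And>w. w \<in> f ` ball z0 r \<Longrightarrow> (g has_derivative (\<lambda>h. A w * h + B w * cnj h)) (at w)"
    and dil: "\<And>w. w \<in> f ` ball z0 r \<Longrightarrow> cmod (B w) \<le> k * cmod (A w)"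
    and contA: "continuous_on (f ` ball z0 r) A" and contB: "continuous_on (f ` ball z0 r) B"
    and e: "e \<notin> f ` ball z0 r"
    and z1: "z1 \<in> cball z0 (r/2)" and z2: "z2 \<in> cball z0 (r/2)"
  shows "cmod (f z1 - e) \<le> qc_constant k * cmod (f z2 - e)"
proof -
  define W where "W = f ` ball z0 r"
  define r1 where "r1 = 3 * r / 4"
  define V where "V = f ` ball z0 r1"
  define K where "K = (1 + k) / (1 - k)"
  have K: "0 < K" using k by (simp add: K_def)
  have r1: "0 < r1" "r/2 < r1" "r1 < r" using r by (auto simp: r1_def)
  have sub: "cball z0 (r/2) \<subseteq> ball z0 r1" "ball z0 r1 \<subseteq> cball z0 r1" "cball z0 r1 \<subseteq> ball z0 r"
    using r1 by auto
  have injf: "inj_on f (ball z0 r)" using inv by (metis inj_onI)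
  have cf: "continuous_on (ball z0 r1) f" "continuous_on (cball z0 r1) f" "continuous_on (cball z0 (r/2)) f"
    using contf sub by (meson continuous_on_subset order_trans)+
  have gf: "f (g w) = w" "g w \<in> ball z0 r" if "w \<in> W" for w
    using that inv by (auto simp: W_def)
  have contg: "continuous_on W g"
    unfolding W_def by (intro continuous_at_imp_continuous_on ballI has_derivative_continuous[OF der])
  have oV: "open V" unfolding V_def
    using invariance_of_domain[OF cf(1) open_ball] inj_on_subset[OF injf] sub by blast
  have VW: "V \<subseteq> W" unfolding V_def W_def using sub by blast
  have gV: "g w \<in> ball z0 r1" if "w \<in> V" for w using that inv r1 by (auto simp: V_def)
  have scV: "simply_connected V"
  proof -
    have "homeomorphism (ball z0 r1) V f g"
      unfolding homeomorphism_def V_def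
      using cf(1) continuous_on_subset[OF contg VW] inv r1 by (auto simp: V_def image_iff) 
    then have "(ball z0 r1) homeomorphic V" by (auto simp: homeomorphic_def)
    then show ?thesis using homeomorphic_simply_connected_eq convex_imp_simply_connected convex_ball by blast
  qed
  have eV: "e \<notin> V" using e VW by (auto simp: W_def)
  have ne: "f z1 \<noteq> e" "f z2 \<noteq> e" using e z1 z2 r1 by auto
  define \<alpha> where "\<alpha> = ln (cmod (f z2 - e))"
  define \<beta> where "\<beta> = ln (cmod (f z1 - e))"
  have ex: "exp \<alpha> = cmod (f z2 - e)" "exp \<beta> = cmod (f z1 - e)"
    using ne by (auto simp: \<alpha>_def \<beta>_def)
  define P where "P = (\<lambda>z. e + exp z)"
  define \<Sigma> where "\<Sigma> = {z. 0 < Im z \<and> Im z < 2 * pi} \<inter> P -` V"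
  define A' where "A' = (\<lambda>z. A (P z) * exp z)"
  define B' where "B' = (\<lambda>z. B (P z) * cnj (exp z))"
  have contP: "continuous_on X P" for X unfolding P_def by (intro continuous_intros)
  have o\<Sigma>: "open \<Sigma>"
    unfolding \<Sigma>_def by (intro open_Int open_vimage oV contP open_Collect_conj open_Collect_less continuous_intros)
  have derG: "((\<lambda>z. g (P z)) has_derivative (\<lambda>h. A' z * h + B' z * cnj h)) (at z)" if "P z \<in> W" for z
  proof -
    have "(P has_derivative (\<lambda>h. exp z * h)) (at z)"
      unfolding P_def has_field_derivative_def[symmetric] by (auto intro!: derivative_eq_intros)
    from has_derivative_compose[OF this der[of "P z"]] show ?thesis
      using that by (simp add: A'_def B'_def W_def mult_ac)
  qed
  have dil': "cmod (B' z) \<le> k * cmod (A' z)" if "P z \<in> W" for z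
    using dil[of "P z"] that by (auto simp: A'_def B'_def W_def norm_mult mult.assoc[symmetric] intro: mult_right_mono)
  have P\<Sigma>: "P ` \<Sigma> \<subseteq> W" using VW by (auto simp: \<Sigma>_def)
  have contA': "continuous_on X A'" if "P ` X \<subseteq> W" for X
    unfolding A'_def using that
    by (intro continuous_intros continuous_on_compose2[OF contA contP]) (auto simp: W_def)
  have contB': "continuous_on X B'" if "P ` X \<subseteq> W" for X
    unfolding B'_def using that
    by (intro continuous_intros continuous_on_compose2[OF contB contP]) (auto simp: W_def)
  have inj: "inj_on (\<lambda>z. g (P z)) \<Sigma>"
  proof (rule inj_onI)
    fix z z' assume z: "z \<in> \<Sigma>" "z' \<in> \<Sigma>" "g (P z) = g (P z')"
    then have "P z = P z'" using gf(1) P\<Sigma> by (metis image_subset_iff)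
    then have E: "exp z = exp z'" by (simp add: P_def)
    have "0 < Im z" "Im z < 2 * pi" "0 < Im z'" "Im z' < 2 * pi"
      using z(1,2) by (simp_all add: \<Sigma>_def)
    then have "\<bar>Im z - Im z'\<bar> < 2 * pi" by linarith
    then show "z = z'" using E by (rule exp_complex_eqI)
  qed
  have area: "(\<integral>\<^sup>+x. \<integral>\<^sup>+y. indicator \<Sigma> (Complex x y) * ennreal \<bar>(cmod (A' (Complex x y)))\<^sup>2 - (cmod (B' (Complex x y)))\<^sup>2\<bar> \<partial>lborel \<partial>lborel) \<le> ennreal (4 * r1\<^sup>2)"
    by (rule area_formula_ineq[OF o\<Sigma> inj derG _ r1(1) contA' contB', of z0])
       (use P\<Sigma> gV in \<open>auto simp: \<Sigma>_def\<close>)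
  \<comment> \<open>the energy on the circle of radius \<open>exp x\<close>\<close>
  have lower: "(\<integral>\<^sup>+y. indicator \<Sigma> (Complex x y) * ennreal \<bar>(cmod (A' (Complex x y)))\<^sup>2 - (cmod (B' (Complex x y)))\<^sup>2\<bar> \<partial>lborel)
       \<ge> ennreal ((r/4)\<^sup>2 / (2 * pi) / K)" if x: "\<alpha> < x" "x < \<beta>" for x
  proof -
    obtain w1 where w1: "w1 \<in> f ` cball z0 (r/2)" "cmod (w1 - e) = exp x"
    proof -
      have "connected ((\<lambda>z. cmod (f z - e)) ` cball z0 (r/2))"
        by (intro connected_continuous_image continuous_intros cf(3)) auto
      moreover have "exp \<alpha> \<in> (\<lambda>z. cmod (f z - e)) ` cball z0 (r/2)" "exp \<beta> \<in> (\<lambda>z. cmod (f z - e)) ` cball z0 (r/2)"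
        unfolding ex using z1 z2 by blast+
      ultimately have "exp x \<in> (\<lambda>z. cmod (f z - e)) ` cball z0 (r/2)"
        using x by (meson connectedD_interval exp_le_cancel_iff less_imp_le)
      then show ?thesis using that by force
    qed
    obtain w2 where w2: "cmod (w2 - e) = exp x" "w2 \<notin> V"
      using circle_meets_complement_of_simply_connected[OF scV eV, of "exp x"] by auto
    obtain y1 where y1: "0 \<le> y1" "y1 \<le> 2 * pi" "w1 = P (Complex x y1)"
      using polar_representation[OF w1(2)] by (auto simp: P_def)
    obtain y2 where y2: "0 \<le> y2" "y2 \<le> 2 * pi" "w2 = P (Complex x y2)"
      using polar_representation[OF w2(1)] by (auto simp: P_def)
    define \<gamma> where "\<gamma> = (\<lambda>y. P (Complex x y))"
    \<comment> \<open>\<open>M\<close> extends \<open>|g - z0|\<close> continuously to the whole plane; it is \<open>< r1\<close> exactly on \<open>V\<close>\<close>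
    define M where "M = (\<lambda>w. if w \<in> f ` cball z0 r1 then cmod (g w - z0) else r1)"
    have MV: "M w < r1" if "w \<in> V" for w
      using gV[OF that] that r1 by (auto simp: M_def V_def dist_norm norm_minus_commute)
    have MV': "w \<in> V" if "M w < r1" for w
    proof -
      have "w \<in> f ` cball z0 r1" using that by (auto simp: M_def split: if_splits)
      then obtain z where z: "z \<in> cball z0 r1" "w = f z" by auto
      then have "g w = z" using inv r1 by auto
      then show ?thesis using that z by (auto simp: M_def V_def dist_norm norm_minus_commute)
    qed
    have Mle: "M w \<le> r1" for w
      using inv r1 by (fastforce simp: M_def dist_norm norm_minus_commute)
    have contM: "continuous_on UNIV M"
    proof -
      have "closed (f ` cball z0 r1)" by (intro compact_imp_closed compact_continuous_image cf(2)) auto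
      moreover have "closed (- V)" using oV by auto
      moreover have "continuous_on (f ` cball z0 r1) (\<lambda>w. cmod (g w - z0))"
        using sub by (intro continuous_intros continuous_on_subset[OF contg]) (auto simp: W_def)
      moreover have "cmod (g w - z0) = r1" if "w \<in> f ` cball z0 r1" "w \<in> - V" for w
        using MV'[of w] Mle[of w] that by (fastforce simp: M_def)
      ultimately have "continuous_on (f ` cball z0 r1 \<union> - V) M"
        unfolding M_def by (intro continuous_on_cases) auto
      moreover have "f ` cball z0 r1 \<union> - V = UNIV" using r1 by (auto simp: V_def)
      ultimately show ?thesis by simp
    qed
    have cont\<gamma>: "continuous_on X \<gamma>" for X unfolding \<gamma>_def P_def Complex_eq by (intro continuous_intros)
    have "continuous_on {0..2*pi} (\<lambda>y. M (\<gamma> y))"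
      by (rule continuous_on_compose2[OF contM cont\<gamma>]) auto
    moreover have "M (\<gamma> y1) \<le> r/2"
    proof -
      obtain z where z: "z \<in> cball z0 (r/2)" "w1 = f z" using w1 by auto
      then have "g w1 = z" "w1 \<in> f ` cball z0 r1" using inv r1 by auto
      then show ?thesis using z y1 by (simp add: M_def \<gamma>_def dist_norm norm_minus_commute)
    qed
    moreover have "r1 \<le> M (\<gamma> y2)" using MV'[of w2] w2 y2 by (force simp: \<gamma>_def)
    moreover have "y1 \<in> {0..2*pi}" "y2 \<in> {0..2*pi}" using y1 y2 by auto
    \<comment> \<open>a piece of the circle inside \<open>V\<close> on which \<open>M\<close> runs from \<open>r/2\<close> to \<open>r1\<close>\<close>
    ultimately obtain c d where cd: "0 \<le> c" "c < d" "d \<le> 2*pi"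
      "(M (\<gamma> c) \<le> r/2 \<and> M (\<gamma> d) = r1) \<or> (M (\<gamma> d) \<le> r/2 \<and> M (\<gamma> c) = r1)"
      "\<And>y. c < y \<Longrightarrow> y < d \<Longrightarrow> M (\<gamma> y) < r1"
      using crossing_interval[of 0 "2*pi" "\<lambda>y. M (\<gamma> y)" y1 y2 "r/2" r1] r1 by metis
    have clo: "\<gamma> y \<in> f ` cball z0 r1" if y: "y \<in> {c..d}" for y
    proof -
      have "closed (f ` cball z0 r1)" by (intro compact_imp_closed compact_continuous_image cf(2)) auto
      moreover have "\<gamma> ` {c<..<d} \<subseteq> f ` cball z0 r1"
        using cd(5) MV' r1 by (fastforce simp: V_def)
      ultimately have "\<gamma> ` closure {c<..<d} \<subseteq> f ` cball z0 r1"
        by (intro image_closure_subset cont\<gamma>) auto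
      then show ?thesis using y cd(2) by auto
    qed
    define h' where "h' = (\<lambda>y. A' (Complex x y) * \<i> + B' (Complex x y) * cnj \<i>)"
    have inW: "P (Complex x y) \<in> W" if "y \<in> {c..d}" for y
      using clo[OF that] r1 by (auto simp: \<gamma>_def W_def)
    have "(\<integral>\<^sup>+y. indicator {c<..<d} y * ennreal ((cmod (h' y))\<^sup>2) \<partial>lborel) \<ge> ennreal ((r/4)\<^sup>2 / (2*pi))"
    proof (rule energy_lower_bound)
      show "c < d" "d - c \<le> 2 * pi" "0 < r/4" using cd r by auto
      show "((\<lambda>y. g (\<gamma> y)) has_vector_derivative h' y) (at y)" if "y \<in> {c..d}" for y
      proof -
        have "((\<lambda>y. Complex x y) has_derivative (\<lambda>t. of_real t * \<i>)) (at y)"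
          unfolding Complex_eq by (auto intro!: derivative_eq_intros)
        from has_derivative_compose[OF this derG[OF inW[OF that]]] show ?thesis
          unfolding has_vector_derivative_def \<gamma>_def h'_def
          by (simp add: algebra_simps scaleR_conv_of_real)
      qed
      have "continuous_on {c..d} (\<lambda>y. A' (Complex x y))" "continuous_on {c..d} (\<lambda>y. B' (Complex x y))"
        by (rule continuous_on_compose2[OF contA'[of "Complex x ` {c..d}"]] continuous_on_compose2[OF contB'[of "Complex x ` {c..d}"]];
            use inW in \<open>auto simp: Complex_eq intro!: continuous_intros\<close>)+
      then show "continuous_on {c..d} h'" unfolding h'_def by (intro continuous_intros)
      have Mg: "M (\<gamma> y) = cmod (g (\<gamma> y) - z0)" if "y \<in> {c..d}" for y
        using clo[OF that] by (simp add: M_def)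
      have "\<bar>cmod (g (\<gamma> d) - z0) - cmod (g (\<gamma> c) - z0)\<bar> \<le> cmod (g (\<gamma> d) - g (\<gamma> c))"
        using norm_triangle_ineq3[of "g (\<gamma> d) - z0" "g (\<gamma> c) - z0"] by simp
      moreover have "\<bar>M (\<gamma> d) - M (\<gamma> c)\<bar> \<ge> r/4" using cd(4) r by (auto simp: r1_def)
      ultimately show "r/4 \<le> cmod (g (\<gamma> d) - g (\<gamma> c))" using Mg cd(2) by auto
    qed
    moreover have "indicator {c<..<d} y * ennreal ((cmod (h' y))\<^sup>2) \<le>
       ennreal K * (indicator \<Sigma> (Complex x y) * ennreal \<bar>(cmod (A' (Complex x y)))\<^sup>2 - (cmod (B' (Complex x y)))\<^sup>2\<bar>)" for y
    proof (cases "y \<in> {c<..<d}")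
      case True
      then have W: "P (Complex x y) \<in> W" using inW by auto
      have in\<Sigma>: "Complex x y \<in> \<Sigma>" using True cd(1,3) MV'[OF cd(5)] by (auto simp: \<Sigma>_def \<gamma>_def)
      have "(cmod (h' y))\<^sup>2 \<le> (cmod (A' (Complex x y)) + cmod (B' (Complex x y)))\<^sup>2"
        unfolding h'_def by (intro power_mono order_trans[OF norm_triangle_ineq]) (auto simp: norm_mult)
      also have "\<dots> \<le> K * \<bar>(cmod (A' (Complex x y)))\<^sup>2 - (cmod (B' (Complex x y)))\<^sup>2\<bar>"
        unfolding K_def by (rule dilatation_ineq[OF k dil'[OF W]])
      finally show ?thesis using True in\<Sigma> K by (simp add: ennreal_mult'[symmetric] ennreal_leI)
    qed auto
    then have "(\<integral>\<^sup>+y. indicator {c<..<d} y * ennreal ((cmod (h' y))\<^sup>2) \<partial>lborel) \<le>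
       (\<integral>\<^sup>+y. ennreal K * (indicator \<Sigma> (Complex x y) * ennreal \<bar>(cmod (A' (Complex x y)))\<^sup>2 - (cmod (B' (Complex x y)))\<^sup>2\<bar>) \<partial>lborel)"
      by (intro nn_integral_mono)
    ultimately have 1: "ennreal ((r/4)\<^sup>2 / (2*pi)) \<le> (\<integral>\<^sup>+y. ennreal K * (indicator \<Sigma> (Complex x y) * ennreal \<bar>(cmod (A' (Complex x y)))\<^sup>2 - (cmod (B' (Complex x y)))\<^sup>2\<bar>) \<partial>lborel)"
      by (rule order_trans)
    have meas: "(\<lambda>y. indicator \<Sigma> (Complex x y) * ennreal \<bar>(cmod (A' (Complex x y)))\<^sup>2 - (cmod (B' (Complex x y)))\<^sup>2\<bar>) \<in> borel_measurable lborel"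
    proof -
      let ?T = "Complex x -` \<Sigma>"
      have cc: "continuous_on X (Complex x)" for X unfolding Complex_eq by (intro continuous_intros)
      have oT: "open ?T" using cc[of UNIV] o\<Sigma> by (simp add: open_vimage)
      have "continuous_on ?T (\<lambda>y. \<bar>(cmod (A' (Complex x y)))\<^sup>2 - (cmod (B' (Complex x y)))\<^sup>2\<bar>)"
        by (intro continuous_on_rabs continuous_on_diff continuous_on_power continuous_on_norm
            continuous_on_compose2[OF contA'[OF P\<Sigma>] cc] continuous_on_compose2[OF contB'[OF P\<Sigma>] cc]) auto
      then have "(\<lambda>y. indicator ?T y *\<^sub>R \<bar>(cmod (A' (Complex x y)))\<^sup>2 - (cmod (B' (Complex x y)))\<^sup>2\<bar>) \<in> borel_measurable borel"
        by (intro borel_measurable_continuous_on_indicator) (use oT in auto)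
      then have "(\<lambda>y. ennreal (indicator ?T y *\<^sub>R \<bar>(cmod (A' (Complex x y)))\<^sup>2 - (cmod (B' (Complex x y)))\<^sup>2\<bar>)) \<in> borel_measurable borel"
        by measurable
      then show ?thesis by (simp add: ennreal_mult' ennreal_indicator indicator_vimage)
    qed
    have "ennreal ((r/4)\<^sup>2 / (2*pi)) \<le> ennreal K * (\<integral>\<^sup>+y. indicator \<Sigma> (Complex x y) * ennreal \<bar>(cmod (A' (Complex x y)))\<^sup>2 - (cmod (B' (Complex x y)))\<^sup>2\<bar> \<partial>lborel)"
      (is "_ \<le> _ * ?J")
      using 1 nn_integral_cmult[OF meas] by simp
    then have "ennreal (1/K) * ennreal ((r/4)\<^sup>2 / (2*pi)) \<le> ennreal (1/K) * (ennreal K * ?J)"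
      by (rule mult_left_mono) simp
    also have "\<dots> = ?J" using K by (simp add: mult.assoc[symmetric] ennreal_mult'[symmetric])
    also have "ennreal (1/K) * ennreal ((r/4)\<^sup>2 / (2*pi)) = ennreal ((r/4)\<^sup>2 / (2 * pi) / K)"
      using K by (simp add: ennreal_mult'[symmetric])
    finally show ?thesis .
  qed
  have "\<beta> - \<alpha> \<le> 128 * pi * K"
  proof (cases "\<alpha> < \<beta>")
    case True
    have "ennreal ((\<beta> - \<alpha>) * ((r/4)\<^sup>2 / (2 * pi) / K)) = (\<integral>\<^sup>+x. ennreal ((r/4)\<^sup>2 / (2 * pi) / K) * indicator {\<alpha><..<\<beta>} x \<partial>lborel)"
      by (subst nn_integral_cmult_indicator) (use True K in \<open>auto simp: ennreal_mult'[symmetric] mult.commute\<close>)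
    also have "\<dots> \<le> (\<integral>\<^sup>+x. \<integral>\<^sup>+y. indicator \<Sigma> (Complex x y) * ennreal \<bar>(cmod (A' (Complex x y)))\<^sup>2 - (cmod (B' (Complex x y)))\<^sup>2\<bar> \<partial>lborel \<partial>lborel)"
      using lower by (intro nn_integral_mono) (auto simp: indicator_def)
    also have "\<dots> \<le> ennreal (4 * r1\<^sup>2)" by (rule area)
    finally have "(\<beta> - \<alpha>) * ((r/4)\<^sup>2 / (2 * pi) / K) \<le> 4 * r1\<^sup>2" by (simp add: ennreal_le_iff)
    also have "4 * r1\<^sup>2 \<le> 4 * r\<^sup>2" using r1 by (simp add: power_mono)
    finally have "(\<beta> - \<alpha>) * r\<^sup>2 \<le> (128 * pi * K) * r\<^sup>2"
      using K by (simp add: field_simps power2_eq_square)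
    then show ?thesis using r by simp
  next
    case False
    moreover have "0 \<le> 128 * pi * K" using K by simp
    ultimately show ?thesis by linarith
  qed
  then have "exp \<beta> \<le> exp (128 * pi * K + \<alpha>)" by simp
  also have "\<dots> = qc_constant k * exp \<alpha>" by (simp add: exp_add qc_constant_def K_def)
  finally show ?thesis by (simp add: ex)
qed

section \<open>Wirtinger derivatives of harmonic maps\<close>

lemma directional_derivative_along_line:
  fixes u :: "complex \<Rightarrow> real"
  assumes "u differentiable (at (p + t *\<^sub>R v))"
  shows "((\<lambda>s. u (p + s *\<^sub>R v)) has_real_derivative frechet_derivative u (at (p + t *\<^sub>R v)) v) (at t)"
proof -
  have 1: "((\<lambda>s. p + s *\<^sub>R v) has_derivative (\<lambda>s. s *\<^sub>R v)) (at t)"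
    by (auto intro!: derivative_eq_intros)
  have 2: "(u has_derivative frechet_derivative u (at (p + t *\<^sub>R v))) (at (p + t *\<^sub>R v))"
    using assms frechet_derivative_works by blast
  have "frechet_derivative u (at (p + t *\<^sub>R v)) (s *\<^sub>R v) = frechet_derivative u (at (p + t *\<^sub>R v)) v * s" for s
    using linear_scale[OF has_derivative_linear[OF 2], of s v] by simp
  then show ?thesis
    using has_derivative_compose[OF 1 2] unfolding has_field_derivative_def by simp
qed

text \<open>
  The mean value theorem applied twice to the second difference over a parallelogram, first in direction
  \<open>v\<close> and then in direction \<open>w\<close>.
\<close>

lemma second_difference_mean_value:
  fixes u :: "complex \<Rightarrow> real"
  assumes h: "0 < h"
    and sub: "\<And>s t. \<lbrakk>0 \<le> s; s \<le> h; 0 \<le> t; t \<le> h\<rbrakk> \<Longrightarrow> z + s *\<^sub>R v + t *\<^sub>R w \<in> D"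
    and d1: "\<And>x. x \<in> D \<Longrightarrow> u differentiable (at x)"
    and d2: "\<And>x. x \<in> D \<Longrightarrow> (\<lambda>x. frechet_derivative u (at x) v) differentiable (at x)"
  shows "\<exists>s t. 0 \<le> s \<and> s \<le> h \<and> 0 \<le> t \<and> t \<le> h \<and>
    u (z + h *\<^sub>R v + h *\<^sub>R w) - u (z + h *\<^sub>R v) - u (z + h *\<^sub>R w) + u z
     = h\<^sup>2 * frechet_derivative (\<lambda>x. frechet_derivative u (at x) v) (at (z + s *\<^sub>R v + t *\<^sub>R w)) w"
proof -
  let ?Dv = "\<lambda>x. frechet_derivative u (at x) v"
  let ?\<phi> = "\<lambda>s. u (z + h *\<^sub>R w + s *\<^sub>R v) - u (z + s *\<^sub>R v)"
  have "\<exists>s. 0 < s \<and> s < h \<and> ?\<phi> h - ?\<phi> 0 = (h - 0) * (?Dv (z + h *\<^sub>R w + s *\<^sub>R v) - ?Dv (z + s *\<^sub>R v))"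
  proof (rule MVT2[OF h])
    fix s assume "0 \<le> s" "s \<le> h"
    then have "z + h *\<^sub>R w + s *\<^sub>R v \<in> D" "z + s *\<^sub>R v \<in> D"
      using sub[of s h] sub[of s 0] h by (auto simp: algebra_simps)
    then show "(?\<phi> has_real_derivative ?Dv (z + h *\<^sub>R w + s *\<^sub>R v) - ?Dv (z + s *\<^sub>R v)) (at s)"
      by (intro DERIV_diff directional_derivative_along_line d1)
  qed
  then obtain s where s: "0 < s" "s < h" "?\<phi> h - ?\<phi> 0 = h * (?Dv (z + h *\<^sub>R w + s *\<^sub>R v) - ?Dv (z + s *\<^sub>R v))"
    by auto
  let ?\<chi> = "\<lambda>t. ?Dv (z + s *\<^sub>R v + t *\<^sub>R w)"
  have "\<exists>t. 0 < t \<and> t < h \<and> ?\<chi> h - ?\<chi> 0 = (h - 0) * frechet_derivative ?Dv (at (z + s *\<^sub>R v + t *\<^sub>R w)) w"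
  proof (rule MVT2[OF h])
    fix t assume "0 \<le> t" "t \<le> h"
    then have "z + s *\<^sub>R v + t *\<^sub>R w \<in> D" using sub[of s t] s by auto
    then show "(?\<chi> has_real_derivative frechet_derivative ?Dv (at (z + s *\<^sub>R v + t *\<^sub>R w)) w) (at t)"
      by (intro directional_derivative_along_line d2)
  qed
  then obtain t where t: "0 < t" "t < h" "?\<chi> h - ?\<chi> 0 = h * frechet_derivative ?Dv (at (z + s *\<^sub>R v + t *\<^sub>R w)) w"
    by auto
  have "u (z + h *\<^sub>R v + h *\<^sub>R w) - u (z + h *\<^sub>R v) - u (z + h *\<^sub>R w) + u z = ?\<phi> h - ?\<phi> 0"
    by (simp add: add.commute add.left_commute)
  also have "\<dots> = h * (?\<chi> h - ?\<chi> 0)" unfolding s(3) by (simp add: add.commute add.left_commute)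
  also have "\<dots> = h\<^sup>2 * frechet_derivative ?Dv (at (z + s *\<^sub>R v + t *\<^sub>R w)) w"
    unfolding t(3) by (simp add: power2_eq_square)
  finally show ?thesis using s t by (intro exI[of _ s] exI[of _ t]) auto
qed

lemma Ck_on_2D:
  fixes u :: "complex \<Rightarrow> real"
  assumes "Ck_on 2 u D"
  shows "\<And>x. x \<in> D \<Longrightarrow> u differentiable (at x)"
    and "\<And>x v. x \<in> D \<Longrightarrow> (\<lambda>x. frechet_derivative u (at x) v) differentiable (at x)"
    and "\<And>v w. continuous_on D (\<lambda>x. frechet_derivative (\<lambda>x. frechet_derivative u (at x) v) (at x) w)"
  using assms by (auto simp: numeral_2_eq_2)

text \<open>
  The second difference over the parallelogram spanned by \<open>h v\<close> and \<open>h w\<close> is symmetric in \<open>v\<close> and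
  \<open>w\<close>, so dividing it by \<open>h\<^sup>2\<close> yields values of both mixed derivatives close to \<open>z\<close>.
\<close>

lemma mixed_second_derivatives_commute:
  fixes u :: "complex \<Rightarrow> real"
  assumes "open D" and C2: "Ck_on 2 u D" and "z \<in> D"
  shows "frechet_derivative (\<lambda>x. frechet_derivative u (at x) v) (at z) w
       = frechet_derivative (\<lambda>x. frechet_derivative u (at x) w) (at z) v"
proof -
  define P where "P = (\<lambda>v w x. frechet_derivative (\<lambda>x. frechet_derivative u (at x) v) (at x) w)"
  have "\<bar>P v w z - P w v z\<bar> \<le> e" if e: "0 < e" for e
  proof -
    have cont: "isCont (P v w) z" for v w
      using Ck_on_2D(3)[OF C2] assms unfolding P_def by (simp add: continuous_on_eq_continuous_at)
    have lim: "(P v w \<longlongrightarrow> P v w z) (nhds z)" for v w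
      using cont[of v w] by (simp add: isCont_def tendsto_at_iff_tendsto_nhds)
    have "\<forall>\<^sub>F x in nhds z. dist (P v w x) (P v w z) < e/2 \<and> dist (P w v x) (P w v z) < e/2 \<and> x \<in> D"
      by (intro eventually_conj tendstoD[OF lim] eventually_nhds_in_open assms) (use e in auto)
    then obtain d where d: "0 < d" "\<And>x. dist x z < d \<Longrightarrow> dist (P v w x) (P v w z) < e/2 \<and> dist (P w v x) (P w v z) < e/2 \<and> x \<in> D"
      unfolding eventually_nhds_metric by blast
    \<comment> \<open>so small that the parallelogram stays within distance \<open>d\<close> of \<open>z\<close>\<close>
    define h where "h = d / (2 * (1 + norm v + norm w))"
    have pos: "0 < 1 + norm v + norm w" by (smt (verit) norm_ge_zero)
    have h: "0 < h" using d pos by (simp add: h_def)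
    have near: "dist (z + s *\<^sub>R v + t *\<^sub>R w) z < d" if "0 \<le> s" "s \<le> h" "0 \<le> t" "t \<le> h" for s t
    proof -
      have "dist (z + s *\<^sub>R v + t *\<^sub>R w) z = norm (s *\<^sub>R v + t *\<^sub>R w)" by (simp add: dist_norm)
      also have "\<dots> \<le> s * norm v + t * norm w" using norm_triangle_ineq[of "s *\<^sub>R v" "t *\<^sub>R w"] that by simp
      also have "\<dots> \<le> h * norm v + h * norm w" using that by (intro add_mono mult_right_mono) auto
      also have "\<dots> \<le> h * (1 + norm v + norm w)" using h by (simp add: algebra_simps)
      also have "\<dots> = d / 2" using pos by (simp add: h_def field_simps)
      also have "\<dots> < d" using d by simp
      finally show ?thesis .
    qed
    obtain s t where st: "0 \<le> s" "s \<le> h" "0 \<le> t" "t \<le> h"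
       "u (z + h *\<^sub>R v + h *\<^sub>R w) - u (z + h *\<^sub>R v) - u (z + h *\<^sub>R w) + u z = h\<^sup>2 * P v w (z + s *\<^sub>R v + t *\<^sub>R w)"
      using second_difference_mean_value[OF h, of z v w D u] near d(2) Ck_on_2D[OF C2] unfolding P_def by blast
    have near': "dist (z + s *\<^sub>R w + t *\<^sub>R v) z < d" if "0 \<le> s" "s \<le> h" "0 \<le> t" "t \<le> h" for s t
      using near[of t s] that by (simp add: add.commute add.left_commute)
    obtain s' t' where st': "0 \<le> s'" "s' \<le> h" "0 \<le> t'" "t' \<le> h"
       "u (z + h *\<^sub>R w + h *\<^sub>R v) - u (z + h *\<^sub>R w) - u (z + h *\<^sub>R v) + u z = h\<^sup>2 * P w v (z + s' *\<^sub>R w + t' *\<^sub>R v)"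
      using second_difference_mean_value[OF h, of z w v D u] near' d(2) Ck_on_2D[OF C2] unfolding P_def by blast
    have "h\<^sup>2 * P v w (z + s *\<^sub>R v + t *\<^sub>R w) = h\<^sup>2 * P w v (z + s' *\<^sub>R w + t' *\<^sub>R v)"
      unfolding st(5)[symmetric] st'(5)[symmetric] by (simp add: add.commute add.left_commute)
    then have "P v w (z + s *\<^sub>R v + t *\<^sub>R w) = P w v (z + s' *\<^sub>R w + t' *\<^sub>R v)" using h by simp
    moreover have "dist (P v w (z + s *\<^sub>R v + t *\<^sub>R w)) (P v w z) < e/2"
      using d(2) near[OF st(1-4)] by blast
    moreover have "dist (P w v (z + s' *\<^sub>R w + t' *\<^sub>R v)) (P w v z) < e/2"
      using d(2) near'[OF st'(1-4)] by blast
    ultimately have "dist (P v w z) (P w v z) < e" by (metis dist_triangle_half_r)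
    then show ?thesis by (simp add: dist_real_def)
  qed
  then have "P v w z = P w v z" using field_le_epsilon[of "\<bar>P v w z - P w v z\<bar>" 0] by auto
  then show ?thesis by (simp add: P_def)
qed

text \<open>
  The Cauchy-Riemann equations for \<open>u\<^sub>x - i u\<^sub>y\<close> are the Laplace equation and the symmetry of the mixed
  second derivatives of \<open>u\<close>.
\<close>

lemma harmonic_gradient_holomorphic:
  assumes "open D" "real_harmonic_on u D"
  shows "(\<lambda>z. of_real (dx u z) - \<i> * of_real (dy u z)) holomorphic_on D"
proof (subst holomorphic_on_open[OF assms(1)], intro ballI)
  fix z assume z: "z \<in> D"
  have C2: "Ck_on 2 u D" using assms(2) by (simp add: real_harmonic_on_def)
  let ?a = "dx (dx u) z" and ?b = "dy (dx u) z"
  have sym: "dx (dy u) z = ?b"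
    unfolding dx_def dy_def by (rule mixed_second_derivatives_commute[OF assms(1) C2 z])
  have lap: "dy (dy u) z = - ?a"
    using assms(2) z unfolding real_harmonic_on_def by (metis add.commute add_eq_0_iff)
  have dec: "(f has_derivative (\<lambda>h. dx f z * Re h + dy f z * Im h)) (at z)" if "f differentiable (at z)" for f :: "complex \<Rightarrow> real"
  proof -
    have D: "(f has_derivative frechet_derivative f (at z)) (at z)"
      using that frechet_derivative_works by blast
    have "frechet_derivative f (at z) h = dx f z * Re h + dy f z * Im h" for h
    proof -
      have "h = Re h *\<^sub>R 1 + Im h *\<^sub>R \<i>" by (simp add: complex_eq_iff)
      then have "frechet_derivative f (at z) h = frechet_derivative f (at z) (Re h *\<^sub>R 1 + Im h *\<^sub>R \<i>)" by simp
      also have "\<dots> = Re h * dx f z + Im h * dy f z"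
        using has_derivative_linear[OF D] by (simp add: linear_add linear_scale dx_def dy_def)
      finally show ?thesis by (simp add: mult.commute)
    qed
    then show ?thesis using D by (metis (no_types, lifting) ext)
  qed
  have "(dx u has_derivative (\<lambda>h. ?a * Re h + ?b * Im h)) (at z)"
    by (rule dec) (use Ck_on_2D(2)[OF C2 z] in \<open>simp add: dx_def[abs_def]\<close>)
  moreover have "(dy u has_derivative (\<lambda>h. ?b * Re h + (- ?a) * Im h)) (at z)"
    using dec[of "dy u"] Ck_on_2D(2)[OF C2 z] sym lap by (simp add: dy_def[abs_def])
  ultimately have "((\<lambda>z. of_real (dx u z) - \<i> * of_real (dy u z)) has_derivative
      (\<lambda>h. of_real (?a * Re h + ?b * Im h) - \<i> * of_real (?b * Re h + (- ?a) * Im h))) (at z)"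
    by (intro has_derivative_diff has_derivative_mult_right bounded_linear.has_derivative[OF bounded_linear_of_real])
  also have "(\<lambda>h. of_real (?a * Re h + ?b * Im h) - \<i> * of_real (?b * Re h + (- ?a) * Im h)) = (*) (Complex ?a (- ?b))"
    by (auto simp: complex_eq_iff)
  finally show "\<exists>f'. ((\<lambda>z. of_real (dx u z) - \<i> * of_real (dy u z)) has_field_derivative f') (at z)"
    unfolding has_field_derivative_def by blast
qed

text \<open>
  Here \<open>H\<close> is \<open>f\<^sub>z\<close> and \<open>G\<close> is the conjugate of \<open>f\<^sub>z\<^sub>b\<^sub>a\<^sub>r\<close>; both are holomorphic for a harmonic \<open>f\<close>. In
  this form the notion passes to limits, and it makes no reference to injectivity or to the image.
\<close>

definition qc_harmonic_data ::
    "real \<Rightarrow> (complex \<Rightarrow> complex) \<Rightarrow> (complex \<Rightarrow> complex) \<Rightarrow> (complex \<Rightarrow> complex) \<Rightarrow> complex set \<Rightarrow> bool" where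
  "qc_harmonic_data k f H G D \<longleftrightarrow> H holomorphic_on D \<and> G holomorphic_on D \<and>
     (\<forall>z\<in>D. (f has_derivative (\<lambda>h. H z * h + cnj (G z * h))) (at z) \<and> cmod (G z) \<le> k * cmod (H z) \<and> H z \<noteq> 0)"

lemma qc_harmonic_diffeo_imp_data:
  assumes D: "open D" and f: "qc_harmonic_diffeo k f D D'"
  shows "qc_harmonic_data k f (d_z f) (\<lambda>z. cnj (d_zbar f z)) D" "bij_betw f D D'"
proof -
  let ?u = "\<lambda>z. Re (f z)" and ?v = "\<lambda>z. Im (f z)"
  have hu: "real_harmonic_on ?u D" and hv: "real_harmonic_on ?v D"
    using f by (auto simp: qc_harmonic_diffeo_def harmonic_map_on_def)
  show "bij_betw f D D'"
    using f by (auto simp: qc_harmonic_diffeo_def quasiconformal_diffeo_def diffeomorphism_onto_def)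
  have "smooth_on f D"
    using f by (auto simp: qc_harmonic_diffeo_def quasiconformal_diffeo_def diffeomorphism_onto_def)
  then have "Ck_on (Suc 0) f D" unfolding smooth_on_def by blast
  then have diff: "f differentiable (at z)" if "z \<in> D" for z using that by simp
  have der: "(f has_derivative frechet_derivative f (at z)) (at z)" if "z \<in> D" for z
    using diff[OF that] frechet_derivative_works by blast
  have fd: "frechet_derivative ?u (at z) = (\<lambda>h. Re (frechet_derivative f (at z) h))"
           "frechet_derivative ?v (at z) = (\<lambda>h. Im (frechet_derivative f (at z) h))" if "z \<in> D" for z
    using has_derivative_Re[OF der[OF that]] has_derivative_Im[OF der[OF that]]
    by (metis frechet_derivative_at)+
  have H: "d_z f z = ((of_real (dx ?u z) - \<i> * of_real (dy ?u z)) + \<i> * (of_real (dx ?v z) - \<i> * of_real (dy ?v z))) / 2"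
    and G: "cnj (d_zbar f z) = ((of_real (dx ?u z) - \<i> * of_real (dy ?u z)) - \<i> * (of_real (dx ?v z) - \<i> * of_real (dy ?v z))) / 2"
    if "z \<in> D" for z
    unfolding d_z_def d_zbar_def dx_def dy_def fd[OF that] by (auto simp: complex_eq_iff)
  have hH: "(d_z f) holomorphic_on D"
    by (rule holomorphic_transform[OF _ H[symmetric]])
       (auto intro!: holomorphic_intros harmonic_gradient_holomorphic[OF D] hu hv)
  have hG: "(\<lambda>z. cnj (d_zbar f z)) holomorphic_on D"
    by (rule holomorphic_transform[OF _ G[symmetric]])
       (auto intro!: holomorphic_intros harmonic_gradient_holomorphic[OF D] hu hv)
  have derf: "(f has_derivative (\<lambda>h. d_z f z * h + cnj (cnj (d_zbar f z) * h))) (at z)" if z: "z \<in> D" for z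
  proof -
    have "frechet_derivative f (at z) h = d_z f z * h + cnj (cnj (d_zbar f z) * h)" for h
    proof -
      have "h = Re h *\<^sub>R 1 + Im h *\<^sub>R \<i>" by (simp add: complex_eq_iff)
      then have "frechet_derivative f (at z) h = frechet_derivative f (at z) (Re h *\<^sub>R 1 + Im h *\<^sub>R \<i>)" by simp
      also have "\<dots> = Re h *\<^sub>R dx f z + Im h *\<^sub>R dy f z"
        using has_derivative_linear[OF der[OF z]] by (simp add: linear_add linear_scale dx_def dy_def)
      also have "\<dots> = d_z f z * h + cnj (cnj (d_zbar f z) * h)"
        by (simp add: d_z_def d_zbar_def complex_eq_iff field_simps)
      finally show ?thesis .
    qed
    then have "frechet_derivative f (at z) = (\<lambda>h. d_z f z * h + cnj (cnj (d_zbar f z) * h))" by blast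
    then show ?thesis using der[OF z] by simp
  qed
  have nz: "d_z f z \<noteq> 0" if z: "z \<in> D" for z
  proof
    assume 0: "d_z f z = 0"
    have "jacobian_det f z = (cmod (d_z f z))\<^sup>2 - (cmod (d_zbar f z))\<^sup>2"
      unfolding cmod_power2 jacobian_det_def d_z_def d_zbar_def by (simp add: field_simps power2_eq_square)
    then have "jacobian_det f z \<le> 0" using 0 by simp
    then show False using f z
      by (auto simp: qc_harmonic_diffeo_def quasiconformal_diffeo_def orientation_preserving_on_def dest!: bspec)
  qed
  have dil: "cmod (d_zbar f z) \<le> k * cmod (d_z f z)" if z: "z \<in> D" for z
  proof -
    have "cmod (d_zbar f z / d_z f z) \<le> k" using f z
      by (auto simp: qc_harmonic_diffeo_def quasiconformal_diffeo_def complex_dilatation_def)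
    then show ?thesis using nz[OF z] by (simp add: norm_divide field_simps)
  qed
  show "qc_harmonic_data k f (d_z f) (\<lambda>z. cnj (d_zbar f z)) D"
    using hH hG derf nz dil by (auto simp: qc_harmonic_data_def)
qed

section \<open>Smoothness of harmonic maps and their inverses\<close>

text \<open>
  Equality on an open set carries over to derivatives, although \<open>frechet_derivative\<close> at a point sees
  values outside the set.
\<close>

lemma Ck_on_cong:
  assumes "open S" "\<And>x. x \<in> S \<Longrightarrow> f x = g x"
  shows "Ck_on n f S \<longleftrightarrow> Ck_on n g S"
  using assms(2)
proof (induction n arbitrary: f g)
  case 0
  then show ?case by (simp cong: continuous_on_cong)
next
  case (Suc n)
  have der: "(f has_derivative D) (at x) \<longleftrightarrow> (g has_derivative D) (at x)" if "x \<in> S" for x D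
  proof
    assume "(f has_derivative D) (at x)"
    then show "(g has_derivative D) (at x)"
      by (rule has_derivative_transform_within_open[OF _ assms(1) that Suc.prems])
  next
    assume "(g has_derivative D) (at x)"
    then show "(f has_derivative D) (at x)"
      by (rule has_derivative_transform_within_open[OF _ assms(1) that Suc.prems[symmetric]])
  qed
  have eq: "(\<lambda>D. (f has_derivative D) (at x)) = (\<lambda>D. (g has_derivative D) (at x))" if "x \<in> S" for x
    by (intro ext der that)
  have "f differentiable (at x) \<longleftrightarrow> g differentiable (at x)" if "x \<in> S" for x
    unfolding differentiable_def eq[OF that] ..
  moreover have fd: "frechet_derivative f (at x) = frechet_derivative g (at x)" if "x \<in> S" for x
    unfolding frechet_derivative_def eq[OF that] ..
  have "Ck_on n (\<lambda>x. frechet_derivative f (at x) v) S \<longleftrightarrow> Ck_on n (\<lambda>x. frechet_derivative g (at x) v) S" for v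
    by (rule Suc.IH) (simp add: fd)
  ultimately show ?case by auto
qed

lemma Ck_on_of_derivative:
  assumes S: "open S"
    and der: "\<And>x. x \<in> S \<Longrightarrow> (f has_derivative f' x) (at x)"
    and f': "\<And>v. Ck_on n (\<lambda>x. f' x v) S"
  shows "Ck_on (Suc n) f S"
proof -
  have "frechet_derivative f (at x) v = f' x v" if "x \<in> S" for x v
    using frechet_derivative_at[OF der[OF that]] by simp
  then have "Ck_on n (\<lambda>x. frechet_derivative f (at x) v) S" for v
    using f'[of v] Ck_on_cong[OF S, of "\<lambda>x. frechet_derivative f (at x) v" "\<lambda>x. f' x v"] by simp
  then show ?thesis using der by (auto simp: differentiable_def)
qed

text \<open>
  A coinductive principle: smoothness of infinite order needs no formulas for higher derivatives when
  there is a class of functions that is closed under directional derivatives.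
\<close>

lemma smooth_on_if_closed_under_derivatives:
  assumes S: "open S" 
    and cl: "\<And>f. f \<in> C \<Longrightarrow> \<exists>f'. (\<forall>x\<in>S. (f has_derivative f' x) (at x)) \<and> (\<forall>v. (\<lambda>x. f' x v) \<in> C)"
    and "f \<in> C"
  shows "smooth_on f S"
proof -
  have "Ck_on n f S" for n
    using \<open>f \<in> C\<close>
  proof (induction n arbitrary: f)
    case 0
    then obtain f' where "\<forall>x\<in>S. (f has_derivative f' x) (at x)" using cl by blast
    then show ?case by (auto intro!: continuous_at_imp_continuous_on has_derivative_continuous)
  next
    case (Suc n)
    then obtain f' where "\<forall>x\<in>S. (f has_derivative f' x) (at x)" "\<forall>v. (\<lambda>x. f' x v) \<in> C" using cl by blast
    then show ?case using Suc.IH Ck_on_of_derivative[OF S, of f f' n] by blast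
  qed
  then show ?thesis by (simp add: smooth_on_def)
qed

text \<open>
  With \<open>g = id\<close> this class contains the directional derivatives of a harmonic map; with \<open>g\<close> the inverse of
  a harmonic map it contains those of \<open>g\<close>, since they are rational expressions in the Wirtinger
  derivatives at \<open>g w\<close> and their conjugates.
\<close>

inductive_set holomorphic_algebra ::
    "(complex \<Rightarrow> complex) \<Rightarrow> complex set \<Rightarrow> complex set \<Rightarrow> (complex \<Rightarrow> complex) set"
  for g D S where
  hol: "A holomorphic_on D \<Longrightarrow> (\<lambda>w. A (g w)) \<in> holomorphic_algebra g D S"
| conj: "f \<in> holomorphic_algebra g D S \<Longrightarrow> (\<lambda>w. cnj (f w)) \<in> holomorphic_algebra g D S"
| add: "\<lbrakk>f \<in> holomorphic_algebra g D S; h \<in> holomorphic_algebra g D S\<rbrakk>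
    \<Longrightarrow> (\<lambda>w. f w + h w) \<in> holomorphic_algebra g D S"
| mult: "\<lbrakk>f \<in> holomorphic_algebra g D S; h \<in> holomorphic_algebra g D S\<rbrakk>
    \<Longrightarrow> (\<lambda>w. f w * h w) \<in> holomorphic_algebra g D S"
| inv: "\<lbrakk>f \<in> holomorphic_algebra g D S; \<And>w. w \<in> S \<Longrightarrow> f w \<noteq> 0\<rbrakk>
    \<Longrightarrow> (\<lambda>w. inverse (f w)) \<in> holomorphic_algebra g D S"

lemma holomorphic_algebra_const: "(\<lambda>w. c) \<in> holomorphic_algebra g D S"
  using holomorphic_algebra.hol[of "\<lambda>_. c"] by simp

lemma holomorphic_algebra_uminus:
  "f \<in> holomorphic_algebra g D S \<Longrightarrow> (\<lambda>w. - f w) \<in> holomorphic_algebra g D S"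
  using holomorphic_algebra.mult[OF holomorphic_algebra_const[of "-1"]] by simp

lemma holomorphic_algebra_derivative:
  assumes D: "open D" and gS: "g ` S \<subseteq> D"
    and g: "\<And>w. w \<in> S \<Longrightarrow> (g has_derivative g' w) (at w)"
    and g': "\<And>v. (\<lambda>w. g' w v) \<in> holomorphic_algebra g D S"
    and "f \<in> holomorphic_algebra g D S"
  shows "\<exists>f'. (\<forall>w\<in>S. (f has_derivative f' w) (at w)) \<and> (\<forall>v. (\<lambda>w. f' w v) \<in> holomorphic_algebra g D S)"
  using assms(5)
proof induction
  case (hol A)
  have "((\<lambda>w. A (g w)) has_derivative (\<lambda>v. deriv A (g w) * g' w v)) (at w)" if "w \<in> S" for w
  proof -
    have "(A has_derivative (*) (deriv A (g w))) (at (g w))"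
      using holomorphic_derivI[OF hol D] gS that by (auto simp: has_field_derivative_def)
    from has_derivative_compose[OF g[OF that] this] show ?thesis by simp
  qed
  moreover have "(\<lambda>w. deriv A (g w) * g' w v) \<in> holomorphic_algebra g D S" for v
    by (intro holomorphic_algebra.mult g' holomorphic_algebra.hol holomorphic_deriv hol D)
  ultimately show ?case by (intro exI[of _ "\<lambda>w v. deriv A (g w) * g' w v"]) auto
next
  case (conj f)
  then obtain f' where "\<forall>w\<in>S. (f has_derivative f' w) (at w)" "\<forall>v. (\<lambda>w. f' w v) \<in> holomorphic_algebra g D S" by blast
  then show ?case
    by (intro exI[of _ "\<lambda>w v. cnj (f' w v)"])
       (auto intro: holomorphic_algebra.conj bounded_linear.has_derivative[OF bounded_linear_cnj])
next
  case (add f h)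
  then obtain f' h' where "\<forall>w\<in>S. (f has_derivative f' w) (at w)" "\<forall>v. (\<lambda>w. f' w v) \<in> holomorphic_algebra g D S"
    "\<forall>w\<in>S. (h has_derivative h' w) (at w)" "\<forall>v. (\<lambda>w. h' w v) \<in> holomorphic_algebra g D S" by blast
  then show ?case
    by (intro exI[of _ "\<lambda>w v. f' w v + h' w v"]) (auto intro: holomorphic_algebra.add has_derivative_add)
next
  case (mult f h)
  then obtain f' h' where "\<forall>w\<in>S. (f has_derivative f' w) (at w)" "\<forall>v. (\<lambda>w. f' w v) \<in> holomorphic_algebra g D S"
    "\<forall>w\<in>S. (h has_derivative h' w) (at w)" "\<forall>v. (\<lambda>w. h' w v) \<in> holomorphic_algebra g D S" by blast
  then show ?case using mult.hyps
    by (intro exI[of _ "\<lambda>w v. f w * h' w v + f' w v * h w"])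
       (auto intro!: holomorphic_algebra.add holomorphic_algebra.mult has_derivative_mult)
next
  case (inv f)
  then obtain f' where f': "\<forall>w\<in>S. (f has_derivative f' w) (at w)" "\<forall>v. (\<lambda>w. f' w v) \<in> holomorphic_algebra g D S" by blast
  have "((\<lambda>w. inverse (f w)) has_derivative (\<lambda>v. - (inverse (f w) * f' w v * inverse (f w)))) (at w)" if "w \<in> S" for w
    using Deriv.has_derivative_inverse[OF inv.hyps(2)[OF that] f'(1)[rule_format, OF that]] .
  moreover have "(\<lambda>w. - (inverse (f w) * f' w v * inverse (f w))) \<in> holomorphic_algebra g D S" for v
    using f'(2) inv.hyps by (intro holomorphic_algebra_uminus holomorphic_algebra.mult holomorphic_algebra.inv) auto
  ultimately show ?case by (intro exI[of _ "\<lambda>w v. - (inverse (f w) * f' w v * inverse (f w))"]) auto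
qed

definition jac :: "(complex \<Rightarrow> complex) \<Rightarrow> (complex \<Rightarrow> complex) \<Rightarrow> complex \<Rightarrow> real" where
  "jac H G z = (cmod (H z))\<^sup>2 - (cmod (G z))\<^sup>2"

lemma qc_harmonic_data_jac_pos:
  assumes "0 \<le> k" "k < 1" "qc_harmonic_data k f H G D" "z \<in> D"
  shows "0 < jac H G z"
proof -
  have *: "cmod (G z) \<le> k * cmod (H z)" "H z \<noteq> 0" using assms by (auto simp: qc_harmonic_data_def)
  have "k * cmod (H z) < cmod (H z)" using assms * by simp
  then have "cmod (G z) < cmod (H z)" using * by linarith
  then show ?thesis by (simp add: jac_def power_strict_mono)
qed

text \<open>
  Cramer's rule for the real linear equation \<open>a h + cnj (b h) = v\<close>.
\<close>

lemma wirtinger_solve: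
  assumes "(cmod a)\<^sup>2 - (cmod b)\<^sup>2 \<noteq> 0"
  shows "(cnj a * (a * h + cnj (b * h)) - cnj b * cnj (a * h + cnj (b * h))) / of_real ((cmod a)\<^sup>2 - (cmod b)\<^sup>2) = h"
    and "a * ((cnj a * v - cnj b * cnj v) / of_real ((cmod a)\<^sup>2 - (cmod b)\<^sup>2))
       + cnj (b * ((cnj a * v - cnj b * cnj v) / of_real ((cmod a)\<^sup>2 - (cmod b)\<^sup>2))) = v"
proof -
  have e: "of_real ((cmod a)\<^sup>2 - (cmod b)\<^sup>2) = a * cnj a - b * cnj b"
    by (simp add: complex_norm_square[symmetric])
  have "complex_of_real ((cmod a)\<^sup>2 - (cmod b)\<^sup>2) \<noteq> 0" using assms by (simp only: of_real_eq_0_iff not_False_eq_True)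
  then have nz: "a * cnj a - b * cnj b \<noteq> 0" unfolding e .
  show "(cnj a * (a * h + cnj (b * h)) - cnj b * cnj (a * h + cnj (b * h))) / of_real ((cmod a)\<^sup>2 - (cmod b)\<^sup>2) = h"
    unfolding e using nz by (simp add: field_simps)
  show "a * ((cnj a * v - cnj b * cnj v) / of_real ((cmod a)\<^sup>2 - (cmod b)\<^sup>2))
       + cnj (b * ((cnj a * v - cnj b * cnj v) / of_real ((cmod a)\<^sup>2 - (cmod b)\<^sup>2))) = v"
  proof -
    have N: "cnj (a * cnj a - b * cnj b) = a * cnj a - b * cnj b" by (simp add: mult.commute)
    have "a * ((cnj a * v - cnj b * cnj v) / (a * cnj a - b * cnj b))
       + cnj (b * ((cnj a * v - cnj b * cnj v) / (a * cnj a - b * cnj b)))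
      = (a * (cnj a * v - cnj b * cnj v) + cnj b * (a * cnj v - b * v)) / (a * cnj a - b * cnj b)"
      unfolding complex_cnj_mult[of b] complex_cnj_divide N by (simp add: add_divide_distrib)
    also have "a * (cnj a * v - cnj b * cnj v) + cnj b * (a * cnj v - b * v) = v * (a * cnj a - b * cnj b)"
      by (simp add: algebra_simps)
    finally show ?thesis unfolding e using nz by simp
  qed
qed

lemma qc_harmonic_data_continuous:
  assumes "qc_harmonic_data k f H G D"
  shows "continuous_on D f"
  using assms by (auto simp: qc_harmonic_data_def intro!: continuous_at_imp_continuous_on has_derivative_continuous)

lemma qc_harmonic_inverse:
  assumes k: "0 \<le> k" "k < 1" and D: "open D" and f: "qc_harmonic_data k f H G D" and inj: "inj_on f D"
    and g: "\<And>z. z \<in> D \<Longrightarrow> g (f z) = z"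
  shows "open (f ` D)" "continuous_on (f ` D) g"
    "\<And>w. w \<in> f ` D \<Longrightarrow> (g has_derivative
        (\<lambda>v. (cnj (H (g w)) * v - cnj (G (g w)) * cnj v) / of_real (jac H G (g w)))) (at w)"
proof -
  have cf: "continuous_on D f" by (rule qc_harmonic_data_continuous[OF f])
  show o: "open (f ` D)" using invariance_of_domain[OF cf D inj] .
  have inj': "inj_on f U" if "U \<subseteq> D" for U using inj that inj_on_subset by blast
  show cg: "continuous_on (f ` D) g"
    unfolding continuous_on_open_vimage[OF o]
  proof (intro allI impI)
    fix B :: "complex set" assume "open B"
    have "g -` B \<inter> f ` D = f ` (B \<inter> D)" using g by auto
    then show "open (g -` B \<inter> f ` D)"
      using invariance_of_domain[of "B \<inter> D" f] continuous_on_subset[OF cf] inj' D \<open>open B\<close> by (metis inf_le2 open_Int)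
  qed
  fix w assume w: "w \<in> f ` D"
  then have gD: "g w \<in> D" using g by auto
  have J: "jac H G (g w) \<noteq> 0" using qc_harmonic_data_jac_pos[OF k f gD] by simp
  show "(g has_derivative
        (\<lambda>v. (cnj (H (g w)) * v - cnj (G (g w)) * cnj v) / of_real (jac H G (g w)))) (at w)"
  proof (rule has_derivative_inverse_basic)
    show "(f has_derivative (\<lambda>h. H (g w) * h + cnj (G (g w) * h))) (at (g w))"
      using f gD by (auto simp: qc_harmonic_data_def)
    show "bounded_linear (\<lambda>v. (cnj (H (g w)) * v - cnj (G (g w)) * cnj v) / of_real (jac H G (g w)))"
      by (rule bounded_linear_compose[OF bounded_linear_divide bounded_linear_sub[OF bounded_linear_mult_right
            bounded_linear_compose[OF bounded_linear_mult_right bounded_linear_cnj]]])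
    show "(\<lambda>v. (cnj (H (g w)) * v - cnj (G (g w)) * cnj v) / of_real (jac H G (g w))) \<circ> (\<lambda>h. H (g w) * h + cnj (G (g w) * h)) = id"
      using wirtinger_solve(1) J unfolding jac_def o_def by (intro ext) (metis id_apply)
    show "continuous (at w) g" using continuous_on_eq_continuous_at[OF o] cg w by blast
    show "open (f ` D)" by (rule o)
    show "w \<in> f ` D" by (rule w)
    show "f (g z) = z" if "z \<in> f ` D" for z using that g by auto
  qed
qed

text \<open>
  The converse of \<open>qc_harmonic_diffeo_imp_data\<close>. It is what turns a limit, of which only first
  derivatives are known, into a smooth diffeomorphism.
\<close>

lemma qc_harmonic_data_imp_diffeo:
  assumes k: "0 \<le> k" "k < 1" and D: "open D" and f: "qc_harmonic_data k f H G D" and bij: "bij_betw f D D'"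
  shows "qc_harmonic_diffeo k f D D'"
proof -
  have inj: "inj_on f D" and img: "f ` D = D'" using bij by (auto simp: bij_betw_def)
  have hH: "H holomorphic_on D" and hG: "G holomorphic_on D"
    and der: "\<And>z. z \<in> D \<Longrightarrow> (f has_derivative (\<lambda>h. H z * h + cnj (G z * h))) (at z)"
    using f by (auto simp: qc_harmonic_data_def)
  let ?C = "holomorphic_algebra id D D"
  have idder: "\<exists>f'. (\<forall>w\<in>D. (h has_derivative f' w) (at w)) \<and> (\<forall>v. (\<lambda>w. f' w v) \<in> ?C)" if "h \<in> ?C" for h
    using holomorphic_algebra_derivative[OF D, of id D "\<lambda>_ v. v" h] that holomorphic_algebra_const
    by (auto simp: id_def)
  have fC: "(\<lambda>z. H z * v + cnj (G z * v)) \<in> ?C" for v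
  proof -
    have "(\<lambda>z. H z * v) \<in> ?C" "(\<lambda>z. G z * v) \<in> ?C"
      using holomorphic_algebra.hol[of "\<lambda>z. H z * v" D id D, OF holomorphic_on_mult[OF hH holomorphic_on_const]]
        holomorphic_algebra.hol[of "\<lambda>z. G z * v" D id D, OF holomorphic_on_mult[OF hG holomorphic_on_const]]
      by simp_all
    then show ?thesis by (intro holomorphic_algebra.add holomorphic_algebra.conj)
  qed
  have smooth_f: "smooth_on f D"
  proof (rule smooth_on_if_closed_under_derivatives[OF D, of "insert f ?C"])
    fix h assume "h \<in> insert f ?C"
    then show "\<exists>f'. (\<forall>x\<in>D. (h has_derivative f' x) (at x)) \<and> (\<forall>v. (\<lambda>x. f' x v) \<in> insert f ?C)"
      using idder[of h] der fC by fastforce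
  qed simp
  have smooth_part: "smooth_on (\<lambda>z. p (f z)) D" if p: "bounded_linear p" for p :: "complex \<Rightarrow> real"
  proof (rule smooth_on_if_closed_under_derivatives[OF D, of "insert (\<lambda>z. p (f z)) ((\<lambda>h z. p (h z)) ` ?C)"])
    fix u assume "u \<in> insert (\<lambda>z. p (f z)) ((\<lambda>h z. p (h z)) ` ?C)"
    then consider "u = (\<lambda>z. p (f z))" | h where "u = (\<lambda>z. p (h z))" "h \<in> ?C" by blast
    then show "\<exists>f'. (\<forall>x\<in>D. (u has_derivative f' x) (at x)) \<and> (\<forall>v. (\<lambda>x. f' x v) \<in> insert (\<lambda>z. p (f z)) ((\<lambda>h z. p (h z)) ` ?C))"
    proof cases
      case 1
      then show ?thesis
        using bounded_linear.has_derivative[OF p der] fC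
        by (intro exI[of _ "\<lambda>z v. p (H z * v + cnj (G z * v))"]) auto
    next
      case 2
      obtain f' where "\<forall>w\<in>D. (h has_derivative f' w) (at w)" "\<forall>v. (\<lambda>w. f' w v) \<in> ?C" using idder[OF 2(2)] by blast
      then show ?thesis unfolding 2(1)
        by (intro exI[of _ "\<lambda>z v. p (f' z v)"] conjI ballI allI bounded_linear.has_derivative[OF p]) auto
    qed
  qed simp
  \<comment> \<open>real and imaginary part are treated together: they are \<open>Re (c f)\<close> for \<open>c = 1\<close> and \<open>c = -i\<close>\<close>
  have harm: "real_harmonic_on (\<lambda>z. Re (c * f z)) D" for c
  proof -
    have p: "bounded_linear (\<lambda>z. Re (c * z))"
      by (rule bounded_linear_compose[OF bounded_linear_Re bounded_linear_mult_right])
    let ?u = "\<lambda>z. Re (c * f z)"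
    let ?A = "\<lambda>z. c * H z + cnj c * G z"
    have du: "(?u has_derivative (\<lambda>v. Re (?A z * v))) (at z)" if "z \<in> D" for z
    proof -
      have "(\<lambda>v. Re (c * (H z * v + cnj (G z * v)))) = (\<lambda>v. Re (?A z * v))"
        by (auto simp: algebra_simps)
      then show ?thesis using bounded_linear.has_derivative[OF p der[OF that]] by simp
    qed
    have fdu: "frechet_derivative ?u (at z) = (\<lambda>v. Re (?A z * v))" if "z \<in> D" for z
      using frechet_derivative_at[OF du[OF that]] by simp
    have hA: "?A holomorphic_on D" using hH hG by (intro holomorphic_intros)
    have d2: "frechet_derivative (\<lambda>z. frechet_derivative ?u (at z) v) (at z) w = Re (deriv ?A z * v * w)" if z: "z \<in> D" for z v w
    proof -
      have "(?A has_derivative (*) (deriv ?A z)) (at z)"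
        using holomorphic_derivI[OF hA D z] by (simp add: has_field_derivative_def)
      then have "((\<lambda>z. Re (?A z * v)) has_derivative (\<lambda>w. Re (deriv ?A z * w * v))) (at z)"
        by (intro has_derivative_Re has_derivative_mult_left)
      then have "((\<lambda>z. frechet_derivative ?u (at z) v) has_derivative (\<lambda>w. Re (deriv ?A z * w * v))) (at z)"
        by (rule has_derivative_transform_within_open[OF _ D z]) (simp only: fdu)
      from frechet_derivative_at[OF this] show ?thesis
        by (metis (no_types, lifting) mult.assoc mult.commute)
    qed
    have "dx (dx ?u) z + dy (dy ?u) z = 0" if "z \<in> D" for z
      unfolding dx_def[abs_def] dy_def[abs_def] d2[OF that] by (simp add: mult.assoc)
    moreover have "Ck_on 2 ?u D" using smooth_part[OF p] by (simp add: smooth_on_def)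
    ultimately show ?thesis by (simp add: real_harmonic_on_def)
  qed
  have "harmonic_map_on f D"
    using harm[of 1] harm[of "-\<i>"] by (simp add: harmonic_map_on_def)
  moreover have "smooth_on (inv_into D f) D'"
  proof -
    let ?g = "inv_into D f"
    let ?G = "holomorphic_algebra ?g D D'"
    have gf: "?g (f z) = z" if "z \<in> D" for z using inj that by simp
    note inv = qc_harmonic_inverse[OF k D f inj gf, unfolded img]
    have gD: "?g ` D' \<subseteq> D" unfolding img[symmetric] using gf by auto
    have dG: "(\<lambda>w. (cnj (H (?g w)) * v - cnj (G (?g w)) * cnj v) / of_real (jac H G (?g w))) \<in> ?G" for v
    proof -
      have HG: "(\<lambda>w. H (?g w)) \<in> ?G" "(\<lambda>w. G (?g w)) \<in> ?G" using hH hG by (auto intro: holomorphic_algebra.hol)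
      have e: "of_real (jac H G z) = H z * cnj (H z) + - (G z * cnj (G z))" for z
        by (simp add: jac_def complex_norm_square[symmetric])
      have "(\<lambda>w. of_real (jac H G (?g w))) \<in> ?G"
        unfolding e by (intro holomorphic_algebra.add holomorphic_algebra.mult holomorphic_algebra_uminus holomorphic_algebra.conj HG)
      then have "(\<lambda>w. inverse (of_real (jac H G (?g w)))) \<in> ?G"
        by (rule holomorphic_algebra.inv) (use qc_harmonic_data_jac_pos[OF k f] gD in force)
      then have "(\<lambda>w. (cnj (H (?g w)) * v + - (cnj (G (?g w)) * cnj v)) * inverse (of_real (jac H G (?g w)))) \<in> ?G"
        by (intro holomorphic_algebra.add holomorphic_algebra.mult holomorphic_algebra_uminus holomorphic_algebra.conj HG holomorphic_algebra_const)
      then show ?thesis by (simp add: divide_inverse)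
    qed
    show ?thesis
    proof (rule smooth_on_if_closed_under_derivatives[of D' ?G])
      show "open D'" by (rule inv(1))
      show "?g \<in> ?G" using holomorphic_algebra.hol[of "\<lambda>z. z" D ?g D'] by auto
      fix h assume h: "h \<in> ?G"
      show "\<exists>f'. (\<forall>x\<in>D'. (h has_derivative f' x) (at x)) \<and> (\<forall>v. (\<lambda>x. f' x v) \<in> ?G)"
        by (rule holomorphic_algebra_derivative[OF D gD inv(3) dG h])
    qed
  qed
  moreover have "jacobian_det f z = jac H G z \<and> cmod (complex_dilatation f z) \<le> k" if z: "z \<in> D" for z
  proof -
    have fd: "frechet_derivative f (at z) = (\<lambda>h. H z * h + cnj (G z * h))"
      using frechet_derivative_at[OF der[OF z]] by simp
    have "d_z f z = H z" "d_zbar f z = cnj (G z)"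
      by (auto simp: d_z_def d_zbar_def dx_def dy_def fd complex_eq_iff)
    moreover have "jacobian_det f z = jac H G z"
      by (simp add: jacobian_det_def dx_def dy_def fd jac_def cmod_power2) (simp add: algebra_simps power2_eq_square)
    ultimately show ?thesis using f z
      by (auto simp: complex_dilatation_def qc_harmonic_data_def norm_divide field_simps)
  qed
  ultimately show ?thesis
    using bij smooth_f qc_harmonic_data_jac_pos[OF k f]
    by (simp add: qc_harmonic_diffeo_def quasiconformal_diffeo_def diffeomorphism_onto_def orientation_preserving_on_def)
qed

section \<open>Distortion and gradient estimates for harmonic maps\<close>

lemma qc_harmonic_data_subset:
  "qc_harmonic_data k f H G D \<Longrightarrow> S \<subseteq> D \<Longrightarrow> qc_harmonic_data k f H G S"
  by (auto simp: qc_harmonic_data_def intro: holomorphic_on_subset)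

text \<open>
  The inverse of a \<open>k\<close>-quasiconformal map is \<open>k\<close>-quasiconformal: its Wirtinger coefficients are
  \<open>cnj H / J\<close> and \<open>- cnj G / J\<close>, where \<open>J\<close> is the Jacobian.
\<close>

lemma qc_harmonic_harnack:
  assumes k: "0 \<le> k" "k < 1" and r: "0 < r"
    and f: "qc_harmonic_data k f H G (ball z0 r)" and inj: "inj_on f (ball z0 r)"
    and e: "e \<notin> f ` ball z0 r" and z: "z1 \<in> cball z0 (r/2)" "z2 \<in> cball z0 (r/2)"
  shows "cmod (f z1 - e) \<le> qc_constant k * cmod (f z2 - e)"
proof -
  define g where "g = inv_into (ball z0 r) f"
  have g: "g (f z) = z" if "z \<in> ball z0 r" for z unfolding g_def using inj that by simp
  have cg: "continuous_on (f ` ball z0 r) g" by (rule qc_harmonic_inverse(2)[OF k open_ball f inj g])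
  have gB: "g w \<in> ball z0 r" if "w \<in> f ` ball z0 r" for w using that g by auto
  have J: "jac H G (g w) > 0" if "w \<in> f ` ball z0 r" for w
    by (rule qc_harmonic_data_jac_pos[OF k f gB[OF that]])
  have cH: "continuous_on (ball z0 r) H" and cG: "continuous_on (ball z0 r) G"
    using f by (auto simp: qc_harmonic_data_def intro: holomorphic_on_imp_continuous_on)
  have cHg: "continuous_on (f ` ball z0 r) (\<lambda>w. H (g w))" and cGg: "continuous_on (f ` ball z0 r) (\<lambda>w. G (g w))"
    by (rule continuous_on_compose2[OF cH cg] continuous_on_compose2[OF cG cg]; use gB in blast)+
  have cJ: "continuous_on (f ` ball z0 r) (\<lambda>w. of_real (jac H G (g w)) :: complex)"
    unfolding jac_def by (intro continuous_on_of_real continuous_on_diff continuous_on_power continuous_on_norm cHg cGg)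
  define A where "A = (\<lambda>w. cnj (H (g w)) / of_real (jac H G (g w)))"
  define B where "B = (\<lambda>w. - cnj (G (g w)) / of_real (jac H G (g w)))"
  show ?thesis
  proof (rule qc_harnack[OF k r qc_harmonic_data_continuous[OF f] g _ _ _ _ e z])
    fix w assume w: "w \<in> f ` ball z0 r"
    have "(\<lambda>v. (cnj (H (g w)) * v - cnj (G (g w)) * cnj v) / of_real (jac H G (g w))) = (\<lambda>h. A w * h + B w * cnj h)"
      by (auto simp: A_def B_def diff_divide_distrib)
    moreover have "(g has_derivative (\<lambda>v. (cnj (H (g w)) * v - cnj (G (g w)) * cnj v) / of_real (jac H G (g w)))) (at w)"
      by (rule qc_harmonic_inverse(3)[OF k open_ball f inj g w])
    ultimately show "(g has_derivative (\<lambda>h. A w * h + B w * cnj h)) (at w)" by simp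
    have "cmod (G (g w)) \<le> k * cmod (H (g w))" using f gB[OF w] by (simp add: qc_harmonic_data_def)
    then have "cmod (G (g w)) / jac H G (g w) \<le> k * cmod (H (g w)) / jac H G (g w)"
      using J[OF w] by (intro divide_right_mono) auto
    then show "cmod (B w) \<le> k * cmod (A w)" using J[OF w] by (simp add: A_def B_def norm_divide)
  next
    have nz: "\<forall>w\<in>f ` ball z0 r. complex_of_real (jac H G (g w)) \<noteq> 0" using J by (metis less_irrefl of_real_eq_0_iff)
    show "continuous_on (f ` ball z0 r) A" unfolding A_def
      by (intro continuous_on_divide continuous_on_cnj cHg cJ nz)
    show "continuous_on (f ` ball z0 r) B" unfolding B_def
      by (intro continuous_on_divide continuous_on_minus continuous_on_cnj cGg cJ nz)
  qed
qed

text \<open>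
  The same estimate with the roles of the map and its inverse exchanged; \<open>g\<close> need not be harmonic.
\<close>

lemma qc_harmonic_inverse_harnack:
  assumes k: "0 \<le> k" "k < 1" and r: "0 < r" and D: "open D"
    and f: "qc_harmonic_data k f H G D" and inj: "inj_on f D"
    and g: "\<And>z. z \<in> D \<Longrightarrow> g (f z) = z"
    and sub: "ball w0 r \<subseteq> f ` D"
    and e: "e \<notin> D" and w: "w1 \<in> cball w0 (r/2)" "w2 \<in> cball w0 (r/2)"
  shows "cmod (g w1 - e) \<le> qc_constant k * cmod (g w2 - e)"
proof (rule qc_harnack[where f = g and g = f and A = H and B = "\<lambda>z. cnj (G z)" and ?z0.0 = w0, OF k r])
  have gD: "g ` ball w0 r \<subseteq> D" using sub g by auto
  show "continuous_on (ball w0 r) g"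
    by (rule continuous_on_subset[OF qc_harmonic_inverse(2)[OF k D f inj g] sub])
  show "f (g w) = w" if "w \<in> ball w0 r" for w using that sub g by auto
  show "(f has_derivative (\<lambda>h. H z * h + cnj (G z) * cnj h)) (at z)" if "z \<in> g ` ball w0 r" for z
    using f that gD by (auto simp: qc_harmonic_data_def)
  show "cmod (cnj (G z)) \<le> k * cmod (H z)" if "z \<in> g ` ball w0 r" for z
    using f that gD by (auto simp: qc_harmonic_data_def)
  have "continuous_on D H" "continuous_on D G"
    using f by (auto simp: qc_harmonic_data_def intro: holomorphic_on_imp_continuous_on)
  then show "continuous_on (g ` ball w0 r) H" "continuous_on (g ` ball w0 r) (\<lambda>z. cnj (G z))"
    using gD by (auto intro!: continuous_on_cnj intro: continuous_on_subset)
  show "e \<notin> g ` ball w0 r" using e gD by auto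
qed (use w in auto)

text \<open>
  The function \<open>exp (F / C)\<close> is bounded by \<open>exp 1\<close> and bounded below by \<open>exp (-1)\<close>, so Cauchy's
  estimate for its derivative bounds the derivative of \<open>F\<close>.
\<close>

lemma deriv_bound_by_real_part:
  assumes r: "0 < r" and C: "0 < C" and F: "F holomorphic_on ball z r"
    and b: "\<And>x. x \<in> ball z r \<Longrightarrow> \<bar>Re (F x)\<bar> \<le> C"
  shows "cmod (deriv F z) \<le> 2 * exp 2 * C / r"
proof -
  let ?E = "\<lambda>x. exp (F x / C)"
  have E: "?E holomorphic_on ball z r" by (intro holomorphic_intros F) (use C in auto)
  have nE: "cmod (?E x) = exp (Re (F x) / C)" for x by (simp add: Re_divide_of_real)
  have "cmod ((deriv ^^ 1) ?E z) \<le> fact 1 * exp 1 / (r/2) ^ 1"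
  proof (rule Cauchy_inequality)
    show "?E holomorphic_on ball z (r/2)" by (rule holomorphic_on_subset[OF E]) (use r in auto)
    show "continuous_on (cball z (r/2)) ?E"
      by (rule continuous_on_subset[OF holomorphic_on_imp_continuous_on[OF E]]) (use r in auto)
    show "cmod (?E x) \<le> exp 1" if "cmod (z - x) = r/2" for x
    proof -
      have "x \<in> ball z r" using that r by (simp add: dist_norm)
      then have "Re (F x) \<le> C" using b by force
      then show ?thesis unfolding nE using C by simp
    qed
  qed (use r in auto)
  then have 1: "cmod (deriv ?E z) \<le> 2 * exp 1 / r" by (simp add: field_simps)
  have "(F has_field_derivative deriv F z) (at z)"
    by (rule holomorphic_derivI[OF F]) (use r in auto)
  then have "(?E has_field_derivative (deriv F z / C * ?E z)) (at z)"
    using C by (auto intro!: derivative_eq_intros)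
  then have "deriv ?E z = deriv F z / C * ?E z" by (rule DERIV_imp_deriv)
  then have "cmod (deriv F z) / C * cmod (?E z) \<le> 2 * exp 1 / r"
    using 1 C by (simp add: norm_mult norm_divide)
  moreover have "exp (-1) \<le> cmod (?E z)"
  proof -
    have "- C \<le> Re (F z)" using b[of z] r by auto
    then show ?thesis unfolding nE using C by (simp add: field_simps)
  qed
  then have "cmod (deriv F z) / C * exp (-1) \<le> cmod (deriv F z) / C * cmod (?E z)"
    using C by (intro mult_left_mono) auto
  ultimately have "cmod (deriv F z) / C * exp (-1) \<le> 2 * exp 1 / r" by linarith
  then have "cmod (deriv F z) / C * exp (-1) * (C * exp 1) \<le> 2 * exp 1 / r * (C * exp 1)"
    using C by (intro mult_right_mono) auto
  then have "cmod (deriv F z) * (exp (-1) * exp 1) \<le> 2 * (exp 1 * exp 1) * C / r" using C by (simp add: field_simps)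
  then show ?thesis by (simp add: exp_add[symmetric])
qed

text \<open>
  On a disc \<open>Re (c f)\<close> is the real part of a primitive of the holomorphic function \<open>c H + cnj c G\<close>. The
  choices \<open>c = 1\<close> and \<open>c = i\<close> bound \<open>H + G\<close> and \<open>H - G\<close>.
\<close>

lemma harmonic_gradient_bound:
  assumes r: "0 < r" and C: "0 < C" and f: "qc_harmonic_data k f H G (ball z r)"
    and b: "\<And>x. x \<in> ball z r \<Longrightarrow> cmod (f x) \<le> C"
  shows "cmod (H z) \<le> 2 * exp 2 * C / r" "cmod (G z) \<le> 2 * exp 2 * C / r"
proof -
  have hH: "H holomorphic_on ball z r" and hG: "G holomorphic_on ball z r"
    and der: "\<And>x. x \<in> ball z r \<Longrightarrow> (f has_derivative (\<lambda>h. H x * h + cnj (G x * h))) (at x)"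
    using f by (auto simp: qc_harmonic_data_def)
  have *: "cmod (c * H z + cnj c * G z) \<le> 2 * exp 2 * C / r" if c: "cmod c = 1" for c
  proof -
    let ?A = "\<lambda>z. c * H z + cnj c * G z"
    have hA: "?A holomorphic_on ball z r" using hH hG by (intro holomorphic_intros)
    obtain F0 where F0: "\<And>x. x \<in> ball z r \<Longrightarrow> (F0 has_field_derivative ?A x) (at x within ball z r)"
      using holomorphic_convex_primitive'[OF convex_ball open_ball hA] by auto
    define F where "F = (\<lambda>x. F0 x - F0 z + c * f z)"
    have dF: "(F has_field_derivative ?A x) (at x)" if "x \<in> ball z r" for x
    proof -
      have "(F0 has_field_derivative ?A x) (at x)" using F0[OF that] unfolding at_within_open[OF that open_ball] .
      from DERIV_add[OF DERIV_diff[OF this DERIV_const] DERIV_const] show ?thesis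
        unfolding F_def by simp
    qed
    have Z: "((\<lambda>x. Re (F x) - Re (c * f x)) has_derivative (\<lambda>h. 0)) (at x within ball z r)" if "x \<in> ball z r" for x
    proof -
      have "((\<lambda>x. Re (F x) - Re (c * f x)) has_derivative (\<lambda>h. Re (?A x * h) - Re (c * (H x * h + cnj (G x * h))))) (at x)"
        using dF[OF that] der[OF that] unfolding has_field_derivative_def
        by (intro has_derivative_diff has_derivative_Re has_derivative_mult_right)
      moreover have "(\<lambda>h. Re (?A x * h) - Re (c * (H x * h + cnj (G x * h)))) = (\<lambda>h. 0)"
        by (auto simp: algebra_simps)
      ultimately have "((\<lambda>x. Re (F x) - Re (c * f x)) has_derivative (\<lambda>h. 0)) (at x)" by (simp only:)
      then show ?thesis by (rule has_derivative_at_withinI)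
    qed
    from has_derivative_zero_constant[OF convex_ball Z]
    obtain d where d: "\<And>x. x \<in> ball z r \<Longrightarrow> Re (F x) - Re (c * f x) = d" by blast
    have "d = 0" using d[of z] r by (simp add: F_def)
    then have "\<bar>Re (F x)\<bar> \<le> C" if "x \<in> ball z r" for x
    proof -
      have "\<bar>Re (F x)\<bar> = \<bar>Re (c * f x)\<bar>" using d[OF that] \<open>d = 0\<close> by simp
      also have "\<dots> \<le> cmod (c * f x)" by (rule abs_Re_le_cmod)
      also have "\<dots> \<le> C" using b[OF that] c by (simp add: norm_mult)
      finally show ?thesis .
    qed
    moreover have "F holomorphic_on ball z r"
      unfolding holomorphic_on_open[OF open_ball] using dF by blast
    ultimately have "cmod (deriv F z) \<le> 2 * exp 2 * C / r" by (intro deriv_bound_by_real_part r C)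
    moreover have "deriv F z = ?A z" using dF[of z] r by (intro DERIV_imp_deriv) auto
    ultimately show ?thesis by simp
  qed
  have 1: "cmod (H z + G z) \<le> 2 * exp 2 * C / r" using *[of 1] by simp
  have "\<i> * H z + cnj \<i> * G z = \<i> * (H z - G z)" by (simp add: algebra_simps)
  then have "cmod (\<i> * H z + cnj \<i> * G z) = cmod (H z - G z)" by (simp add: norm_mult)
  then have 2: "cmod (H z - G z) \<le> 2 * exp 2 * C / r" using *[of \<i>] by simp
  have "2 * cmod (H z) = cmod ((H z + G z) + (H z - G z))"
  proof -
    have "(H z + G z) + (H z - G z) = 2 * H z" by simp
    then show ?thesis by (simp add: norm_mult)
  qed
  also have "\<dots> \<le> 2 * (2 * exp 2 * C / r)" using order_trans[OF norm_triangle_ineq add_mono[OF 1 2]] by (simp add: mult_ac)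
  finally show "cmod (H z) \<le> 2 * exp 2 * C / r" by simp
  have "2 * cmod (G z) = cmod ((H z + G z) - (H z - G z))"
  proof -
    have "(H z + G z) - (H z - G z) = 2 * G z" by simp
    then show ?thesis by (simp add: norm_mult)
  qed
  also have "\<dots> \<le> 2 * (2 * exp 2 * C / r)" using order_trans[OF norm_triangle_ineq4 add_mono[OF 1 2]] by (simp add: mult_ac)
  finally show "cmod (G z) \<le> 2 * exp 2 * C / r" by simp
qed

lemma locally_bounded_imp_bounded_on_compact:
  fixes h :: "'i \<Rightarrow> 'a::metric_space \<Rightarrow> real"
  assumes loc: "\<And>z. z \<in> D \<Longrightarrow> \<exists>r>0. \<exists>C. \<forall>i. \<forall>x\<in>ball z r. h i x \<le> C"
    and K: "compact K" "K \<subseteq> D"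
  shows "\<exists>C. \<forall>i. \<forall>x\<in>K. h i x \<le> C"
proof -
  obtain r C where rC: "\<And>z. z \<in> D \<Longrightarrow> 0 < r z" "\<And>z i x. z \<in> D \<Longrightarrow> x \<in> ball z (r z) \<Longrightarrow> h i x \<le> C z"
    using loc by metis
  obtain T where T: "T \<subseteq> K" "finite T" "K \<subseteq> (\<Union>z\<in>T. ball z (r z))"
    by (rule compactE_image[OF K(1), of K "\<lambda>z. ball z (r z)"]) (use rC(1) K in force)+
  have "h i x \<le> Max (insert 0 (C ` T))" if x: "x \<in> K" for i x
  proof -
    obtain z where z: "z \<in> T" "x \<in> ball z (r z)" using T x by blast
    then have "h i x \<le> C z" using rC(2) T K by blast
    also have "\<dots> \<le> Max (insert 0 (C ` T))" using z T by (intro Max_ge) auto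
    finally show ?thesis .
  qed
  then show ?thesis by blast
qed

section \<open>Compactness of locally bounded families\<close>

text \<open>
  Montel's theorem is applied to the Wirtinger derivatives, whose local bounds come from the gradient
  estimate. The maps themselves are recovered from their derivatives and their values at \<open>a\<close>: on a disc,
  convergence at one point and uniform convergence of the derivatives give uniform convergence, so the
  set of points of convergence is open and closed in \<open>D\<close>.
\<close>

lemma harmonic_montel:
  assumes D: "open D" "connected D" and a: "a \<in> D"
    and f: "\<And>n. qc_harmonic_data k (f n) (H n) (G n) D"
    and bdd: "\<And>z. z \<in> D \<Longrightarrow> \<exists>r>0. \<exists>C. \<forall>n. \<forall>x\<in>ball z r. cmod (f n x) \<le> C"
  obtains s F H' G' where "strict_mono (s :: nat \<Rightarrow> nat)" "H' holomorphic_on D" "G' holomorphic_on D"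
    "\<And>z. z \<in> D \<Longrightarrow> (F has_derivative (\<lambda>h. H' z * h + cnj (G' z * h))) (at z)"
    "\<And>z. z \<in> D \<Longrightarrow> cmod (G' z) \<le> k * cmod (H' z)"
    "\<And>K. \<lbrakk>compact K; K \<subseteq> D\<rbrakk> \<Longrightarrow> uniform_limit K (\<lambda>n. H (s n)) H' sequentially"
    "\<And>z. z \<in> D \<Longrightarrow> \<exists>r>0. cball z r \<subseteq> D \<and> uniform_limit (cball z r) (\<lambda>n. f (s n)) F sequentially"
proof -
  have hol: "H n holomorphic_on D" "G n holomorphic_on D" for n using f by (auto simp: qc_harmonic_data_def)
  have loc: "\<exists>r>0. \<exists>C. \<forall>n. \<forall>x\<in>ball z r \<inter> D. cmod (H n x) \<le> C \<and> cmod (G n x) \<le> C" if z: "z \<in> D" for z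
  proof -
    obtain r1 C where r1: "0 < r1" "\<And>n x. x \<in> ball z r1 \<Longrightarrow> cmod (f n x) \<le> C" using bdd[OF z] by blast
    obtain r2 where r2: "0 < r2" "ball z r2 \<subseteq> D" using D(1) z open_contains_ball by blast
    define r where "r = min r1 r2 / 2"
    have r: "0 < r" using r1 r2 by (simp add: r_def)
    have "cmod (H n x) \<le> 2 * exp 2 * (\<bar>C\<bar> + 1) / r \<and> cmod (G n x) \<le> 2 * exp 2 * (\<bar>C\<bar> + 1) / r" if x: "x \<in> ball z r" for n x
    proof -
      have sub: "y \<in> ball z r1 \<inter> ball z r2" if "y \<in> ball x r" for y
      proof -
        have "dist z y < r + r" using dist_triangle[of z y x] that x by simp
        then show ?thesis by (simp add: r_def)
      qed
      have q: "qc_harmonic_data k (f n) (H n) (G n) (ball x r)"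
        by (rule qc_harmonic_data_subset[OF f]) (use sub r2 in blast)
      have b: "cmod (f n y) \<le> \<bar>C\<bar> + 1" if "y \<in> ball x r" for y
        using r1(2)[of y n] sub[OF that] by fastforce
      show ?thesis using harmonic_gradient_bound[OF r _ q b] by auto
    qed
    then show ?thesis using r by blast
  qed
  have bd: "\<exists>B. \<forall>h\<in>range \<F>. \<forall>z\<in>K. cmod (h z) \<le> B"
    if K: "compact K" "K \<subseteq> D" and \<F>: "\<And>n. \<exists>m. \<F> n = H m \<or> \<F> n = G m" for K and \<F> :: "nat \<Rightarrow> complex \<Rightarrow> complex"
  proof -
    have "\<exists>C. \<forall>n. \<forall>x\<in>K. (if x \<in> D then cmod (H n x) + cmod (G n x) else 0) \<le> C"
    proof (rule locally_bounded_imp_bounded_on_compact[OF _ K])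
      fix z assume "z \<in> D"
      then obtain r C where rC: "0 < r" "\<And>n x. x \<in> ball z r \<inter> D \<Longrightarrow> cmod (H n x) \<le> C \<and> cmod (G n x) \<le> C"
        using loc by blast
      have "(if x \<in> D then cmod (H n x) + cmod (G n x) else 0) \<le> \<bar>C\<bar> + \<bar>C\<bar>" if "x \<in> ball z r" for n x
        using rC(2)[of x n] that by auto
      then show "\<exists>r>0. \<exists>C. \<forall>n. \<forall>x\<in>ball z r. (if x \<in> D then cmod (H n x) + cmod (G n x) else 0) \<le> C"
        using rC(1) by blast
    qed
    then obtain C where C: "\<And>n x. x \<in> K \<Longrightarrow> cmod (H n x) + cmod (G n x) \<le> C" using K by (smt (verit) subsetD)
    have "cmod (\<F> n x) \<le> C" if "x \<in> K" for n x
    proof -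
      obtain m where "\<F> n = H m \<or> \<F> n = G m" using \<F> by blast
      then show ?thesis using C[OF that, of m] by (smt (verit) norm_ge_zero)
    qed
    then show ?thesis by blast
  qed
  obtain H' s1 where H': "H' holomorphic_on D" "strict_mono (s1 :: nat \<Rightarrow> nat)"
    "\<And>K. \<lbrakk>compact K; K \<subseteq> D\<rbrakk> \<Longrightarrow> uniform_limit K (H \<circ> s1) H' sequentially"
    by (rule Montel[OF D(1), of "range H" H]) (use hol bd[of _ H] in blast)+
  obtain G' s2 where G': "G' holomorphic_on D" "strict_mono (s2 :: nat \<Rightarrow> nat)"
    "\<And>K. \<lbrakk>compact K; K \<subseteq> D\<rbrakk> \<Longrightarrow> uniform_limit K ((G \<circ> s1) \<circ> s2) G' sequentially"
  proof (rule Montel[OF D(1), of "range (G \<circ> s1)" "G \<circ> s1"])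
    show "h holomorphic_on D" if "h \<in> range (G \<circ> s1)" for h using that hol(2) by auto
    show "\<exists>B. \<forall>h\<in>range (G \<circ> s1). \<forall>z\<in>K. cmod (h z) \<le> B" if "compact K" "K \<subseteq> D" for K
      by (rule bd[OF that]) auto
  qed auto
  obtain Ca where Ca: "\<And>n. cmod (f n a) \<le> Ca" using bdd[OF a] by (metis centre_in_ball)
  have "compact (cball 0 Ca :: complex set)" by simp
  then obtain l s3 where l: "strict_mono (s3 :: nat \<Rightarrow> nat)" "((\<lambda>n. f (s1 (s2 n)) a) \<circ> s3) \<longlonglongrightarrow> l"
    unfolding compact_def using Ca by (metis dist_0_norm mem_cball)
  define s where "s = s1 \<circ> s2 \<circ> s3"
  have s: "strict_mono s" unfolding s_def using H'(2) G'(2) l(1) by (intro strict_mono_o)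
  have sub23: "filterlim (s2 \<circ> s3) sequentially sequentially" 
    using G'(2) l(1) by (intro filterlim_subseq strict_mono_o)
  have sub3: "filterlim s3 sequentially sequentially" using l(1) by (rule filterlim_subseq)
  have uH: "uniform_limit K (\<lambda>n. H (s n)) H' sequentially" if "compact K" "K \<subseteq> D" for K
    using filterlim_compose[OF H'(3)[OF that] sub23] by (simp add: o_def s_def)
  have uG: "uniform_limit K (\<lambda>n. G (s n)) G' sequentially" if "compact K" "K \<subseteq> D" for K
    using filterlim_compose[OF G'(3)[OF that] sub3] by (simp add: o_def s_def)
  let ?f = "\<lambda>n. f (s n)"
  have der: "(?f n has_derivative (\<lambda>h. H (s n) z * h + cnj (G (s n) z * h))) (at z)" if "z \<in> D" for n z
    using f that by (auto simp: qc_harmonic_data_def)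
  have near: "\<forall>\<^sub>F n in sequentially. \<forall>x\<in>S. \<forall>h. cmod ((H (s n) x * h + cnj (G (s n) x * h)) - (H' x * h + cnj (G' x * h))) \<le> e * cmod h"
    if S: "compact S" "S \<subseteq> D" and e: "0 < e" for S e
  proof -
    have "\<forall>\<^sub>F n in sequentially. \<forall>x\<in>S. dist (H (s n) x) (H' x) < e/2"
         "\<forall>\<^sub>F n in sequentially. \<forall>x\<in>S. dist (G (s n) x) (G' x) < e/2"
      using uniform_limitD[OF uH[OF S], of "e/2"] uniform_limitD[OF uG[OF S], of "e/2"] e by simp_all
    then show ?thesis
    proof eventually_elim
      case (elim n)
      show ?case
      proof (intro ballI allI)
        fix x h assume x: "x \<in> S"
        have "(H (s n) x * h + cnj (G (s n) x * h)) - (H' x * h + cnj (G' x * h))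
            = (H (s n) x - H' x) * h + cnj ((G (s n) x - G' x) * h)"
          by (simp add: algebra_simps)
        also have "cmod \<dots> \<le> cmod (H (s n) x - H' x) * cmod h + cmod (G (s n) x - G' x) * cmod h"
          by (rule order_trans[OF norm_triangle_ineq]) (simp only: complex_mod_cnj norm_mult order_refl)
        also have "\<dots> \<le> e/2 * cmod h + e/2 * cmod h"
          using elim x by (intro add_mono mult_right_mono) (auto simp: dist_norm less_imp_le)
        finally show "cmod ((H (s n) x * h + cnj (G (s n) x * h)) - (H' x * h + cnj (G' x * h))) \<le> e * cmod h" by simp
      qed
    qed
  qed
  have local: "\<exists>g. \<forall>x\<in>cball z r. (\<lambda>n. ?f n x) \<longlonglongrightarrow> g x \<and> (g has_derivative (\<lambda>h. H' x * h + cnj (G' x * h))) (at x within cball z r)"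
    if zr: "cball z r \<subseteq> D" and x0: "x0 \<in> cball z r" and conv: "convergent (\<lambda>n. ?f n x0)" for z r x0
  proof -
    obtain l where l: "(\<lambda>n. ?f n x0) \<longlonglongrightarrow> l" using conv by (auto simp: convergent_def)
    show ?thesis
    proof (rule has_derivative_sequence[where f = ?f and f' = "\<lambda>n x h. H (s n) x * h + cnj (G (s n) x * h)"
          and g' = "\<lambda>x h. H' x * h + cnj (G' x * h)", OF convex_cball _ _ x0 l])
      show "(?f n has_derivative (\<lambda>h. H (s n) x * h + cnj (G (s n) x * h))) (at x within cball z r)" if "x \<in> cball z r" for n x
        by (rule has_derivative_at_withinI[OF der]) (use zr that in blast)
      show "\<forall>\<^sub>F n in sequentially. \<forall>x\<in>cball z r. \<forall>h. cmod (H (s n) x * h + cnj (G (s n) x * h) - (H' x * h + cnj (G' x * h))) \<le> e * cmod h" if "e > 0" for e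
        using near[OF compact_cball zr that] .
    qed
  qed
  have ball_ex: "\<exists>r>0. cball z r \<subseteq> D" if "z \<in> D" for z using D(1) that open_contains_cball by blast
  have conv: "convergent (\<lambda>n. ?f n z)" if z: "z \<in> D" for z
  proof -
    have ca: "convergent (\<lambda>n. ?f n a)" using l(2) by (auto simp: convergent_def s_def o_def)
    have "convergent (\<lambda>n. ?f n a) \<longleftrightarrow> convergent (\<lambda>n. ?f n z)"
    proof (rule connected_equivalence_relation[OF D(2) a z])
      fix y assume y: "y \<in> D"
      obtain r where r: "0 < r" "cball y r \<subseteq> D" using ball_ex[OF y] by blast
      have "convergent (\<lambda>n. ?f n y) \<longleftrightarrow> convergent (\<lambda>n. ?f n x)" if x: "x \<in> cball y r" for x
      proof -
        have yc: "y \<in> cball y r" using r by simp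
        show ?thesis using local[OF r(2) x] local[OF r(2) yc] x yc by (meson convergent_def)
      qed
      moreover have "ball y r \<subseteq> D" using r by (meson ball_subset_cball order_trans)
      ultimately show "\<exists>T. openin (top_of_set D) T \<and> y \<in> T \<and> (\<forall>x\<in>T. convergent (\<lambda>n. ?f n y) \<longleftrightarrow> convergent (\<lambda>n. ?f n x))"
        using r(1) by (intro exI[of _ "ball y r"]) (auto intro: openin_open_subtopology simp: D(1) openin_open_eq)
    qed auto
    then show ?thesis using ca by simp
  qed
  define F where "F = (\<lambda>z. lim (\<lambda>n. ?f n z))"
  have limF: "(\<lambda>n. ?f n z) \<longlonglongrightarrow> F z" if "z \<in> D" for z
    using conv[OF that] unfolding F_def by (simp add: convergent_LIMSEQ_iff)
  have derF: "(F has_derivative (\<lambda>h. H' z * h + cnj (G' z * h))) (at z)" if z: "z \<in> D" for z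
  proof -
    obtain r where r: "0 < r" "cball z r \<subseteq> D" using ball_ex[OF z] by blast
    obtain g where g: "\<And>x. x \<in> cball z r \<Longrightarrow> (\<lambda>n. ?f n x) \<longlonglongrightarrow> g x"
       "\<And>x. x \<in> cball z r \<Longrightarrow> (g has_derivative (\<lambda>h. H' x * h + cnj (G' x * h))) (at x within cball z r)"
    proof -
      have "z \<in> cball z r" using r(1) by simp
      from local[OF r(2) this conv[OF z]] show ?thesis using that by blast
    qed
    have gF: "g x = F x" if "x \<in> cball z r" for x
      using LIMSEQ_unique[OF g(1)[OF that] limF] that r(2) by auto
    have "(g has_derivative (\<lambda>h. H' z * h + cnj (G' z * h))) (at z within ball z r)"
      by (rule has_derivative_subset[OF g(2)]) (use r in auto)
    then have "(g has_derivative (\<lambda>h. H' z * h + cnj (G' z * h))) (at z)"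
      using at_within_open[of z "ball z r"] r(1) by simp
    then show ?thesis
      by (rule has_derivative_transform_within_open[of _ _ _ _ "ball z r"]) (use r gF in auto)
  qed
  have dil: "cmod (G' z) \<le> k * cmod (H' z)" if z: "z \<in> D" for z
  proof (rule tendsto_le[OF sequentially_bot])
    have "compact {z}" "{z} \<subseteq> D" using z by auto
    then have "(\<lambda>n. H (s n) z) \<longlonglongrightarrow> H' z" "(\<lambda>n. G (s n) z) \<longlonglongrightarrow> G' z"
      using tendsto_uniform_limitI[OF uH] tendsto_uniform_limitI[OF uG] by blast+
    then show "(\<lambda>n. k * cmod (H (s n) z)) \<longlonglongrightarrow> k * cmod (H' z)" "(\<lambda>n. cmod (G (s n) z)) \<longlonglongrightarrow> cmod (G' z)"
      by (auto intro!: tendsto_intros)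
    show "\<forall>\<^sub>F n in sequentially. cmod (G (s n) z) \<le> k * cmod (H (s n) z)"
      using f z by (auto simp: qc_harmonic_data_def)
  qed
  have unif: "\<exists>r>0. cball z r \<subseteq> D \<and> uniform_limit (cball z r) ?f F sequentially" if z: "z \<in> D" for z
  proof -
    obtain r where r: "0 < r" "cball z r \<subseteq> D" using ball_ex[OF z] by blast
    have "uniform_limit (cball z r) ?f F sequentially"
    proof (rule uniform_limitI)
      fix e :: real assume e: "0 < e"
      define e' where "e' = e / (2 * r)"
      have e': "0 < e'" using e r by (simp add: e'_def)
      have "\<forall>\<^sub>F n in sequentially. dist (?f n z) (F z) < e/2" using tendstoD[OF limF[OF z], of "e/2"] e by simp
      with near[OF compact_cball r(2) e']
      show "\<forall>\<^sub>F n in sequentially. \<forall>x\<in>cball z r. dist (?f n x) (F x) < e"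
      proof eventually_elim
        case (elim n)
        show ?case
        proof
          fix x assume x: "x \<in> cball z r"
          have "cmod ((?f n x - F x) - (?f n z - F z)) \<le> e' * cmod (x - z)"
          proof (rule differentiable_bound[OF convex_cball[of z r]])
            fix y assume y: "y \<in> cball z r"
            then have yD: "y \<in> D" using r by blast
            show "((\<lambda>x. ?f n x - F x) has_derivative (\<lambda>h. (H (s n) y * h + cnj (G (s n) y * h)) - (H' y * h + cnj (G' y * h)))) (at y within cball z r)"
              by (rule has_derivative_at_withinI[OF has_derivative_diff[OF der[OF yD] derF[OF yD]]])
            show "onorm (\<lambda>h. (H (s n) y * h + cnj (G (s n) y * h)) - (H' y * h + cnj (G' y * h))) \<le> e'"
              by (rule onorm_le) (rule elim(1)[rule_format, OF y])
          qed (use x r(1) in auto)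
          also have "\<dots> \<le> e' * r" using x e' by (intro mult_left_mono) (auto simp: dist_norm norm_minus_commute)
          also have "\<dots> = e / 2" using r by (simp add: e'_def)
          finally have "cmod ((?f n x - F x) - (?f n z - F z)) \<le> e/2" .
          moreover have "cmod (?f n x - F x) \<le> cmod ((?f n x - F x) - (?f n z - F z)) + cmod (?f n z - F z)"
            using norm_triangle_sub[of "?f n x - F x" "?f n z - F z"] by (simp add: add.commute)
          moreover have "cmod (?f n z - F z) < e/2" using elim(2) by (simp add: dist_norm)
          ultimately show "dist (?f n x) (F x) < e" unfolding dist_norm by linarith
        qed
      qed
    qed
    then show ?thesis using r by blast
  qed
  show ?thesis using that[OF s H'(1) G'(1) derF dil uH unif] .
qed

section \<open>Injectivity of the limit and local bounds\<close>

text \<open>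
  Since the derivative of \<open>F\<close> at \<open>z\<close> is invertible, \<open>|F - F z|\<close> is bounded below on a small circle
  around \<open>z\<close>. For large \<open>n\<close> the minimum of \<open>|f n - F z|\<close> on the disc is therefore attained in its
  interior, and as \<open>f n\<close> is an open map this minimum is zero.
\<close>

lemma limit_value_attained_nearby:
  assumes k: "0 \<le> k" "k < 1" and D: "open D"
    and f: "\<And>n::nat. qc_harmonic_data k (f n) (H n) (G n) D" and inj: "\<And>n. inj_on (f n) D"
    and z: "z \<in> D" and r: "0 < r" "cball z r \<subseteq> D"
    and unif: "uniform_limit (cball z r) f F sequentially"
    and derF: "(F has_derivative (\<lambda>h. a * h + cnj (b * h))) (at z)" and a: "a \<noteq> 0" "cmod b \<le> k * cmod a"
    and e: "0 < e"
  shows "\<forall>\<^sub>F n in sequentially. F z \<in> f n ` ball z e"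
proof -
  \<comment> \<open>a lower bound for the derivative of \<open>F\<close> at \<open>z\<close>\<close>
  define c where "c = (1 - k) * cmod a"
  have c: "0 < c" using k a by (simp add: c_def)
  have low: "c * cmod h \<le> cmod (a * h + cnj (b * h))" for h
  proof -
    have "cmod (a * h) \<le> cmod (a * h + cnj (b * h)) + cmod (cnj (b * h))"
      by (metis add_diff_cancel_right' norm_triangle_ineq4)
    moreover have "cmod (cnj (b * h)) \<le> k * cmod a * cmod h"
      unfolding complex_mod_cnj norm_mult using a by (intro mult_right_mono) auto
    moreover have "c * cmod h = cmod (a * h) - k * cmod a * cmod h"
      by (simp add: c_def norm_mult algebra_simps)
    ultimately show ?thesis by linarith
  qed
  obtain d where d: "0 < d" "\<And>x. cmod (x - z) < d \<Longrightarrow> cmod (F x - F z - (a * (x - z) + cnj (b * (x - z)))) \<le> c/2 * cmod (x - z)"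
  proof -
    have "0 < c/2" using c by simp
    then have "\<exists>d>0. \<forall>y. cmod (y - z) < d \<longrightarrow> cmod (F y - F z - (a * (y - z) + cnj (b * (y - z)))) \<le> c/2 * cmod (y - z)"
      using derF[unfolded has_derivative_at_alt] by blast
    then show ?thesis using that by blast
  qed
  define \<rho> where "\<rho> = min (min (e/2) r) (d/2)"
  have \<rho>: "0 < \<rho>" "\<rho> < e" "\<rho> \<le> r" "\<rho> < d" using e r d by (auto simp: \<rho>_def)
  have subr: "cball z \<rho> \<subseteq> cball z r" using \<rho> by auto
  have far: "c/2 * \<rho> \<le> cmod (F x - F z)" if x: "dist z x = \<rho>" for x
  proof -
    have xr: "cmod (x - z) = \<rho>" using x by (simp add: dist_norm norm_minus_commute)
    have "c * \<rho> \<le> cmod (a * (x - z) + cnj (b * (x - z)))" using low[of "x - z"] xr by simp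
    also have "\<dots> \<le> cmod (F x - F z) + cmod (F x - F z - (a * (x - z) + cnj (b * (x - z))))"
      by (metis add_diff_cancel_left' diff_add_cancel norm_triangle_ineq4 diff_diff_eq2)
    also have "\<dots> \<le> cmod (F x - F z) + c/2 * \<rho>" using d(2)[of x] xr \<rho> by simp
    finally show ?thesis by simp
  qed
  have "0 < c * \<rho> / 8" using c \<rho> by simp
  from uniform_limitD[OF unif this]
  show ?thesis
  proof eventually_elim
    case (elim n)
    have cf: "continuous_on D (f n)" by (rule qc_harmonic_data_continuous[OF f])
    have "continuous_on (cball z \<rho>) (\<lambda>x. cmod (f n x - F z))"
      by (intro continuous_intros continuous_on_subset[OF cf]) (use subr r in blast)
    then obtain m where m: "m \<in> cball z \<rho>" "\<And>x. x \<in> cball z \<rho> \<Longrightarrow> cmod (f n m - F z) \<le> cmod (f n x - F z)"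
      using continuous_attains_inf[OF compact_cball, of z \<rho> "\<lambda>x. cmod (f n x - F z)"] \<rho> by auto
    have "cmod (f n m - F z) \<le> cmod (f n z - F z)" using m(2)[of z] \<rho> by simp
    also have "\<dots> < c * \<rho> / 8" using elim r by (auto simp: dist_norm)
    finally have small: "cmod (f n m - F z) < c * \<rho> / 8" .
    have "dist z m \<noteq> \<rho>"
    proof
      assume eq: "dist z m = \<rho>"
      have "dist (f n m) (F m) < c * \<rho> / 8" using elim m(1) subr by blast
      moreover have "cmod (F m - F z) \<le> cmod (f n m - F z) + dist (f n m) (F m)"
        by (metis dist_norm dist_triangle3 add.commute dist_commute)
      ultimately have "cmod (F m - F z) < c * \<rho> / 4" using small by simp
      moreover have "0 < c * \<rho>" using c \<rho> by simp
      ultimately show False using far[OF eq] by simp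
    qed
    then have mb: "m \<in> ball z \<rho>" using m(1) by auto
    have bD: "ball z \<rho> \<subseteq> D" using subr r ball_subset_cball by blast
    have op: "open (f n ` ball z \<rho>)"
      by (rule invariance_of_domain[OF continuous_on_subset[OF cf bD] open_ball inj_on_subset[OF inj bD]])
    have "f n m = F z"
    proof (rule ccontr)
      assume ne: "f n m \<noteq> F z"
      obtain t where t: "0 < t" "ball (f n m) t \<subseteq> f n ` ball z \<rho>" using op mb open_contains_ball by blast
      define u where "u = min (1/2) (t / (2 * cmod (f n m - F z)))"
      have pos: "0 < cmod (f n m - F z)" using ne by simp
      have u: "0 < u" "u \<le> 1/2" using t pos by (auto simp: u_def)
      have "u * cmod (f n m - F z) \<le> t / (2 * cmod (f n m - F z)) * cmod (f n m - F z)"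
        using pos by (intro mult_right_mono) (auto simp: u_def)
      also have "\<dots> < t" using pos t by simp
      finally have ut: "u * cmod (f n m - F z) < t" .
      \<comment> \<open>a value of \<open>f n\<close> slightly closer to \<open>F z\<close> than \<open>f n m\<close>\<close>
      define v where "v = f n m - of_real u * (f n m - F z)"
      have "dist (f n m) v = u * cmod (f n m - F z)" using u by (simp add: v_def dist_norm norm_mult)
      then have "v \<in> ball (f n m) t" using ut by simp
      then obtain x where x: "x \<in> ball z \<rho>" "v = f n x" using t(2) by blast
      have "v - F z = of_real (1 - u) * (f n m - F z)" by (simp add: v_def algebra_simps)
      then have "cmod (v - F z) = (1 - u) * cmod (f n m - F z)" using u by (simp only: norm_mult norm_of_real)
      also have "\<dots> < 1 * cmod (f n m - F z)" using u pos by (intro mult_strict_right_mono) auto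
      finally have "cmod (f n x - F z) < cmod (f n m - F z)" using x by simp
      moreover have "cmod (f n m - F z) \<le> cmod (f n x - F z)" using m(2)[of x] x(1) by simp
      ultimately show False by simp
    qed
    moreover have "m \<in> ball z e" using mb \<rho> by auto
    ultimately show ?case by (metis imageI)
  qed
qed

text \<open>
  If \<open>F\<close> takes a value at two points, then so does \<open>f n\<close> for large \<open>n\<close>, in disjoint neighbourhoods of
  these points.
\<close>

lemma limit_of_injective_qc_harmonic_is_injective:
  assumes k: "0 \<le> k" "k < 1" and D: "open D"
    and f: "\<And>n::nat. qc_harmonic_data k (f n) (H n) (G n) D" and inj: "\<And>n. inj_on (f n) D"
    and unif: "\<And>z. z \<in> D \<Longrightarrow> \<exists>r>0. cball z r \<subseteq> D \<and> uniform_limit (cball z r) f F sequentially"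
    and F: "qc_harmonic_data k F H' G' D"
  shows "inj_on F D"
proof (rule inj_onI, rule ccontr)
  fix z1 z2 assume z: "z1 \<in> D" "z2 \<in> D" "F z1 = F z2" "z1 \<noteq> z2"
  define e where "e = dist z1 z2 / 2"
  have e: "0 < e" using z by (simp add: e_def)
  obtain r1 r2 where r1: "0 < r1" "ball z1 r1 \<subseteq> D" and r2: "0 < r2" "ball z2 r2 \<subseteq> D"
    using D z open_contains_ball by metis
  have ev: "\<forall>\<^sub>F n in sequentially. F z \<in> f n ` ball z e'" if zD: "z \<in> D" and e': "0 < e'" for z e'
  proof -
    obtain r where r: "0 < r" "cball z r \<subseteq> D" "uniform_limit (cball z r) f F sequentially"
      using unif[OF zD] by blast
    have "(F has_derivative (\<lambda>h. H' z * h + cnj (G' z * h))) (at z)" "H' z \<noteq> 0" "cmod (G' z) \<le> k * cmod (H' z)"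
      using F zD by (simp_all add: qc_harmonic_data_def)
    from limit_value_attained_nearby[OF k D f inj zD r this e'] show ?thesis .
  qed
  have "\<forall>\<^sub>F n in sequentially. F z1 \<in> f n ` ball z1 (min e r1) \<and> F z2 \<in> f n ` ball z2 (min e r2)"
    using ev[OF z(1), of "min e r1"] ev[OF z(2), of "min e r2"] e r1 r2 by (auto simp: eventually_conj_iff)
  then obtain n where "F z1 \<in> f n ` ball z1 (min e r1)" "F z2 \<in> f n ` ball z2 (min e r2)"
    using eventually_happens'[OF sequentially_bot] by blast
  then obtain x1 x2 where x: "x1 \<in> ball z1 (min e r1)" "x2 \<in> ball z2 (min e r2)" "f n x1 = F z1" "f n x2 = F z2"
    by (metis imageE)
  then have "x1 \<in> D" "x2 \<in> D" "f n x1 = f n x2" using r1 r2 z by auto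
  then have "x1 = x2" using inj by (metis inj_onD)
  then have "dist z1 z2 < e + e" using x dist_triangle_less_add[of z1 x1 e z2 e] by (auto simp: dist_commute)
  then show False by (simp add: e_def)
qed

lemma qc_constant_pos: "0 < qc_constant k"
  by (simp add: qc_constant_def)

text \<open>
  Comparability of \<open>|f n|\<close> at two points, uniformly in \<open>n\<close>, is an equivalence relation that holds
  locally by \<open>qc_harmonic_harnack\<close> with \<open>e = 0\<close>; as \<open>D\<close> is connected, it relates every point to \<open>a\<close>.
\<close>

lemma qc_harmonic_family_locally_bounded:
  assumes k: "0 \<le> k" "k < 1" and D: "open D" "connected D" and a: "a \<in> D"
    and f: "\<And>n::nat. qc_harmonic_data k (f n) (H n) (G n) D" and inj: "\<And>n. inj_on (f n) D"
    and omit: "\<And>n. 0 \<notin> f n ` D" and bd: "\<And>n. cmod (f n a) \<le> 1" and z: "z \<in> D"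
  shows "\<exists>r>0. \<exists>C. \<forall>n. \<forall>x\<in>ball z r. cmod (f n x) \<le> C"
proof -
  let ?M = "qc_constant k"
  have local: "\<exists>r>0. ball y r \<subseteq> D \<and> (\<forall>n. \<forall>x1\<in>ball y r. \<forall>x2\<in>ball y r. cmod (f n x1) \<le> ?M * cmod (f n x2))" if y: "y \<in> D" for y
  proof -
    obtain r where r: "0 < r" "ball y r \<subseteq> D" using D(1) y open_contains_ball by blast
    have "cmod (f n x1) \<le> ?M * cmod (f n x2)" if x: "x1 \<in> ball y (r/2)" "x2 \<in> ball y (r/2)" for n x1 x2
    proof -
      have "0 \<notin> f n ` ball y r" using omit[of n] r(2) by blast
      moreover have "x1 \<in> cball y (r/2)" "x2 \<in> cball y (r/2)" using x by simp_all
      ultimately show ?thesis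
        using qc_harmonic_harnack[OF k r(1) qc_harmonic_data_subset[OF f r(2)] inj_on_subset[OF inj r(2)], of 0 n x1 x2]
        by simp
    qed
    moreover have "ball y (r/2) \<subseteq> ball y r" using r(1) by (intro subset_ball) simp
    then have "ball y (r/2) \<subseteq> D" using r(2) by (rule order_trans)
    ultimately show ?thesis using half_gt_zero[OF r(1)] by blast
  qed
  have "\<exists>C>0. \<forall>n. cmod (f n a) \<le> C * cmod (f n z) \<and> cmod (f n z) \<le> C * cmod (f n a)"
  proof (rule connected_equivalence_relation[OF D(2) a z])
    fix x y assume "\<exists>C>0. \<forall>n. cmod (f n x) \<le> C * cmod (f n y) \<and> cmod (f n y) \<le> C * cmod (f n x)"
    then show "\<exists>C>0. \<forall>n. cmod (f n y) \<le> C * cmod (f n x) \<and> cmod (f n x) \<le> C * cmod (f n y)" by blast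
  next
    fix x y w
    assume "\<exists>C>0. \<forall>n. cmod (f n x) \<le> C * cmod (f n y) \<and> cmod (f n y) \<le> C * cmod (f n x)"
      "\<exists>C>0. \<forall>n. cmod (f n y) \<le> C * cmod (f n w) \<and> cmod (f n w) \<le> C * cmod (f n y)"
    then obtain C1 C2 where C: "0 < C1" "0 < C2" "\<And>n. cmod (f n x) \<le> C1 * cmod (f n y)" "\<And>n. cmod (f n y) \<le> C1 * cmod (f n x)"
      "\<And>n. cmod (f n y) \<le> C2 * cmod (f n w)" "\<And>n. cmod (f n w) \<le> C2 * cmod (f n y)" by blast
    have "cmod (f n x) \<le> C1 * C2 * cmod (f n w)" for n
      using order_trans[OF C(3) mult_left_mono[OF C(5)]] C(1) by (simp add: mult.assoc)
    moreover have "cmod (f n w) \<le> C1 * C2 * cmod (f n x)" for n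
      using order_trans[OF C(6) mult_left_mono[OF C(4)]] C(2) by (simp add: mult_ac)
    ultimately show "\<exists>C>0. \<forall>n. cmod (f n x) \<le> C * cmod (f n w) \<and> cmod (f n w) \<le> C * cmod (f n x)"
      using C(1,2) by (intro exI[of _ "C1 * C2"]) auto
  next
    fix y assume "y \<in> D"
    then obtain r where r: "0 < r" "ball y r \<subseteq> D"
      "\<And>n x1 x2. x1 \<in> ball y r \<Longrightarrow> x2 \<in> ball y r \<Longrightarrow> cmod (f n x1) \<le> ?M * cmod (f n x2)" using local by blast
    have "openin (top_of_set D) (ball y r)" using r(2) by (simp add: openin_open_eq D(1))
    then show "\<exists>T. openin (top_of_set D) T \<and> y \<in> T \<and> (\<forall>x\<in>T. \<exists>C>0. \<forall>n. cmod (f n y) \<le> C * cmod (f n x) \<and> cmod (f n x) \<le> C * cmod (f n y))"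
      using r qc_constant_pos[of k] by (intro exI[of _ "ball y r"]) auto
  qed
  then obtain C where C: "0 < C" "\<And>n. cmod (f n z) \<le> C * cmod (f n a)" by blast
  have fz: "cmod (f n z) \<le> C" for n
    using order_trans[OF C(2)[of n] mult_left_mono[OF bd[of n], of C]] C(1) by simp
  obtain r where r: "0 < r" "\<And>n x1 x2. x1 \<in> ball z r \<Longrightarrow> x2 \<in> ball z r \<Longrightarrow> cmod (f n x1) \<le> ?M * cmod (f n x2)"
    using local[OF z] by blast
  have "cmod (f n x) \<le> ?M * C" if "x \<in> ball z r" for n x
  proof -
    have "cmod (f n x) \<le> ?M * cmod (f n z)" using r that by auto
    also have "\<dots> \<le> ?M * C" using fz[of n] qc_constant_pos[of k] by (intro mult_left_mono) auto
    finally show ?thesis .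
  qed
  then show ?thesis using r(1) by blast
qed

section \<open>Preimages and surjectivity of the limit\<close>

text \<open>
  For two points of \<open>\<Omega>\<close>, comparability of the distances of their preimages to all points outside \<open>D\<close>,
  eventually in \<open>n\<close>, is an equivalence relation that holds locally by the distortion estimate for the
  inverse maps. Since \<open>f n a\<close> is eventually close to \<open>w0\<close>, the preimages of \<open>w\<close> are compared with the
  fixed point \<open>a\<close>, so their distance to the complement of \<open>D\<close> is bounded below.
\<close>

lemma qc_harmonic_preimages_stay_inside:
  assumes k: "0 \<le> k" "k < 1" and D: "open D" "bounded D" and a: "a \<in> D"
    and f: "\<And>n::nat. qc_harmonic_data k (f n) (H n) (G n) D" and inj: "\<And>n. inj_on (f n) D"
    and g: "\<And>n z. z \<in> D \<Longrightarrow> g n (f n z) = z"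
    and \<Omega>: "open \<Omega>" "connected \<Omega>"
    and exh: "\<And>w. w \<in> \<Omega> \<Longrightarrow> \<exists>r>0. ball w r \<subseteq> \<Omega> \<and> (\<forall>\<^sub>F n in sequentially. ball w r \<subseteq> f n ` D)"
    and w0: "w0 \<in> \<Omega>" "(\<lambda>n. f n a) \<longlonglongrightarrow> w0" and w: "w \<in> \<Omega>"
  shows "\<exists>K. compact K \<and> K \<subseteq> D \<and> (\<forall>\<^sub>F n in sequentially. w \<in> f n ` D \<and> g n w \<in> K)"
proof -
  let ?M = "qc_constant k"
  define R where "R = (\<lambda>C n x y. x \<in> f n ` D \<and> y \<in> f n ` D \<and>
     (\<forall>e. e \<notin> D \<longrightarrow> cmod (g n x - e) \<le> C * cmod (g n y - e) \<and> cmod (g n y - e) \<le> C * cmod (g n x - e)))"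
  have local: "\<exists>r>0. ball y r \<subseteq> \<Omega> \<and> (\<forall>\<^sub>F n in sequentially. \<forall>x1\<in>ball y r. \<forall>x2\<in>ball y r. R ?M n x1 x2)" if y: "y \<in> \<Omega>" for y
  proof -
    obtain r where r: "0 < r" "ball y r \<subseteq> \<Omega>" "\<forall>\<^sub>F n in sequentially. ball y r \<subseteq> f n ` D" using exh[OF y] by blast
    have half: "ball y (r/2) \<subseteq> ball y r" using r(1) by (intro subset_ball) simp
    from r(3) have "\<forall>\<^sub>F n in sequentially. \<forall>x1\<in>ball y (r/2). \<forall>x2\<in>ball y (r/2). R ?M n x1 x2"
    proof eventually_elim
      case (elim n)
      have *: "cmod (g n x1 - e) \<le> ?M * cmod (g n x2 - e)"
        if "x1 \<in> ball y (r/2)" "x2 \<in> ball y (r/2)" "e \<notin> D" for x1 x2 e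
        by (rule qc_harmonic_inverse_harnack[OF k r(1) D(1) f inj g elim]) (use that in auto)
      show ?case unfolding R_def using * elim half by blast
    qed
    moreover have "ball y (r/2) \<subseteq> \<Omega>" using half r(2) by (rule order_trans)
    ultimately show ?thesis using half_gt_zero[OF r(1)] by blast
  qed
  have "\<exists>C>0. \<forall>\<^sub>F n in sequentially. R C n w0 w"
  proof (rule connected_equivalence_relation[OF \<Omega>(2) w0(1) w])
    fix x y assume "\<exists>C>0. \<forall>\<^sub>F n in sequentially. R C n x y"
    then show "\<exists>C>0. \<forall>\<^sub>F n in sequentially. R C n y x" by (simp add: R_def conj_commute conj_left_commute)
  next
    fix x y u assume "\<exists>C>0. \<forall>\<^sub>F n in sequentially. R C n x y" "\<exists>C>0. \<forall>\<^sub>F n in sequentially. R C n y u"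
    then obtain C1 C2 where C: "0 < C1" "0 < C2" "\<forall>\<^sub>F n in sequentially. R C1 n x y" "\<forall>\<^sub>F n in sequentially. R C2 n y u" by blast
    from C(3,4) have "\<forall>\<^sub>F n in sequentially. R (C1 * C2) n x u"
    proof eventually_elim
      case (elim n)
      have "cmod (g n x - e) \<le> C1 * C2 * cmod (g n u - e) \<and> cmod (g n u - e) \<le> C1 * C2 * cmod (g n x - e)" if e: "e \<notin> D" for e
      proof
        have c: "cmod (g n x - e) \<le> C1 * cmod (g n y - e)" "cmod (g n y - e) \<le> C1 * cmod (g n x - e)"
          "cmod (g n y - e) \<le> C2 * cmod (g n u - e)" "cmod (g n u - e) \<le> C2 * cmod (g n y - e)"
          using elim e unfolding R_def by blast+
        show "cmod (g n x - e) \<le> C1 * C2 * cmod (g n u - e)"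
          using order_trans[OF c(1) mult_left_mono[OF c(3)]] C(1) by (simp add: mult.assoc)
        show "cmod (g n u - e) \<le> C1 * C2 * cmod (g n x - e)"
          using order_trans[OF c(4) mult_left_mono[OF c(2)]] C(2) by (simp add: mult_ac)
      qed
      then show ?case using elim unfolding R_def by blast
    qed
    then show "\<exists>C>0. \<forall>\<^sub>F n in sequentially. R C n x u" using C(1,2) by (intro exI[of _ "C1 * C2"]) auto
  next
    fix y assume "y \<in> \<Omega>"
    then obtain r where r: "0 < r" "ball y r \<subseteq> \<Omega>"
      "\<forall>\<^sub>F n in sequentially. \<forall>x1\<in>ball y r. \<forall>x2\<in>ball y r. R ?M n x1 x2" using local by blast
    have o: "openin (top_of_set \<Omega>) (ball y r)" using r(2) by (simp add: openin_open_eq \<Omega>(1))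
    have "\<exists>C>0. \<forall>\<^sub>F n in sequentially. R C n y x" if x: "x \<in> ball y r" for x
    proof -
      have "\<forall>\<^sub>F n in sequentially. R ?M n y x"
        using r(3) by (rule eventually_mono) (use x r(1) in auto)
      then show ?thesis using qc_constant_pos by blast
    qed
    then show "\<exists>T. openin (top_of_set \<Omega>) T \<and> y \<in> T \<and> (\<forall>x\<in>T. \<exists>C>0. \<forall>\<^sub>F n in sequentially. R C n y x)"
      using o r(1) by (intro exI[of _ "ball y r"]) auto
  qed
  then obtain C where C: "0 < C" "\<forall>\<^sub>F n in sequentially. R C n w0 w" by blast
  obtain r where r: "0 < r" "\<forall>\<^sub>F n in sequentially. \<forall>x1\<in>ball w0 r. \<forall>x2\<in>ball w0 r. R ?M n x1 x2"
    using local[OF w0(1)] by blast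
  have near: "\<forall>\<^sub>F n in sequentially. f n a \<in> ball w0 r"
    using tendstoD[OF w0(2) r(1)] by (simp add: dist_commute)
  obtain d where d: "0 < d" "ball a d \<subseteq> D" using D(1) a open_contains_ball by blast
  define c where "c = d / (?M * C)"
  have MC: "0 < ?M * C" using qc_constant_pos[of k] C(1) by simp
  have c: "0 < c" using d(1) MC by (simp add: c_def)
  define K where "K = (\<Inter>e\<in>-D. {z. c \<le> dist e z})"
  have "closed {z. c \<le> dist e z}" for e :: complex by (intro closed_Collect_le continuous_intros)
  then have "closed K" unfolding K_def by (intro closed_INT) auto
  moreover have KD: "K \<subseteq> D"
  proof
    fix z assume z: "z \<in> K"
    show "z \<in> D"
    proof (rule ccontr)
      assume "z \<notin> D"
      then have "c \<le> dist z z" using z unfolding K_def by blast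
      then show False using c by simp
    qed
  qed
  ultimately have "compact K" using D(2) bounded_subset compact_eq_bounded_closed by blast
  moreover have "\<forall>\<^sub>F n in sequentially. w \<in> f n ` D \<and> g n w \<in> K"
    using C(2) r(2) near
  proof eventually_elim
    case (elim n)
    have wD: "w \<in> f n ` D" using elim(1) by (simp add: R_def)
    have "c \<le> dist e (g n w)" if e: "e \<notin> D" for e
    proof -
      have "d \<le> dist a e" using d(2) e by (metis mem_ball not_le subsetD)
      also have "\<dots> = cmod (g n (f n a) - e)" using g[OF a] by (simp add: dist_norm)
      also have "\<dots> \<le> ?M * cmod (g n w0 - e)"
      proof -
        have "w0 \<in> ball w0 r" using r(1) by simp
        then have "R ?M n (f n a) w0" using elim(2,3) by blast
        then show ?thesis using e unfolding R_def by blast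
      qed
      also have "\<dots> \<le> ?M * (C * cmod (g n w - e))"
        using elim(1) e qc_constant_pos[of k] unfolding R_def by (intro mult_left_mono) auto
      finally have "d \<le> (?M * C) * dist e (g n w)" by (simp add: dist_norm norm_minus_commute mult.assoc)
      then show ?thesis using MC by (simp add: c_def pos_divide_le_eq mult.commute)
    qed
    then show ?case using wD by (auto simp: K_def)
  qed
  ultimately show ?thesis using KD by blast
qed

text \<open>
  The preimages accumulate at a point of \<open>K\<close>, and locally uniform convergence carries the equation over
  to it.
\<close>

lemma continuous_limit_along_compact_preimages:
  fixes f :: "nat \<Rightarrow> complex \<Rightarrow> complex"
  assumes unif: "\<And>z. z \<in> D \<Longrightarrow> \<exists>r>0. cball z r \<subseteq> D \<and> uniform_limit (cball z r) f F sequentially"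
    and contF: "continuous_on D F" and D: "open D"
    and K: "compact K" "K \<subseteq> D"
    and x: "\<forall>\<^sub>F n in sequentially. x n \<in> K \<and> f n (x n) = w"
  shows "w \<in> F ` K"
proof -
  obtain N where N: "\<And>n. n \<ge> N \<Longrightarrow> x n \<in> K \<and> f n (x n) = w" using x by (auto simp: eventually_sequentially)
  have "\<forall>n. x (n + N) \<in> K" using N by simp
  then obtain z t where t: "z \<in> K" "strict_mono (t :: nat \<Rightarrow> nat)" "((\<lambda>n. x (n + N)) \<circ> t) \<longlonglongrightarrow> z"
    using K(1) unfolding compact_def by meson
  define y where "y = (\<lambda>n. x (t n + N))"
  have y: "y \<longlonglongrightarrow> z" using t(3) by (simp add: y_def o_def)
  have zD: "z \<in> D" using t(1) K(2) by blast
  obtain r where r: "0 < r" "cball z r \<subseteq> D" "uniform_limit (cball z r) f F sequentially" using unif[OF zD] by blast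
  have sub: "filterlim (\<lambda>n. t n + N) sequentially sequentially"
    by (rule filterlim_compose[OF filterlim_add_const_nat_at_top filterlim_subseq[OF t(2)]])
  have "isCont F z" using contF D zD continuous_on_eq_continuous_at by blast
  then have lim1: "(\<lambda>n. F (y n)) \<longlonglongrightarrow> F z" using y isCont_tendsto_compose by blast
  have "(\<lambda>n. F (y n) - w) \<longlonglongrightarrow> 0"
  proof (rule tendstoI)
    fix e :: real assume e: "0 < e"
    have "\<forall>\<^sub>F n in sequentially. \<forall>x\<in>cball z r. dist (f (t n + N) x) (F x) < e"
      using eventually_compose_filterlim[OF uniform_limitD[OF r(3) e] sub] .
    moreover have "\<forall>\<^sub>F n in sequentially. dist (y n) z < r" using tendstoD[OF y r(1)] .
    ultimately show "\<forall>\<^sub>F n in sequentially. dist (F (y n) - w) 0 < e"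
    proof eventually_elim
      case (elim n)
      have "f (t n + N) (y n) = w" using N[of "t n + N"] by (simp add: y_def)
      moreover have "dist (f (t n + N) (y n)) (F (y n)) < e" using elim by (auto simp: dist_commute)
      ultimately show ?case by (simp add: dist_norm norm_minus_commute)
    qed
  qed
  then have "(\<lambda>n. F (y n)) \<longlonglongrightarrow> w" by (simp add: LIM_zero_iff)
  then have "F z = w" using lim1 LIMSEQ_unique by blast
  then show ?thesis using t(1) by blast
qed

lemma upper_half_plane_facts:
  "open upper_half_plane" "connected upper_half_plane" "interior {z. 0 \<le> Im z} = upper_half_plane"
proof -
  show "open upper_half_plane"
    unfolding upper_half_plane_def by (intro open_Collect_less continuous_intros)
  show "connected upper_half_plane"
    unfolding upper_half_plane_def by (intro convex_connected convex_halfspace_Im_gt)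
  have "{z. 0 \<le> Im z} = {z. \<i> \<bullet> z \<ge> 0}" by (simp add: inner_complex_def)
  then show "interior {z. 0 \<le> Im z} = upper_half_plane"
    using interior_halfspace_ge[of \<i> 0] by (auto simp: inner_complex_def upper_half_plane_def)
qed

text \<open>
  The assumption \<open>blow\<close> says that on every disc the images converge to the half-plane. The unit discs
  around \<open>f n a\<close> inside the images keep the limit of \<open>f n a\<close> off the real axis, so that it can serve
  as the base point for \<open>qc_harmonic_preimages_stay_inside\<close>.
\<close>

lemma qc_harmonic_limit_onto_half_plane:
  assumes k: "0 \<le> k" "k < 1" and D: "open D" "connected D" "bounded D" and a: "a \<in> D"
    and f: "\<And>n::nat. qc_harmonic_data k (f n) (H n) (G n) D" and inj: "\<And>n. inj_on (f n) D"
    and omit: "\<And>n. 0 \<notin> f n ` D" and bd: "\<And>n. cmod (f n a) \<le> 1" and room: "\<And>n. ball (f n a) 1 \<subseteq> f n ` D"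
    and blow: "\<And>R e. 0 < e \<Longrightarrow> \<forall>\<^sub>F n in sequentially. \<forall>\<zeta>. cmod \<zeta> \<le> R \<longrightarrow>
       (e < Im \<zeta> \<longrightarrow> \<zeta> \<in> f n ` D) \<and> (\<zeta> \<in> f n ` D \<longrightarrow> - e < Im \<zeta>)"
  shows "\<exists>\<psi>. qc_harmonic_diffeo k \<psi> D upper_half_plane"
proof -
  have bdd: "\<exists>r>0. \<exists>C. \<forall>n. \<forall>x\<in>ball z r. cmod (f n x) \<le> C" if "z \<in> D" for z
    by (rule qc_harmonic_family_locally_bounded[OF k D(1,2) a f inj omit bd that])
  obtain s F H' G' where s: "strict_mono (s :: nat \<Rightarrow> nat)" and hH': "H' holomorphic_on D" and hG': "G' holomorphic_on D"
    and derF: "\<And>z. z \<in> D \<Longrightarrow> (F has_derivative (\<lambda>h. H' z * h + cnj (G' z * h))) (at z)"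
    and dil: "\<And>z. z \<in> D \<Longrightarrow> cmod (G' z) \<le> k * cmod (H' z)"
    and uH: "\<And>K. \<lbrakk>compact K; K \<subseteq> D\<rbrakk> \<Longrightarrow> uniform_limit K (\<lambda>n. H (s n)) H' sequentially"
    and unif: "\<And>z. z \<in> D \<Longrightarrow> \<exists>r>0. cball z r \<subseteq> D \<and> uniform_limit (cball z r) (\<lambda>n. f (s n)) F sequentially"
  proof (rule harmonic_montel[OF D(1,2) a f])
    fix s F H' G'
    assume *: "strict_mono (s :: nat \<Rightarrow> nat)" "H' holomorphic_on D" "G' holomorphic_on D"
      "\<And>z. z \<in> D \<Longrightarrow> (F has_derivative (\<lambda>h. H' z * h + cnj (G' z * h))) (at z)"
      "\<And>z. z \<in> D \<Longrightarrow> cmod (G' z) \<le> k * cmod (H' z)"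
      "\<And>K. \<lbrakk>compact K; K \<subseteq> D\<rbrakk> \<Longrightarrow> uniform_limit K (\<lambda>n. H (s n)) H' sequentially"
      "\<And>z. z \<in> D \<Longrightarrow> \<exists>r>0. cball z r \<subseteq> D \<and> uniform_limit (cball z r) (\<lambda>n. f (s n)) F sequentially"
    show thesis by (rule that[OF *])
  qed (rule bdd)
  have subs: "filterlim s sequentially sequentially" using s by (rule filterlim_subseq)
  have blow': "\<forall>\<^sub>F n in sequentially. \<forall>\<zeta>. cmod \<zeta> \<le> R \<longrightarrow>
       (e < Im \<zeta> \<longrightarrow> \<zeta> \<in> f (s n) ` D) \<and> (\<zeta> \<in> f (s n) ` D \<longrightarrow> - e < Im \<zeta>)" if "0 < e" for R e
    using eventually_compose_filterlim[OF blow[OF that] subs] .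
  have limF: "(\<lambda>n. f (s n) z) \<longlonglongrightarrow> F z" if z: "z \<in> D" for z
  proof -
    obtain r where r: "0 < r" "uniform_limit (cball z r) (\<lambda>n. f (s n)) F sequentially" using unif[OF z] by blast
    then show ?thesis using tendsto_uniform_limitI[OF r(2), of z] by simp
  qed
  have contF: "continuous_on D F"
    by (intro continuous_at_imp_continuous_on ballI has_derivative_continuous[OF derF])
  have nonneg: "0 \<le> Im w" if w: "(\<lambda>n. x n) \<longlonglongrightarrow> w" "\<forall>\<^sub>F n in sequentially. x n \<in> f (s n) ` D" for w x
  proof (rule field_le_epsilon)
    fix e :: real assume e: "0 < e"
    have "\<forall>\<^sub>F n in sequentially. dist (x n) w < 1" using tendstoD[OF w(1)] by simp
    then have "\<forall>\<^sub>F n in sequentially. cmod (x n) \<le> cmod w + 1"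
    proof (rule eventually_mono)
      fix n assume "dist (x n) w < 1"
      then show "cmod (x n) \<le> cmod w + 1" using norm_triangle_sub[of "x n" w] by (simp add: dist_norm)
    qed
    with w(2) blow'[OF e, of "cmod w + 1"]
    have "\<forall>\<^sub>F n in sequentially. - e \<le> Im (x n)" by eventually_elim auto
    then have "- e \<le> Im w"
      by (intro tendsto_lowerbound[OF tendsto_Im[OF w(1)]]) auto
    then show "0 \<le> Im w + e" by simp
  qed
  \<comment> \<open>the image contains the point half a unit below \<open>f (s n) a\<close>\<close>
  have Fa: "F a \<in> upper_half_plane"
  proof -
    have "0 \<le> Im (F a - \<i> / 2)"
    proof (rule nonneg)
      show "(\<lambda>n. f (s n) a - \<i> / 2) \<longlonglongrightarrow> F a - \<i> / 2" by (intro tendsto_intros limF a)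
      have "f (s n) a - \<i> / 2 \<in> ball (f (s n) a) 1" for n by (simp add: dist_norm norm_divide)
      then show "\<forall>\<^sub>F n in sequentially. f (s n) a - \<i> / 2 \<in> f (s n) ` D"
        by (intro always_eventually allI subsetD[OF room])
    qed
    then show ?thesis by (simp add: upper_half_plane_def)
  qed
  have onto: "w \<in> F ` D" if w: "w \<in> upper_half_plane" for w
  proof -
    define g where "g = (\<lambda>n. inv_into D (f (s n)))"
    have g: "g n (f (s n) z) = z" if "z \<in> D" for n z unfolding g_def using inj that by simp
    have "\<exists>K. compact K \<and> K \<subseteq> D \<and> (\<forall>\<^sub>F n in sequentially. w \<in> f (s n) ` D \<and> g n w \<in> K)"
    proof (rule qc_harmonic_preimages_stay_inside[where f = "\<lambda>n. f (s n)" and g = g, OF k D(1,3) a f inj g upper_half_plane_facts(1,2) _ Fa limF[OF a] w])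
      fix u assume u: "u \<in> upper_half_plane"
      define r where "r = Im u / 2"
      have r: "0 < r" using u by (simp add: r_def upper_half_plane_def)
      have Im: "r < Im v" and nv: "cmod v \<le> cmod u + r" if v: "v \<in> ball u r" for v
      proof -
        have "\<bar>Im (u - v)\<bar> < r" using v abs_Im_le_cmod[of "u - v"] by (simp add: dist_norm)
        moreover have "Im u = r + r" by (simp add: r_def)
        ultimately show "r < Im v" unfolding minus_complex.sel by linarith
        show "cmod v \<le> cmod u + r" using v norm_triangle_sub[of v u] by (simp add: dist_norm norm_minus_commute)
      qed
      have "ball u r \<subseteq> upper_half_plane" using Im r by (fastforce simp: upper_half_plane_def)
      moreover have "\<forall>\<^sub>F n in sequentially. ball u r \<subseteq> f (s n) ` D"
        using blow'[OF r, of "cmod u + r"] by (rule eventually_mono) (use Im nv in blast)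
      ultimately show "\<exists>r>0. ball u r \<subseteq> upper_half_plane \<and> (\<forall>\<^sub>F n in sequentially. ball u r \<subseteq> f (s n) ` D)"
        using r by blast
    qed
    then obtain K where K: "compact K" "K \<subseteq> D" "\<forall>\<^sub>F n in sequentially. w \<in> f (s n) ` D \<and> g n w \<in> K" by blast
    have ev: "\<forall>\<^sub>F n in sequentially. g n w \<in> K \<and> f (s n) (g n w) = w"
      using K(3) by (rule eventually_mono) (use g in auto)
    have "w \<in> F ` K"
      by (rule continuous_limit_along_compact_preimages[where x = "\<lambda>n. g n w", OF unif contF D(1) K(1,2) ev])
    then show ?thesis using K(2) by blast
  qed
  have nz: "H' z \<noteq> 0" if z: "z \<in> D" for z
  \<comment> \<open>Hurwitz' theorem leaves the constants as an exception; the constant 0 would make \<open>F\<close> constant\<close>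
  proof (cases "H' constant_on D")
    case True
    then obtain c where c: "\<And>x. x \<in> D \<Longrightarrow> H' x = c" by (auto simp: constant_on_def)
    have "c \<noteq> 0"
    proof
      assume "c = 0"
      then have 0: "H' x = 0" "G' x = 0" if "x \<in> D" for x using c[OF that] dil[OF that] by auto
      have "(F has_derivative (\<lambda>h. 0)) (at x within D)" if "x \<in> D" for x
        using has_derivative_at_withinI[OF derF[OF that]] 0[OF that] by simp
      then obtain d where "\<And>x. x \<in> D \<Longrightarrow> F x = d"
        using has_derivative_zero_connected_constant_on[OF D(2) D(1), of "{}" F] contF by (auto simp: constant_on_def)
      moreover have "\<i> \<in> F ` D" "2 * \<i> \<in> F ` D" by (rule onto; simp add: upper_half_plane_def)+
      ultimately have "\<i> = 2 * \<i>" by (metis imageE)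
      then show False by simp
    qed
    then show ?thesis using c z by simp
  next
    case False
    have "H (s n) holomorphic_on D" "\<And>x. x \<in> D \<Longrightarrow> H (s n) x \<noteq> 0" for n using f by (auto simp: qc_harmonic_data_def)
    then show ?thesis using Hurwitz_no_zeros[OF D(1,2) _ hH' uH False _ z] by blast
  qed
  have data: "qc_harmonic_data k F H' G' D"
    using hH' hG' derF dil nz by (auto simp: qc_harmonic_data_def)
  have injF: "inj_on F D"
    by (rule limit_of_injective_qc_harmonic_is_injective[where f = "\<lambda>n. f (s n)", OF k D(1) f inj unif data])
  have "open (F ` D)" using invariance_of_domain[OF contF D(1) injF] .
  moreover have "F ` D \<subseteq> {z. 0 \<le> Im z}"
  proof safe
    fix z assume z: "z \<in> D"
    show "0 \<le> Im (F z)" by (rule nonneg[OF limF[OF z]]) (use z in auto)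
  qed
  ultimately have "F ` D \<subseteq> upper_half_plane" using interior_maximal upper_half_plane_facts(3) by blast
  then have "bij_betw F D upper_half_plane" using onto injF by (auto simp: bij_betw_def)
  then show ?thesis using qc_harmonic_data_imp_diffeo[OF k D(1) data] by blast
qed

section \<open>Scaling at a smooth boundary point\<close>

text \<open>
  The derivative at the one point \<open>p\<close> serves for all pairs of points near \<open>p\<close>. This uniformity is needed
  because the boundary points at which the domain is scaled vary.
\<close>

lemma Ck_on_1_first_order_expansion:
  fixes \<rho> :: "complex \<Rightarrow> real"
  assumes U: "open U" "p \<in> U" and C: "Ck_on 1 \<rho> U" and e: "0 < e"
  shows "\<exists>\<eta>>0. ball p \<eta> \<subseteq> U \<and> (\<forall>x\<in>ball p \<eta>. \<forall>y\<in>ball p \<eta>.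
     \<bar>\<rho> x - \<rho> y - frechet_derivative \<rho> (at p) (x - y)\<bar> \<le> e * cmod (x - y))"
proof -
  let ?D = "\<lambda>x. frechet_derivative \<rho> (at x)"
  have der: "(\<rho> has_derivative ?D x) (at x)" if "x \<in> U" for x
    using C that frechet_derivative_works by auto
  have lim: "((\<lambda>x. ?D x v) \<longlongrightarrow> ?D p v) (nhds p)" for v
  proof -
    have "continuous_on U (\<lambda>x. ?D x v)" using C by simp
    then have "isCont (\<lambda>x. ?D x v) p" using continuous_on_eq_continuous_at[OF U(1)] U(2) by blast
    then show ?thesis using tendsto_at_iff_tendsto_nhds[of "\<lambda>x. ?D x v" p] by (simp add: isCont_def)
  qed
  have "\<forall>\<^sub>F x in nhds p. dist (?D x 1) (?D p 1) < e/2 \<and> dist (?D x \<i>) (?D p \<i>) < e/2 \<and> x \<in> U"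
    by (intro eventually_conj tendstoD[OF lim] eventually_nhds_in_open U) (use e in auto)
  then obtain \<eta> where \<eta>: "0 < \<eta>" "\<And>x. dist x p < \<eta> \<Longrightarrow> dist (?D x 1) (?D p 1) < e/2 \<and> dist (?D x \<i>) (?D p \<i>) < e/2 \<and> x \<in> U"
    unfolding eventually_nhds_metric by blast
  have split: "?D x h = Re h * ?D x 1 + Im h * ?D x \<i>" if "x \<in> U" for x h
  proof -
    have "h = Re h *\<^sub>R 1 + Im h *\<^sub>R \<i>" by (simp add: complex_eq_iff)
    then have "?D x h = ?D x (Re h *\<^sub>R 1 + Im h *\<^sub>R \<i>)" by simp
    then show ?thesis
      using has_derivative_linear[OF der[OF that]] by (simp add: linear_add linear_scale)
  qed
  have blD: "bounded_linear (?D p)" using der[OF U(2)] by (rule has_derivative_bounded_linear)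
  have "\<bar>\<rho> x - \<rho> y - ?D p (x - y)\<bar> \<le> e * cmod (x - y)" if xy: "x \<in> ball p \<eta>" "y \<in> ball p \<eta>" for x y
  proof -
    have "norm ((\<rho> x - ?D p x) - (\<rho> y - ?D p y)) \<le> e * norm (x - y)"
    proof (rule differentiable_bound[OF convex_ball[of p \<eta>]])
      fix z assume z: "z \<in> ball p \<eta>"
      then have zU: "z \<in> U" and near: "\<bar>?D z 1 - ?D p 1\<bar> < e/2" "\<bar>?D z \<i> - ?D p \<i>\<bar> < e/2"
        using \<eta>(2)[of z] z by (simp_all add: dist_commute[of p] dist_real_def)
      show "((\<lambda>x. \<rho> x - ?D p x) has_derivative (\<lambda>h. ?D z h - ?D p h)) (at z within ball p \<eta>)"
        by (rule has_derivative_at_withinI[OF has_derivative_diff[OF der[OF zU] bounded_linear_imp_has_derivative[OF blD]]])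
      show "onorm (\<lambda>h. ?D z h - ?D p h) \<le> e"
      proof (rule onorm_le)
        fix h :: complex
        have "?D z h - ?D p h = Re h * (?D z 1 - ?D p 1) + Im h * (?D z \<i> - ?D p \<i>)"
          unfolding split[OF zU, of h] split[OF U(2), of h] by (simp add: algebra_simps)
        then have "norm (?D z h - ?D p h) \<le> \<bar>Re h\<bar> * \<bar>?D z 1 - ?D p 1\<bar> + \<bar>Im h\<bar> * \<bar>?D z \<i> - ?D p \<i>\<bar>"
          using abs_triangle_ineq[of "Re h * (?D z 1 - ?D p 1)" "Im h * (?D z \<i> - ?D p \<i>)"] by (simp add: abs_mult)
        also have "\<dots> \<le> cmod h * (e/2) + cmod h * (e/2)"
          using near by (intro add_mono mult_mono abs_Re_le_cmod abs_Im_le_cmod) auto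
        finally show "norm (?D z h - ?D p h) \<le> e * norm h" by (simp add: mult.commute)
      qed
    qed (use xy in auto)
    moreover have "?D p (x - y) = ?D p x - ?D p y"
      using blD by (simp add: linear_diff bounded_linear.linear)
    ultimately show ?thesis by (simp add: algebra_simps)
  qed
  moreover have "ball p \<eta> \<subseteq> U" using \<eta>(2) by (auto simp: dist_commute)
  ultimately show ?thesis using \<eta>(1) by blast
qed

text \<open>
  In the coordinate \<open>\<zeta>\<close> with \<open>x = q + c \<zeta>\<close> the domain is given, up to an error \<open>e |\<zeta>|\<close>, by
  \<open>Im \<zeta> > 0\<close>. One rotation \<open>c\<close>, taken from the gradient of \<open>\<rho>\<close> at \<open>p\<close>, works for all boundary points
  \<open>q\<close> near \<open>p\<close>.
\<close>

lemma C2_boundary_point_half_plane_approximation: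
  assumes D: "open D" and p: "C2_boundary_point D p"
  obtains c where "cmod c = 1"
    "\<And>e. 0 < e \<Longrightarrow> \<exists>\<eta>>0. \<forall>q\<in>frontier D \<inter> ball p \<eta>. \<forall>\<zeta>. q + c * \<zeta> \<in> ball p \<eta> \<longrightarrow>
       (e * cmod \<zeta> < Im \<zeta> \<longrightarrow> q + c * \<zeta> \<in> D) \<and> (q + c * \<zeta> \<in> D \<longrightarrow> - e * cmod \<zeta> < Im \<zeta>)"
proof -
  obtain U and \<rho> :: "complex \<Rightarrow> real" where U: "open U" "p \<in> U" and C2: "Ck_on 2 \<rho> U"
    and UD: "U \<inter> D = {z \<in> U. \<rho> z < 0}"
    and nz: "\<forall>z\<in>U \<inter> frontier D. frechet_derivative \<rho> (at z) \<noteq> (\<lambda>_. 0)" and pf: "p \<in> frontier D"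
    using p unfolding C2_boundary_point_def by blast
  let ?D = "frechet_derivative \<rho> (at p)"
  have diff: "\<rho> differentiable (at x)" if "x \<in> U" for x using Ck_on_2D(1)[OF C2 that] .
  have "(\<lambda>x. frechet_derivative \<rho> (at x) v) differentiable (at x)" if "x \<in> U" for x v
    using Ck_on_2D(2)[OF C2 that] .
  then have C1: "Ck_on 1 \<rho> U"
    using diff by (auto intro!: continuous_at_imp_continuous_on differentiable_imp_continuous_within)
  have contr: "continuous_on U \<rho>"
    using diff by (intro continuous_at_imp_continuous_on ballI differentiable_imp_continuous_within) auto
  have zero: "\<rho> q = 0" if q: "q \<in> frontier D" "q \<in> U" for q
  proof (rule antisym)
    show "\<rho> q \<le> 0"
    proof (rule ccontr)
      assume "\<not> \<rho> q \<le> 0"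
      then have "q \<in> U \<inter> \<rho> -` {0<..}" using q by auto
      moreover have "open (U \<inter> \<rho> -` {0<..})" using contr U(1) by (simp add: continuous_open_preimage)
      moreover have "q \<in> closure D" using q by (simp add: frontier_def)
      ultimately obtain x where "x \<in> D" "x \<in> U \<inter> \<rho> -` {0<..}"
        by (metis closure_iff_nhds_not_empty disjoint_iff order_refl)
      then have "x \<in> {z \<in> U. \<rho> z < 0}" "0 < \<rho> x" unfolding UD[symmetric] by simp_all
      then show False by simp
    qed
    show "0 \<le> \<rho> q" using q UD D by (auto simp: frontier_def interior_open not_less[symmetric])
  qed
  define N where "N = Complex (?D 1) (?D \<i>)"
  have DN: "?D h = Re (cnj N * h)" for h
  proof -
    have "(\<rho> has_derivative ?D) (at p)" using diff[OF U(2)] frechet_derivative_works by blast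
    then have lin: "linear ?D" by (rule has_derivative_linear)
    have "h = Re h *\<^sub>R 1 + Im h *\<^sub>R \<i>" by (simp add: complex_eq_iff)
    then have "?D h = ?D (Re h *\<^sub>R 1 + Im h *\<^sub>R \<i>)" by simp
    then show ?thesis using lin by (simp add: linear_add linear_scale N_def)
  qed
  have N: "N \<noteq> 0"
  proof
    assume "N = 0"
    then have "?D = (\<lambda>_. 0)" using DN by (simp add: fun_eq_iff)
    then show False using nz U(2) pf by blast
  qed
  \<comment> \<open>rotates \<open>-i\<close>, the outer normal of the half-plane, to the outer normal \<open>N / |N|\<close>\<close>
  define c where "c = \<i> * N / of_real (cmod N)"
  have c1: "cmod c = 1" using N by (simp add: c_def norm_mult norm_divide)
  have Dc: "?D (c * \<zeta>) = - cmod N * Im \<zeta>" for \<zeta>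
  proof -
    have "cnj N * (c * \<zeta>) = (N * cnj N) * (\<i> * \<zeta>) / of_real (cmod N)" by (simp add: c_def mult_ac)
    also have "\<dots> = of_real (cmod N) * (\<i> * \<zeta>)"
      using N by (simp add: complex_norm_square[symmetric] power2_eq_square)
    finally have E: "cnj N * (c * \<zeta>) = of_real (cmod N) * (\<i> * \<zeta>)" .
    show ?thesis unfolding DN E by simp
  qed
  show ?thesis
  proof (rule that[OF c1])
    fix e :: real assume e: "0 < e"
    then have "0 < e * cmod N" using N by simp
    from Ck_on_1_first_order_expansion[OF U C1 this] obtain \<eta> where \<eta>: "0 < \<eta>" "ball p \<eta> \<subseteq> U"
      "\<And>x y. x \<in> ball p \<eta> \<Longrightarrow> y \<in> ball p \<eta> \<Longrightarrow> \<bar>\<rho> x - \<rho> y - ?D (x - y)\<bar> \<le> e * cmod N * cmod (x - y)" by blast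
    have "(e * cmod \<zeta> < Im \<zeta> \<longrightarrow> q + c * \<zeta> \<in> D) \<and> (q + c * \<zeta> \<in> D \<longrightarrow> - e * cmod \<zeta> < Im \<zeta>)"
      if q: "q \<in> frontier D \<inter> ball p \<eta>" and \<zeta>: "q + c * \<zeta> \<in> ball p \<eta>" for q \<zeta>
    proof -
      have q0: "\<rho> q = 0" using zero q \<eta>(2) by blast
      have "\<bar>\<rho> (q + c * \<zeta>) - \<rho> q - ?D (q + c * \<zeta> - q)\<bar> \<le> e * cmod N * cmod (q + c * \<zeta> - q)"
        by (rule \<eta>(3)[OF \<zeta>]) (use q in simp)
      then have est: "\<bar>\<rho> (q + c * \<zeta>) + cmod N * Im \<zeta>\<bar> \<le> cmod N * (e * cmod \<zeta>)"
        unfolding add_diff_cancel_left' Dc norm_mult c1 q0 by (simp add: mult_ac)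
      have inU: "q + c * \<zeta> \<in> U" using \<zeta> \<eta>(2) by blast
      have Np: "0 < cmod N" using N by simp
      show ?thesis
      proof (intro conjI impI)
        assume "e * cmod \<zeta> < Im \<zeta>"
        then have "cmod N * (e * cmod \<zeta>) < cmod N * Im \<zeta>" using Np by (rule mult_strict_left_mono)
        then have "\<rho> (q + c * \<zeta>) < 0" using est by linarith
        then show "q + c * \<zeta> \<in> D" using UD inU by blast
      next
        assume "q + c * \<zeta> \<in> D"
        then have "\<rho> (q + c * \<zeta>) < 0" using UD inU by blast
        then have "cmod N * (- e * cmod \<zeta>) < cmod N * Im \<zeta>" using est by (simp add: abs_le_iff)
        then show "- e * cmod \<zeta> < Im \<zeta>" using Np by (simp only: mult_less_cancel_left_pos)
      qed
    qed
    then show "\<exists>\<eta>>0. \<forall>q\<in>frontier D \<inter> ball p \<eta>. \<forall>\<zeta>. q + c * \<zeta> \<in> ball p \<eta> \<longrightarrow>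
       (e * cmod \<zeta> < Im \<zeta> \<longrightarrow> q + c * \<zeta> \<in> D) \<and> (q + c * \<zeta> \<in> D \<longrightarrow> - e * cmod \<zeta> < Im \<zeta>)"
      using \<eta>(1) by blast
  qed
qed

lemma qc_harmonic_data_affine:
  assumes "qc_harmonic_data k f H G D" and s: "s \<noteq> 0"
  shows "qc_harmonic_data k (\<lambda>z. (f z - q) / s) (\<lambda>z. H z / s) (\<lambda>z. G z / cnj s) D"
  unfolding qc_harmonic_data_def
proof (intro conjI ballI)
  show "(\<lambda>z. H z / s) holomorphic_on D" "(\<lambda>z. G z / cnj s) holomorphic_on D"
    using assms by (auto simp: qc_harmonic_data_def intro!: holomorphic_intros)
  fix z assume z: "z \<in> D"
  have "(f has_derivative (\<lambda>h. H z * h + cnj (G z * h))) (at z)" using assms z by (auto simp: qc_harmonic_data_def)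
  then have "((\<lambda>z. (f z - q) / s) has_derivative (\<lambda>h. (H z * h + cnj (G z * h) - 0) / s)) (at z)"
    by (intro bounded_linear.has_derivative[OF bounded_linear_divide] has_derivative_diff has_derivative_const)
  then show "((\<lambda>z. (f z - q) / s) has_derivative (\<lambda>h. H z / s * h + cnj (G z / cnj s * h))) (at z)"
    by (simp add: add_divide_distrib)
  show "cmod (G z / cnj s) \<le> k * cmod (H z / s)" "H z / s \<noteq> 0"
    using assms z s by (auto simp: qc_harmonic_data_def norm_divide divide_right_mono)
qed

theorem theorem1p2:
  fixes D :: "complex set" and p a :: complex and k :: real
    and \<phi> :: "nat \<Rightarrow> complex \<Rightarrow> complex"
  assumes "planar_domain D" and "bounded D"
    and "C2_boundary_point D p"
    and "0 \<le> k" and "k < 1"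
    and "a \<in> D"
    and "\<And>j. qc_harmonic_diffeo k (\<phi> j) D D"
    and "(\<lambda>j. \<phi> j a) \<longlonglongrightarrow> p"
  shows "\<exists>\<psi>. qc_harmonic_diffeo k \<psi> D upper_half_plane"
proof -
  have D: "open D" "connected D" using assms(1) by (auto simp: planar_domain_def)
  have pf: "p \<in> frontier D" using assms(3) by (simp add: C2_boundary_point_def)
  obtain c where c: "cmod c = 1"
    "\<And>e. 0 < e \<Longrightarrow> \<exists>\<eta>>0. \<forall>q\<in>frontier D \<inter> ball p \<eta>. \<forall>\<zeta>. q + c * \<zeta> \<in> ball p \<eta> \<longrightarrow>
       (e * cmod \<zeta> < Im \<zeta> \<longrightarrow> q + c * \<zeta> \<in> D) \<and> (q + c * \<zeta> \<in> D \<longrightarrow> - e * cmod \<zeta> < Im \<zeta>)"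
    by (rule C2_boundary_point_half_plane_approximation[OF D(1) assms(3)]) (rule that)
  have c0: "c \<noteq> 0" using c(1) by auto
  have "\<exists>q\<in>frontier D. \<forall>y\<in>frontier D. dist (\<phi> j a) q \<le> dist (\<phi> j a) y" for j
  proof -
    have ne: "frontier D \<noteq> {}" using pf by blast
    show ?thesis by (rule distance_attains_inf[OF frontier_closed ne, of "\<phi> j a"]) (rule bexI, rule ballI)
  qed
  then obtain q where q: "\<And>j. q j \<in> frontier D" "\<And>j y. y \<in> frontier D \<Longrightarrow> dist (\<phi> j a) (q j) \<le> dist (\<phi> j a) y"
    by metis
  define \<delta> where "\<delta> = (\<lambda>j. dist (\<phi> j a) (q j))"
  have data: "qc_harmonic_data k (\<phi> j) (d_z (\<phi> j)) (\<lambda>z. cnj (d_zbar (\<phi> j) z)) D" and bij: "bij_betw (\<phi> j) D D" for j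
    by (rule qc_harmonic_diffeo_imp_data[OF D(1) assms(7)])+
  have img: "\<phi> j ` D = D" and inj: "inj_on (\<phi> j) D" for j using bij by (auto simp: bij_betw_def)
  have \<phi>a: "\<phi> j a \<in> D" for j using imageI[OF assms(6), of "\<phi> j"] unfolding img .
  have qD: "q j \<notin> D" for j using q(1)[of j] D(1) by (auto simp: frontier_def interior_open)
  have \<delta>: "0 < \<delta> j" for j using \<phi>a[of j] qD[of j] by (auto simp: \<delta>_def)
  have room: "ball (\<phi> j a) (\<delta> j) \<subseteq> D" for j
  proof (rule ccontr)
    assume "\<not> ball (\<phi> j a) (\<delta> j) \<subseteq> D"
    moreover have "\<phi> j a \<in> ball (\<phi> j a) (\<delta> j) \<inter> D" using \<phi>a[of j] \<delta>[of j] by simp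
    then have "ball (\<phi> j a) (\<delta> j) \<inter> D \<noteq> {}" by blast
    ultimately have "ball (\<phi> j a) (\<delta> j) \<inter> frontier D \<noteq> {}"
      by (intro connected_Int_frontier) auto
    then show False using q(2)[of _ j] by (auto simp: \<delta>_def not_less[symmetric])
  qed
  have \<delta>0: "\<delta> \<longlonglongrightarrow> 0"
  proof (rule tendsto_sandwich[OF _ _ tendsto_const])
    show "\<forall>\<^sub>F j in sequentially. 0 \<le> \<delta> j" by (intro always_eventually allI less_imp_le[OF \<delta>])
    show "\<forall>\<^sub>F j in sequentially. \<delta> j \<le> dist (\<phi> j a) p" unfolding \<delta>_def by (intro always_eventually allI q(2)[OF pf])
    show "(\<lambda>j. dist (\<phi> j a) p) \<longlonglongrightarrow> 0" by (rule iffD1[OF tendsto_dist_iff assms(8)])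
  qed
  have qp: "q \<longlonglongrightarrow> p"
  proof -
    have "(\<lambda>j. dist (q j) p) \<longlonglongrightarrow> 0"
    proof (rule tendsto_sandwich[OF _ _ tendsto_const])
      show "\<forall>\<^sub>F j in sequentially. dist (q j) p \<le> \<delta> j + dist (\<phi> j a) p"
        unfolding \<delta>_def by (intro always_eventually allI dist_triangle3)
      have "(\<lambda>j. \<delta> j + dist (\<phi> j a) p) \<longlonglongrightarrow> 0 + 0"
        by (rule tendsto_add[OF \<delta>0 iffD1[OF tendsto_dist_iff assms(8)]])
      then show "(\<lambda>j. \<delta> j + dist (\<phi> j a) p) \<longlonglongrightarrow> 0" by simp
    qed simp
    then show ?thesis by (rule iffD2[OF tendsto_dist_iff])
  qed
  define s where "s = (\<lambda>j. c * of_real (\<delta> j))"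
  have s: "s j \<noteq> 0" "cmod (s j) = \<delta> j" for j using c0 c(1) \<delta>[of j] by (auto simp: s_def norm_mult)
  define f where "f = (\<lambda>j z. (\<phi> j z - q j) / s j)"
  have fimg: "\<zeta> \<in> f j ` D \<longleftrightarrow> q j + s j * \<zeta> \<in> D" for j \<zeta>
  proof -
    have "\<zeta> \<in> f j ` D \<longleftrightarrow> (\<exists>w\<in>\<phi> j ` D. \<zeta> = (w - q j) / s j)" by (auto simp: f_def)
    also have "\<dots> \<longleftrightarrow> q j + s j * \<zeta> \<in> D" unfolding img using s(1)[of j] by (auto simp: field_simps)
    finally show ?thesis .
  qed
  show ?thesis
  proof (rule qc_harmonic_limit_onto_half_plane[where f = f, OF assms(4,5) D assms(2,6)])
    show "qc_harmonic_data k (f j) (\<lambda>z. d_z (\<phi> j) z / s j) (\<lambda>z. cnj (d_zbar (\<phi> j) z) / cnj (s j)) D" for j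
      unfolding f_def by (rule qc_harmonic_data_affine[OF data s(1)])
    show "inj_on (f j) D" for j
    proof (rule inj_onI)
      fix x y assume xy: "x \<in> D" "y \<in> D" "f j x = f j y"
      then have "\<phi> j x = \<phi> j y" using s(1)[of j] by (simp add: f_def)
      then show "x = y" using inj xy by (auto dest: inj_onD)
    qed
    show "0 \<notin> f j ` D" for j unfolding fimg using qD by simp
    have fa: "q j + s j * f j a = \<phi> j a" for j using s(1)[of j] by (simp add: f_def)
    show "cmod (f j a) \<le> 1" for j
      using \<delta>[of j] by (simp add: f_def norm_divide s(2)) (simp add: \<delta>_def dist_norm)
    show "ball (f j a) 1 \<subseteq> f j ` D" for j
    proof
      fix \<zeta> assume \<zeta>: "\<zeta> \<in> ball (f j a) 1"
      have "dist (\<phi> j a) (q j + s j * \<zeta>) = cmod (s j * (f j a - \<zeta>))"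
        unfolding fa[symmetric] dist_norm by (simp add: algebra_simps)
      also have "\<dots> = \<delta> j * dist (f j a) \<zeta>" by (simp add: norm_mult s(2) dist_norm)
      also have "\<dots> < \<delta> j * 1" using \<zeta> \<delta>[of j] by (intro mult_strict_left_mono) auto
      finally show "\<zeta> \<in> f j ` D" unfolding fimg using room[of j] by (auto simp: subset_iff)
    qed
    fix R e :: real assume e: "0 < e"
    \<comment> \<open>makes the error \<open>e' |\<zeta>|\<close> smaller than \<open>e\<close> for \<open>|\<zeta>| \<le> R\<close>\<close>
    define e' where "e' = e / (\<bar>R\<bar> + 1)"
    have e': "0 < e'" using e by (simp add: e'_def)
    obtain \<eta> where \<eta>: "0 < \<eta>" "\<And>q' \<zeta>. q' \<in> frontier D \<inter> ball p \<eta> \<Longrightarrow> q' + c * \<zeta> \<in> ball p \<eta> \<Longrightarrow>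
       (e' * cmod \<zeta> < Im \<zeta> \<longrightarrow> q' + c * \<zeta> \<in> D) \<and> (q' + c * \<zeta> \<in> D \<longrightarrow> - e' * cmod \<zeta> < Im \<zeta>)"
      using c(2)[OF e'] by blast
    have "(\<lambda>j. \<bar>R\<bar> * \<delta> j) \<longlonglongrightarrow> \<bar>R\<bar> * 0" by (intro tendsto_intros \<delta>0)
    then have "\<forall>\<^sub>F j in sequentially. \<bar>R\<bar> * \<delta> j < \<eta>/2" using \<eta>(1) by (intro order_tendstoD(2)) auto
    moreover have "\<forall>\<^sub>F j in sequentially. dist (q j) p < \<eta>/2" using tendstoD[OF qp, of "\<eta>/2"] \<eta>(1) by simp
    ultimately show "\<forall>\<^sub>F j in sequentially. \<forall>\<zeta>. cmod \<zeta> \<le> R \<longrightarrow>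
       (e < Im \<zeta> \<longrightarrow> \<zeta> \<in> f j ` D) \<and> (\<zeta> \<in> f j ` D \<longrightarrow> - e < Im \<zeta>)"
    proof eventually_elim
      case (elim j)
      show ?case
      proof (intro allI impI)
        fix \<zeta> assume \<zeta>: "cmod \<zeta> \<le> R"
        have "cmod (s j * \<zeta>) \<le> \<bar>R\<bar> * \<delta> j"
        proof -
          have "cmod (s j * \<zeta>) = cmod \<zeta> * \<delta> j" by (simp add: norm_mult s(2))
          also have "\<dots> \<le> \<bar>R\<bar> * \<delta> j" using \<zeta> \<delta>[of j] by (intro mult_right_mono) auto
          finally show ?thesis .
        qed
        then have "dist (q j + s j * \<zeta>) (q j) < \<eta>/2" using elim(1) by (simp add: dist_norm)
        then have "dist (q j + s j * \<zeta>) p < \<eta>"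
          using elim(2) dist_triangle[of "q j + s j * \<zeta>" p "q j"] by simp
        then have in1: "q j + c * (of_real (\<delta> j) * \<zeta>) \<in> ball p \<eta>" by (simp add: s_def mult.assoc dist_commute)
        have in2: "q j \<in> frontier D \<inter> ball p \<eta>" using q(1)[of j] elim(2) \<eta>(1) by (simp add: dist_commute)
        have "e' * cmod \<zeta> < e"
        proof -
          have "e' * cmod \<zeta> \<le> e' * \<bar>R\<bar>" using \<zeta> e' by (intro mult_left_mono) auto
          also have "\<dots> < e' * (\<bar>R\<bar> + 1)" using e' by simp
          also have "\<dots> = e" by (simp add: e'_def)
          finally show ?thesis .
        qed
        then have "e' * (\<delta> j * cmod \<zeta>) < \<delta> j * e"
          using mult_strict_left_mono[of "e' * cmod \<zeta>" e "\<delta> j"] \<delta>[of j] by (simp add: mult_ac)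
        moreover have "(e' * (\<delta> j * cmod \<zeta>) < \<delta> j * Im \<zeta> \<longrightarrow> \<zeta> \<in> f j ` D) \<and> (\<zeta> \<in> f j ` D \<longrightarrow> - e' * (\<delta> j * cmod \<zeta>) < \<delta> j * Im \<zeta>)"
          using \<eta>(2)[OF in2 in1] \<delta>[of j] unfolding fimg by (simp add: norm_mult s_def mult_ac)
        moreover have "\<delta> j * e < \<delta> j * Im \<zeta>" if "e < Im \<zeta>" using that \<delta>[of j] by simp
        moreover have "- e < Im \<zeta>" if "- (\<delta> j * e) < \<delta> j * Im \<zeta>"
        proof -
          have "\<delta> j * (- e) < \<delta> j * Im \<zeta>" using that by simp
          then show ?thesis using \<delta>[of j] by (simp only: mult_less_cancel_left_pos)
        qed
        ultimately show "(e < Im \<zeta> \<longrightarrow> \<zeta> \<in> f j ` D) \<and> (\<zeta> \<in> f j ` D \<longrightarrow> - e < Im \<zeta>)" by fastforce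
      qed
    qed
  qed
qed

end
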